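(* Let $A\ge0$ be a closed densely defined nonnegative symmetric operator in a separable Hilbert space $\mathfrak H$, let $\{\mathcal H,\Gamma_0,\Gamma_1\}$ be a boundary triplet for $A^*$ with Weyl function $M(z)$, and let $A_0=A_0^*$ be the extension of $A$ with $\operatorname{dom}(A_0)=\ker\Gamma_0$. Then $M\in(\widehat S)$ if and only if the operator $A_0$ is nonnegative and transversal to the Friedrichs extension $\widetilde A_F$ of $A$.
   Context: $[\mathcal H]$ denotes the bounded everywhere defined operators on $\mathcal H$. A boundary triplet for $A^*$ is a triple $\{\mathcal H,\Gamma_0,\Gamma_1\}$, where $\mathcal H$ is a Hilbert space and $\Gamma_0,\Gamma_1:\operatorname{dom}(A^* )\to\mathcal H$ are linear maps such that (i) $(A^*f,g)_{\mathfrak H}-(f,A^*g)_{\mathfrak H}=(\Gamma_1f,\Gamma_0g)_{\mathcal H}-(\Gamma_0f,\Gamma_1g)_{\mathcal H}$ for all $f,g\in\operatorname{dom}(A^* )$, and (ii) $f\mapsto(\Gamma_1f,\Gamma_0f)$ maps $\operatorname{dom}(A^* )$ onto $\mathcal H\oplus\mathcal H$. The Weyl function is the $[\mathcal H]$-valued function $M(z)$, $z\in\rho(A_0)$, defined by $M(z)\Gamma_0f_z=\Gamma_1f_z$ for $f_z\in\ker(A^*-z)$. Two proper extensions $\widetilde A_0,\widetilde A_1$ of $A$ (i.e. $A\subset\widetilde A_j\subset A^*$) are transversal if $\operatorname{dom}(\widetilde A_0)\cap\operatorname{dom}(\widetilde A_1)=\operatorname{dom}(A)$ and $\operatorname{dom}(\widetilde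 A_0)+\operatorname{dom}(\widetilde A_1)=\operatorname{dom}(A^* )$. Class $(R)$: functions holomorphic in $\mathbb C_+$ with values in $[\mathcal H]$ and nonnegative imaginary part there. Class $(S)$ (Stieltjes functions): $[\mathcal H]$-valued functions $F$ holomorphic on $\mathbb C\setminus[0,\infty)$ which belong to $(R)$ on $\mathbb C_+$ and satisfy $F(x)\ge0$ for all $x<0$. $M\in(\widehat S)$ means that $M(z)=F(z)+K$ with some $F\in(S)$ and some $K=K^*\in[\mathcal H]$; here $M$ is identified with its holomorphic continuation to $\mathbb C\setminus[0,\infty)$ if such exists. *)

theory Defs
  imports "HOL-Analysis.Analysis"
begin

section \<open>Complex Hilbert spaces\<close>

text \<open>
  The complex structure is added on top of the library class of real inner product spaces: the real
  inner product is the real part of the complex one, so norm, metric and topology are the library's.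
  The complex inner product is linear in its first argument.
\<close>

class complex_inner = real_inner +
  fixes scaleC :: "complex \<Rightarrow> 'a \<Rightarrow> 'a" (infixr \<open>*\<^sub>C\<close> 75)
    and cinner :: "'a \<Rightarrow> 'a \<Rightarrow> complex"
  assumes scaleC_add_right: "c *\<^sub>C (x + y) = c *\<^sub>C x + c *\<^sub>C y"
    and scaleC_add_left: "(c + d) *\<^sub>C x = c *\<^sub>C x + d *\<^sub>C x"
    and scaleC_scaleC: "c *\<^sub>C d *\<^sub>C x = (c * d) *\<^sub>C x"
    and scaleC_of_real: "complex_of_real r *\<^sub>C x = r *\<^sub>R x"
    and cinner_commute: "cinner x y = cnj (cinner y x)"
    and cinner_add_left: "cinner (x + y) z = cinner x z + cinner y z"
    and cinner_scaleC_left: "cinner (c *\<^sub>C x) y = c * cinner x y"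
    and inner_eq_Re_cinner: "inner x y = Re (cinner x y)"

class complex_hilbert = complex_inner + complete_space

instantiation complex :: complex_hilbert
begin

definition scaleC_complex :: "complex \<Rightarrow> complex \<Rightarrow> complex"
  where "scaleC_complex c x = c * x"

definition cinner_complex :: "complex \<Rightarrow> complex \<Rightarrow> complex"
  where "cinner_complex x y = x * cnj y"

instance
  by standard
    (auto simp: scaleC_complex_def cinner_complex_def inner_complex_def algebra_simps
      scaleR_conv_of_real)

end


section \<open>Bounded operators\<close>

text \<open>Everywhere defined bounded complex-linear operators.\<close>

definition bounded_clinear :: "('a::complex_inner \<Rightarrow> 'b::complex_inner) \<Rightarrow> bool" where
  "bounded_clinear T \<longleftrightarrow> bounded_linear T \<and> (\<forall>c x. T (c *\<^sub>C x) = c *\<^sub>C T x)"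

definition bounded_adjoint :: "('a::complex_inner \<Rightarrow> 'a) \<Rightarrow> 'a \<Rightarrow> 'a" where
  "bounded_adjoint T y = (THE h. \<forall>x. cinner (T x) y = cinner x h)"

definition bounded_nonneg :: "('a::complex_inner \<Rightarrow> 'a) \<Rightarrow> bool" where
  "bounded_nonneg T \<longleftrightarrow> (\<forall>x. cinner (T x) x \<in> \<real>\<^sub>\<ge>\<^sub>0)"

definition Im_operator :: "('a::complex_inner \<Rightarrow> 'a) \<Rightarrow> 'a \<Rightarrow> 'a" where
  "Im_operator T x = (1 / (2 * \<i>)) *\<^sub>C (T x - bounded_adjoint T x)"

text \<open>
  Holomorphy with respect to the operator norm: the difference quotients converge in operator norm
  to a bounded operator.
\<close>

definition operator_holomorphic_on ::
  "(complex \<Rightarrow> 'a::complex_inner \<Rightarrow> 'a) \<Rightarrow> complex set \<Rightarrow> bool" where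
  "operator_holomorphic_on F S \<longleftrightarrow>
     (\<forall>z\<in>S. bounded_clinear (F z)) \<and>
     (\<forall>z\<in>S. \<exists>D. bounded_clinear D \<and>
        ((\<lambda>w. onorm (\<lambda>h. (1 / (w - z)) *\<^sub>C (F w h - F z h) - D h)) \<longlongrightarrow> 0) (at z within S))"


section \<open>Unbounded operators\<close>

text \<open>
  An unbounded operator is a partial function; its domain is \<^const>\<open>dom\<close>, and \<open>A\<close> is a restriction
  of \<open>B\<close> iff \<open>A \<subseteq>\<^sub>m B\<close>.
\<close>

definition linear_operator :: "('a::complex_inner \<rightharpoonup> 'a) \<Rightarrow> bool" where
  "linear_operator A \<longleftrightarrow>
     A 0 = Some 0 \<and>
     (\<forall>c f g u v. A f = Some u \<and> A g = Some v \<longrightarrow> A (c *\<^sub>C f + g) = Some (c *\<^sub>C u + v))"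

definition closed_operator :: "('a::complex_inner \<rightharpoonup> 'a) \<Rightarrow> bool" where
  "closed_operator A \<longleftrightarrow> closed (Map.graph A)"

definition densely_defined :: "('a::complex_inner \<rightharpoonup> 'a) \<Rightarrow> bool" where
  "densely_defined A \<longleftrightarrow> closure (dom A) = UNIV"

definition symmetric_operator :: "('a::complex_inner \<rightharpoonup> 'a) \<Rightarrow> bool" where
  "symmetric_operator A \<longleftrightarrow>
     (\<forall>f\<in>dom A. \<forall>g\<in>dom A. cinner (the (A f)) g = cinner f (the (A g)))"

definition nonneg_operator :: "('a::complex_inner \<rightharpoonup> 'a) \<Rightarrow> bool" where
  "nonneg_operator A \<longleftrightarrow> (\<forall>f\<in>dom A. cinner (the (A f)) f \<in> \<real>\<^sub>\<ge>\<^sub>0)"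

text \<open>The adjoint; the vector \<open>h\<close> below is unique when \<open>A\<close> is densely defined.\<close>

definition adj :: "('a::complex_inner \<rightharpoonup> 'a) \<Rightarrow> 'a \<rightharpoonup> 'a" where
  "adj A g =
     (if \<exists>h. \<forall>f\<in>dom A. cinner (the (A f)) g = cinner f h
      then Some (THE h. \<forall>f\<in>dom A. cinner (the (A f)) g = cinner f h)
      else None)"

definition resolvent_set :: "('a::complex_inner \<rightharpoonup> 'a) \<Rightarrow> complex set" where
  "resolvent_set A =
     {z. \<exists>R. bounded_clinear R \<and>
           (\<forall>h. R h \<in> dom A \<and> the (A (R h)) - z *\<^sub>C R h = h) \<and>
           (\<forall>f\<in>dom A. R (the (A f) - z *\<^sub>C f) = f)}"

definition proper_extension :: "('a::complex_inner \<rightharpoonup> 'a) \<Rightarrow> ('a \<rightharpoonup> 'a) \<Rightarrow> bool" where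
  "proper_extension A B \<longleftrightarrow> A \<subseteq>\<^sub>m B \<and> B \<subseteq>\<^sub>m adj A"

definition transversal ::
  "('a::complex_inner \<rightharpoonup> 'a) \<Rightarrow> ('a \<rightharpoonup> 'a) \<Rightarrow> ('a \<rightharpoonup> 'a) \<Rightarrow> bool" where
  "transversal A B C \<longleftrightarrow>
     proper_extension A B \<and> proper_extension A C \<and>
     dom B \<inter> dom C = dom A \<and> {f + g | f g. f \<in> dom B \<and> g \<in> dom C} = dom (adj A)"


section \<open>The Friedrichs extension\<close>

text \<open>
  The Friedrichs extension is the operator associated with the closure of the quadratic form
  \<open>(A f, g)\<close> on \<open>dom A\<close>. A vector lies in the domain of the closure iff it is the norm limit of a
  sequence in \<open>dom A\<close> that is Cauchy for the form; the closed form is the limit of the form along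
  such sequences and does not depend on their choice.
\<close>

definition form_approx :: "('a::complex_inner \<rightharpoonup> 'a) \<Rightarrow> (nat \<Rightarrow> 'a) \<Rightarrow> 'a \<Rightarrow> bool" where
  "form_approx A X f \<longleftrightarrow>
     range X \<subseteq> dom A \<and> X \<longlonglongrightarrow> f \<and>
     (\<forall>e>0. \<exists>N. \<forall>m\<ge>N. \<forall>n\<ge>N. cmod (cinner (the (A (X m - X n))) (X m - X n)) < e)"

definition closed_form_dom :: "('a::complex_inner \<rightharpoonup> 'a) \<Rightarrow> 'a set" where
  "closed_form_dom A = {f. \<exists>X. form_approx A X f}"

definition closed_form :: "('a::complex_inner \<rightharpoonup> 'a) \<Rightarrow> 'a \<Rightarrow> 'a \<Rightarrow> complex" where
  "closed_form A f g =
     (THE t. \<forall>X Y. form_approx A X f \<longrightarrow> form_approx A Y g \<longrightarrow>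
        (\<lambda>n. cinner (the (A (X n))) (Y n)) \<longlonglongrightarrow> t)"

definition friedrichs_extension :: "('a::complex_inner \<rightharpoonup> 'a) \<Rightarrow> 'a \<rightharpoonup> 'a" where
  "friedrichs_extension A f =
     (if f \<in> closed_form_dom A \<and> (\<exists>h. \<forall>g\<in>closed_form_dom A. closed_form A f g = cinner h g)
      then Some (THE h. \<forall>g\<in>closed_form_dom A. closed_form A f g = cinner h g)
      else None)"


section \<open>Boundary triplets and Weyl functions\<close>

text \<open>
  The maps \<open>\<Gamma>\<^sub>0\<close>, \<open>\<Gamma>\<^sub>1\<close> are total functions of which only the values on \<open>dom (adj A)\<close>
  matter. The Hilbert space of the triplet is the whole type \<open>'b\<close>.
\<close>

definition boundary_triplet ::
  "('a::complex_hilbert \<rightharpoonup> 'a) \<Rightarrow> ('a \<Rightarrow> 'b::complex_hilbert) \<Rightarrow> ('a \<Rightarrow> 'b) \<Rightarrow> bool" where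
  "boundary_triplet A \<Gamma>\<^sub>0 \<Gamma>\<^sub>1 \<longleftrightarrow>
     (\<forall>c. \<forall>f\<in>dom (adj A). \<forall>g\<in>dom (adj A).
        \<Gamma>\<^sub>0 (c *\<^sub>C f + g) = c *\<^sub>C \<Gamma>\<^sub>0 f + \<Gamma>\<^sub>0 g \<and> \<Gamma>\<^sub>1 (c *\<^sub>C f + g) = c *\<^sub>C \<Gamma>\<^sub>1 f + \<Gamma>\<^sub>1 g) \<and>
     (\<forall>f\<in>dom (adj A). \<forall>g\<in>dom (adj A).
        cinner (the (adj A f)) g - cinner f (the (adj A g)) =
        cinner (\<Gamma>\<^sub>1 f) (\<Gamma>\<^sub>0 g) - cinner (\<Gamma>\<^sub>0 f) (\<Gamma>\<^sub>1 g)) \<and>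
     (\<lambda>f. (\<Gamma>\<^sub>1 f, \<Gamma>\<^sub>0 f)) ` dom (adj A) = UNIV"

definition kernel_extension ::
  "('a::complex_inner \<rightharpoonup> 'a) \<Rightarrow> ('a \<Rightarrow> 'b::complex_inner) \<Rightarrow> 'a \<rightharpoonup> 'a" where
  "kernel_extension A \<Gamma>\<^sub>0 = adj A |` {f. \<Gamma>\<^sub>0 f = 0}"

definition defect_space :: "('a::complex_inner \<rightharpoonup> 'a) \<Rightarrow> complex \<Rightarrow> 'a set" where
  "defect_space A z = {f. adj A f = Some (z *\<^sub>C f)}"

text \<open>
  \<open>M(z)\<close> sends \<open>\<Gamma>\<^sub>0 f\<close> to \<open>\<Gamma>\<^sub>1 f\<close> for \<open>f\<close> in the defect space; it is a well-defined bounded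
  operator for \<open>z\<close> in the resolvent set of \<open>kernel_extension A \<Gamma>\<^sub>0\<close>, and meaningless elsewhere.
\<close>

definition weyl_function ::
  "('a::complex_inner \<rightharpoonup> 'a) \<Rightarrow> ('a \<Rightarrow> 'b::complex_inner) \<Rightarrow> ('a \<Rightarrow> 'b) \<Rightarrow> complex \<Rightarrow> 'b \<Rightarrow> 'b" where
  "weyl_function A \<Gamma>\<^sub>0 \<Gamma>\<^sub>1 z h = (THE k. \<exists>f\<in>defect_space A z. \<Gamma>\<^sub>0 f = h \<and> \<Gamma>\<^sub>1 f = k)"


section \<open>Classes of operator functions\<close>

definition class_R :: "(complex \<Rightarrow> 'b::complex_hilbert \<Rightarrow> 'b) set" where
  "class_R = {F. operator_holomorphic_on F {z. Im z > 0} \<and>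
                 (\<forall>z. Im z > 0 \<longrightarrow> bounded_nonneg (Im_operator (F z)))}"

definition class_S :: "(complex \<Rightarrow> 'b::complex_hilbert \<Rightarrow> 'b) set" where
  "class_S = {F. operator_holomorphic_on F (- \<real>\<^sub>\<ge>\<^sub>0) \<and> F \<in> class_R \<and>
                 (\<forall>x::real. x < 0 \<longrightarrow> bounded_nonneg (F (of_real x)))}"

text \<open>
  Membership in the shifted Stieltjes class for a function \<open>M\<close> given on \<open>\<Omega>\<close> only: \<open>M\<close> has to agree
  on \<open>\<Omega> - [0, \<infinity>)\<close> with some \<open>F + K\<close>, which then is the holomorphic continuation of \<open>M\<close> to the
  complement of \<open>[0, \<infinity>)\<close>.
\<close>

definition in_class_S_hat ::
  "complex set \<Rightarrow> (complex \<Rightarrow> 'b::complex_hilbert \<Rightarrow> 'b) \<Rightarrow> bool" where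
  "in_class_S_hat \<Omega> M \<longleftrightarrow>
     (\<exists>F K. F \<in> class_S \<and> bounded_clinear K \<and> bounded_adjoint K = K \<and>
        (\<forall>z \<in> \<Omega> - \<real>\<^sub>\<ge>\<^sub>0. \<forall>h. M z h = F z h + K h))"

end

theory Submission
  imports Defs
begin

text \<open>
  Everything reduces to Green's identity for the \<open>\<gamma>\<close>-field \<open>\<gamma>(z) = (\<Gamma>\<^sub>0 | N\<^sub>z)\<^sup>-\<^sup>1\<close>, where \<open>N\<^sub>z\<close> is
  the defect space, and to the fact that the Friedrichs extension is the restriction of the adjoint
  to the domain of the closed form; the spectral theorem is not needed.

  If \<open>A\<^sub>0 \<ge> 0\<close> is transversal to the Friedrichs extension, then the latter is given by a boundary
  condition \<open>\<Gamma>\<^sub>1 f = B \<Gamma>\<^sub>0 f\<close> with an everywhere defined symmetric, hence bounded, operator \<open>B\<close>.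
  Extremality of the Friedrichs extension among the nonnegative extensions gives \<open>M(x) \<ge> B\<close> for
  \<open>x < 0\<close>, so that \<open>M - B\<close> is a Stieltjes function.

  Conversely, let \<open>M = F + K\<close>. As \<open>z\<close> tends to \<open>x < 0\<close> vertically,
  \<open>Im z \<parallel>\<gamma>(z)h\<parallel>\<^sup>2 = Im (M(z)h, h)\<close> tends to \<open>0\<close>. Hence the boundary values of \<open>N\<^sub>x\<close> lie in the graph of
  \<open>F(x) + K\<close>, and by maximality they fill it. It follows that \<open>x\<close> belongs to the resolvent set of
  \<open>A\<^sub>0\<close>, so \<open>A\<^sub>0 \<ge> 0\<close>. The forms \<open>(M(x)h, h)\<close> decrease as \<open>x \<rightarrow> -\<infinity>\<close> and are bounded below by
  \<open>(Kh, h)\<close>. Therefore \<open>M(x)h\<close> converges, \<open>\<gamma>(x)h\<close> tends to \<open>0\<close> in the form sense, and the vectors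
  \<open>g - \<gamma>(x)h\<close> with \<open>\<Gamma>\<^sub>0 g = h\<close> and \<open>\<Gamma>\<^sub>1 g = lim M(x)h\<close> differ from elements of \<open>dom A\<close> by vectors
  that are small in the graph norm. So \<open>g\<close> lies in the domain of the Friedrichs extension, which is
  thus mapped onto the boundary space by \<open>\<Gamma>\<^sub>0\<close>.
\<close>

section \<open>Complex inner products\<close>

lemma cinner_add_right: "cinner x (y + z) = cinner x y + cinner x z"
  for x :: "'a::complex_inner"
  by (metis cinner_add_left cinner_commute complex_cnj_add)

lemma cinner_scaleC_right: "cinner x (c *\<^sub>C y) = cnj c * cinner x y"
  for x :: "'a::complex_inner"
  by (metis cinner_commute cinner_scaleC_left complex_cnj_mult)

lemma scaleC_one [simp]: "1 *\<^sub>C x = x" for x :: "'a::complex_inner"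
  by (metis of_real_1 scaleC_of_real scaleR_one)

lemma scaleC_zero_left [simp]: "0 *\<^sub>C x = 0" for x :: "'a::complex_inner"
  by (metis of_real_0 scaleC_of_real scaleR_zero_left)

lemma scaleC_minus_one: "(-1) *\<^sub>C x = - x" for x :: "'a::complex_inner"
  by (metis of_real_1 of_real_minus scaleC_of_real scaleR_minus1_left)

lemma scaleC_zero_right [simp]: "c *\<^sub>C 0 = (0::'a::complex_inner)"
  by (metis add_cancel_right_left scaleC_add_right)

lemma scaleC_minus_left [simp]: "(- c) *\<^sub>C x = - (c *\<^sub>C x)" for x :: "'a::complex_inner"
  by (metis add_eq_0_iff scaleC_add_left scaleC_zero_left add.right_inverse)

lemma scaleC_minus_right [simp]: "c *\<^sub>C (- x) = - (c *\<^sub>C x)" for x :: "'a::complex_inner"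
  by (metis add_eq_0_iff scaleC_add_right scaleC_zero_right add.right_inverse)

lemma scaleC_diff_right: "c *\<^sub>C (x - y) = c *\<^sub>C x - c *\<^sub>C y" for x :: "'a::complex_inner"
  by (metis diff_conv_add_uminus scaleC_add_right scaleC_minus_right)

lemma scaleC_diff_left: "(c - d) *\<^sub>C x = c *\<^sub>C x - d *\<^sub>C x" for x :: "'a::complex_inner"
  by (metis diff_conv_add_uminus scaleC_add_left scaleC_minus_left)

lemma scaleR_scaleC_commute: "r *\<^sub>R (c *\<^sub>C x) = c *\<^sub>C (r *\<^sub>R x)" for x :: "'a::complex_inner"
  by (metis mult.commute scaleC_of_real scaleC_scaleC)

lemma cinner_zero_left [simp]: "cinner 0 x = 0" for x :: "'a::complex_inner"
  by (metis cinner_scaleC_left mult_zero_left scaleC_zero_left)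

lemma cinner_zero_right [simp]: "cinner x 0 = 0" for x :: "'a::complex_inner"
  by (metis cinner_commute cinner_zero_left complex_cnj_zero)

lemma cinner_minus_left [simp]: "cinner (- x) y = - cinner x y" for x :: "'a::complex_inner"
  by (metis add_eq_0_iff cinner_add_left cinner_zero_left add.right_inverse)

lemma cinner_minus_right [simp]: "cinner x (- y) = - cinner x y" for x :: "'a::complex_inner"
  by (metis add_eq_0_iff cinner_add_right cinner_zero_right add.right_inverse)

lemma cinner_diff_left: "cinner (x - y) z = cinner x z - cinner y z" for x :: "'a::complex_inner"
  by (metis cinner_add_left cinner_minus_left diff_conv_add_uminus)

lemma cinner_diff_right: "cinner x (y - z) = cinner x y - cinner x z" for x :: "'a::complex_inner"
  by (metis cinner_add_right cinner_minus_right diff_conv_add_uminus)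

lemmas cinner_simps = cinner_add_left cinner_add_right cinner_diff_left cinner_diff_right
  cinner_scaleC_left cinner_scaleC_right

lemmas scaleC_simps = scaleC_add_left scaleC_add_right scaleC_diff_left scaleC_diff_right
  scaleC_scaleC

lemma cinner_self: "cinner x x = of_real ((norm x)\<^sup>2)" for x :: "'a::complex_inner"
proof -
  have "Im (cinner x x) = 0"
    by (metis cinner_commute complex_cnj_cancel_iff cnj.simps(2) equal_neg_zero)
  then show ?thesis
    by (simp add: complex_eq_iff inner_eq_Re_cinner [symmetric] power2_norm_eq_inner)
qed

lemma cinner_self_eq_0 [simp]: "cinner x x = 0 \<longleftrightarrow> x = 0" for x :: "'a::complex_inner"
  by (simp add: cinner_self)

lemma norm_scaleC: "norm (c *\<^sub>C x) = cmod c * norm x" for x :: "'a::complex_inner"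
proof -
  have "complex_of_real ((norm (c *\<^sub>C x))\<^sup>2) = c * cnj c * cinner x x"
    by (simp only: cinner_self [symmetric] cinner_simps mult.assoc mult.left_commute)
  also have "\<dots> = of_real ((cmod c * norm x)\<^sup>2)"
    by (simp only: cinner_self complex_norm_square [symmetric] power_mult_distrib of_real_mult)
  finally have "complex_of_real ((norm (c *\<^sub>C x))\<^sup>2) = of_real ((cmod c * norm x)\<^sup>2)" .
  then show ?thesis
    by (metis norm_ge_zero mult_nonneg_nonneg of_real_eq_iff power2_eq_imp_eq)
qed

lemma norm_diff_sq: "(norm (x - y))\<^sup>2 = (norm x)\<^sup>2 - 2 * Re (cinner x y) + (norm y)\<^sup>2"
  for x :: "'a::complex_inner"
  by (simp add: power2_norm_eq_inner inner_eq_Re_cinner [symmetric] inner_diff inner_commute)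

lemma cinner_bound: "cmod (cinner x y) \<le> norm x * norm y" for x :: "'a::complex_inner"
proof (cases "cinner x y = 0")
  case False
  \<comment> \<open>Rotating \<open>y\<close> by the phase \<open>u\<close> makes the inner product
    real, which reduces the bound to the real Cauchy--Schwarz inequality.\<close>
  define u where "u = cinner x y / cmod (cinner x y)"
  have u: "cmod u = 1" "cnj u * cinner x y = cmod (cinner x y)"
    using False by (auto simp: u_def norm_divide complex_norm_square [symmetric] power2_eq_square
        mult.commute)
  have "cmod (cinner x y) = Re (cinner x (u *\<^sub>C y))"
    by (simp add: cinner_scaleC_right u)
  also have "\<dots> = inner x (u *\<^sub>C y)"
    by (simp add: inner_eq_Re_cinner)
  also have "\<dots> \<le> norm x * norm (u *\<^sub>C y)"
    by (rule norm_cauchy_schwarz)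
  finally show ?thesis
    by (simp add: norm_scaleC u)
qed simp

lemma bounded_bilinear_cinner:
  "bounded_bilinear (cinner :: 'a::complex_inner \<Rightarrow> 'a \<Rightarrow> complex)"
proof
  show "cinner (r *\<^sub>R a) b = r *\<^sub>R cinner a b" for r and a b :: 'a
    using cinner_scaleC_left by (metis scaleC_of_real scaleR_conv_of_real)
  show "cinner a (r *\<^sub>R b) = r *\<^sub>R cinner a b" for r and a b :: 'a
    using cinner_scaleC_right by (metis scaleC_of_real scaleR_conv_of_real complex_cnj_complex_of_real)
  show "\<exists>K. \<forall>a b::'a. norm (cinner a b) \<le> norm a * norm b * K"
    by (rule exI [of _ 1]) (simp add: cinner_bound)
qed (simp_all add: cinner_simps)

lemmas tendsto_cinner = bounded_bilinear.tendsto [OF bounded_bilinear_cinner, tendsto_intros]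

lemma bounded_linear_scaleC: "bounded_linear (\<lambda>x::'a::complex_inner. c *\<^sub>C x)"
  by (rule bounded_linear_intro [where K = "cmod c"])
    (auto simp: scaleC_add_right scaleR_scaleC_commute norm_scaleC mult.commute)

lemmas tendsto_scaleC = bounded_linear.tendsto [OF bounded_linear_scaleC, tendsto_intros]

lemma cinner_ext_right: "(\<And>x. cinner x y = cinner x z) \<Longrightarrow> y = z" for y :: "'a::complex_inner"
  by (metis cinner_diff_right cinner_self_eq_0 diff_self eq_iff_diff_eq_0)

lemma cinner_ext_left: "(\<And>x. cinner y x = cinner z x) \<Longrightarrow> y = z" for y :: "'a::complex_inner"
  by (metis cinner_commute cinner_ext_right)

section \<open>Bounded operators on complex Hilbert spaces\<close>

lemma bounded_clinearI:
  fixes T :: "'a::complex_inner \<Rightarrow> 'b::complex_inner"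
  assumes "\<And>c x y. T (c *\<^sub>C x + y) = c *\<^sub>C T x + T y"
    and "\<And>x. norm (T x) \<le> K * norm x"
  shows "bounded_clinear T"
proof -
  have 1: "T (x + y) = T x + T y" for x y
    using assms(1) [of 1 x y] by simp
  then have "T 0 = 0"
    by (metis add_cancel_right_left)
  then have 2: "T (c *\<^sub>C x) = c *\<^sub>C T x" for c x
    using assms(1) [of c x 0] by simp
  have "bounded_linear T"
    by (rule bounded_linear_intro [where K = K])
      (auto simp: 1 2 scaleC_of_real [symmetric] assms(2) mult.commute [of _ K])
  with 2 show ?thesis
    by (simp add: bounded_clinear_def)
qed

lemma bounded_clinearD:
  assumes "bounded_clinear T"
  shows "T (x + y) = T x + T y" "T (x - y) = T x - T y" "T (c *\<^sub>C x) = c *\<^sub>C T x"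
    "T 0 = 0" "T (- x) = - T x"
proof -
  interpret bounded_linear T
    using assms by (simp add: bounded_clinear_def)
  show "T (x + y) = T x + T y" "T (x - y) = T x - T y" "T (c *\<^sub>C x) = c *\<^sub>C T x"
    "T 0 = 0" "T (- x) = - T x"
    using assms by (simp_all add: add diff zero neg bounded_clinear_def)
qed

lemma bounded_clinear_norm_bound:
  assumes "bounded_clinear T"
  obtains C where "0 < C" "\<And>x. norm (T x) \<le> C * norm x"
  using assms bounded_linear.pos_bounded unfolding bounded_clinear_def by (metis mult.commute)

lemma bounded_clinear_compose:
  "bounded_clinear S \<Longrightarrow> bounded_clinear T \<Longrightarrow> bounded_clinear (\<lambda>x. S (T x))"
  unfolding bounded_clinear_def using bounded_linear_compose by auto

lemma bounded_clinear_diff: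
  "bounded_clinear S \<Longrightarrow> bounded_clinear T \<Longrightarrow> bounded_clinear (\<lambda>x. S x - T x)"
  unfolding bounded_clinear_def by (auto intro: bounded_linear_sub simp: scaleC_diff_right)

lemma bounded_adjointI:
  assumes "\<And>x. cinner (T x) y = cinner x h"
  shows "bounded_adjoint T y = h"
  unfolding bounded_adjoint_def
proof (rule the_equality)
  show "k = h" if "\<forall>x. cinner (T x) y = cinner x k" for k
    using that assms by (auto intro!: cinner_ext_right [of k h])
qed (simp add: assms)

section \<open>Projections, Riesz representation and uniform boundedness\<close>

definition csubspace :: "'a::complex_inner set \<Rightarrow> bool" where
  "csubspace S \<longleftrightarrow> 0 \<in> S \<and> (\<forall>c. \<forall>x\<in>S. \<forall>y\<in>S. c *\<^sub>C x + y \<in> S)"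

lemma csubspaceD:
  assumes "csubspace S" "x \<in> S" "y \<in> S"
  shows "c *\<^sub>C x + y \<in> S" "c *\<^sub>C x \<in> S" "x + y \<in> S" "x - y \<in> S"
proof -
  have *: "c *\<^sub>C x + y \<in> S" "0 \<in> S" if "x \<in> S" "y \<in> S" for c x y
    using assms(1) that unfolding csubspace_def by auto
  show "c *\<^sub>C x + y \<in> S" "c *\<^sub>C x \<in> S" "x + y \<in> S" "x - y \<in> S"
    using *(1) [of x y c] *(1) [of x 0 c] *(1) [of x y 1] *(1) [of y x "-1"] *(2) assms
    by (auto simp: scaleC_minus_one)
qed

text \<open>A minimizing sequence for the distance is Cauchy by the parallelogram identity, and its
  limit \<open>p\<close> realizes the distance. If \<open>y - p\<close> were not orthogonal to some
  \<open>s\<close>, a small step from \<open>p\<close> along \<open>s\<close> would shorten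
  it.\<close>

lemma orthogonal_projection:
  fixes S :: "'a::complex_hilbert set"
  assumes "closed S" and S: "csubspace S"
  obtains p where "p \<in> S" "\<And>s. s \<in> S \<Longrightarrow> cinner s (y - p) = 0"
proof -
  define d where "d = infdist y S"
  have ne: "S \<noteq> {}"
    using S by (auto simp: csubspace_def)
  have d_le: "d \<le> norm (y - s)" if "s \<in> S" for s
    using infdist_le [OF that, of y] by (simp add: d_def dist_norm)
  have d0: "0 \<le> d"
    by (simp add: d_def infdist_nonneg)
  have "\<exists>s\<in>S. norm (y - s) < d + inverse (real (Suc n))" for n
  proof -
    have "(INF s\<in>S. dist y s) < d + inverse (real (Suc n))"
      using ne by (simp add: d_def infdist_def del: of_nat_Suc)
    then show ?thesis
      using ne by (subst (asm) cINF_less_iff) (auto simp: dist_norm intro: bdd_belowI2 [of _ 0])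
  qed
  then obtain X where X: "\<And>n. X n \<in> S" "\<And>n. norm (y - X n) < d + inverse (real (Suc n))"
    by metis
  have lim: "(\<lambda>n. norm (y - X n)) \<longlonglongrightarrow> d"
  proof (rule tendsto_sandwich [OF always_eventually always_eventually tendsto_const])
    show "(\<lambda>n. d + inverse (real (Suc n))) \<longlonglongrightarrow> d"
      using tendsto_add [OF tendsto_const [of d] LIMSEQ_inverse_real_of_nat] by simp
  qed (use X d_le in \<open>auto simp: less_imp_le simp del: of_nat_Suc\<close>)
  have par: "(norm (a - b))\<^sup>2 \<le> 2 * (norm (y - a))\<^sup>2 + 2 * (norm (y - b))\<^sup>2 - 4 * d\<^sup>2"
    if "a \<in> S" "b \<in> S" for a b
  proof -
    have "(1/2) *\<^sub>C (a + b) \<in> S"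
      using that S csubspaceD by blast
    then have "d \<le> norm (y - (1/2) *\<^sub>C (a + b))"
      using d_le by blast
    moreover have "2 *\<^sub>C (y - (1/2) *\<^sub>C (a + b)) = (y - a) + (y - b)"
      using scaleC_of_real [of 2 y] by (simp add: scaleC_simps algebra_simps scaleR_2)
    then have "norm ((y - a) + (y - b)) = 2 * norm (y - (1/2) *\<^sub>C (a + b))"
      by (metis norm_scaleC norm_numeral)
    ultimately have "(2 * d)\<^sup>2 \<le> (norm ((y - a) + (y - b)))\<^sup>2"
      using d0 by (intro power_mono) auto
    moreover have "(norm ((y - a) + (y - b)))\<^sup>2 + (norm (a - b))\<^sup>2
        = 2 * (norm (y - a))\<^sup>2 + 2 * (norm (y - b))\<^sup>2"
      by (simp add: power2_norm_eq_inner inner_diff inner_add inner_commute)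
    ultimately show ?thesis
      by simp
  qed
  have "Cauchy X"
  proof (rule metric_CauchyI)
    fix e :: real
    assume "0 < e"
    have "(\<lambda>n. 4 * (norm (y - X n))\<^sup>2) \<longlonglongrightarrow> 4 * d\<^sup>2"
      by (intro tendsto_intros lim)
    moreover have "4 * d\<^sup>2 < 4 * d\<^sup>2 + e\<^sup>2"
      using \<open>0 < e\<close> by simp
    ultimately have "\<forall>\<^sub>F n in sequentially. 4 * (norm (y - X n))\<^sup>2 < 4 * d\<^sup>2 + e\<^sup>2"
      by (rule order_tendstoD(2))
    then obtain N where N: "\<And>n. n \<ge> N \<Longrightarrow> 4 * (norm (y - X n))\<^sup>2 < 4 * d\<^sup>2 + e\<^sup>2"
      by (auto simp: eventually_sequentially)
    show "\<exists>N. \<forall>m\<ge>N. \<forall>n\<ge>N. dist (X m) (X n) < e"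
    proof (intro exI allI impI)
      fix m n
      assume "N \<le> m" "N \<le> n"
      then have "(norm (X m - X n))\<^sup>2 < e\<^sup>2"
        using par [OF X(1) X(1), of m n] N [of m] N [of n] by simp
      then show "dist (X m) (X n) < e"
        using \<open>0 < e\<close> by (simp add: dist_norm power_less_imp_less_base)
    qed
  qed
  then obtain p where p: "X \<longlonglongrightarrow> p"
    using Cauchy_convergent convergent_def by blast
  have pS: "p \<in> S"
    using \<open>closed S\<close> X(1) p closed_sequentially by blast
  have "(\<lambda>n. norm (y - X n)) \<longlonglongrightarrow> norm (y - p)"
    by (intro tendsto_intros p)
  then have np: "norm (y - p) = d"
    using lim LIMSEQ_unique by blast
  show ?thesis
  proof
    show "p \<in> S" by (rule pS)
    fix s
    assume s: "s \<in> S"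
    define r where "r = y - p"
    define e where "e = cinner r s"
    \<comment> \<open>The step \<open>t * e\<close> along \<open>s\<close> changes the squared
      distance by - 2 t |e|^2 + t^2 |e|^2 |s|^2. Any positive \<open>t\<close> with t |s|^2 < 1
      makes this negative unless \<open>e = 0\<close>; the summand 1 covers
      \<open>s = 0\<close>.\<close>
    define t where "t = 1 / ((norm s)\<^sup>2 + 1)"
    have t: "0 < t" "t * (norm s)\<^sup>2 < 1"
      using zero_le_power2 [of "norm s"] by (simp_all add: t_def add_nonneg_pos)
    have "(of_real t * e) *\<^sub>C s + p \<in> S"
      using s pS S csubspaceD by blast
    then have "norm r \<le> norm (y - ((of_real t * e) *\<^sub>C s + p))"
      using d_le np r_def by metis
    also have "y - ((of_real t * e) *\<^sub>C s + p) = r - (of_real t * e) *\<^sub>C s"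
      by (simp add: r_def)
    finally have "(norm r)\<^sup>2 \<le> (norm (r - (of_real t * e) *\<^sub>C s))\<^sup>2"
      by (simp add: power_mono)
    also have "\<dots> = (norm r)\<^sup>2 - 2 * Re (of_real t * (cnj e * e)) + (t * cmod e * norm s)\<^sup>2"
      using t by (simp add: norm_diff_sq cinner_simps norm_scaleC e_def norm_mult mult.assoc)
    also have "cnj e * e = of_real ((cmod e)\<^sup>2)"
      by (simp only: mult.commute [of "cnj e"] complex_norm_square)
    finally have "2 * (t * (cmod e)\<^sup>2) \<le> t * (cmod e)\<^sup>2 * (t * (norm s)\<^sup>2)"
      by (simp add: power2_eq_square algebra_simps)
    also have "\<dots> \<le> t * (cmod e)\<^sup>2 * 1"
      using t by (intro mult_left_mono) auto
    finally have "e = 0"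
      using t by (simp add: mult_le_0_iff)
    then show "cinner s (y - p) = 0"
      by (metis cinner_commute complex_cnj_zero e_def r_def)
  qed
qed

text \<open>Unless \<open>l\<close> vanishes, its kernel is a closed subspace of codimension one,
  and a vector \<open>n\<close> orthogonal to the kernel determines \<open>l\<close> up to a
  scalar.\<close>

lemma riesz_representation:
  fixes l :: "'a::complex_hilbert \<Rightarrow> complex"
  assumes lin: "\<And>c x y. l (c *\<^sub>C x + y) = c * l x + l y"
    and bd: "\<And>x. cmod (l x) \<le> C * norm x"
  obtains v where "\<And>x. l x = cinner x v"
proof (cases "\<forall>x. l x = 0")
  case True
  then show ?thesis
    using that [of 0] by simp
next
  case False
  then obtain u where u: "l u \<noteq> 0" by blast
  have l0: "l 0 = 0"
    using bd [of 0] by simp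
  have bl: "bounded_linear l"
  proof (rule bounded_linear_intro [where K = C])
    show "l (x + y) = l x + l y" for x y
      using lin [of 1 x y] by simp
    show "l (r *\<^sub>R x) = r *\<^sub>R l x" for r x
      using lin [of "of_real r" x 0] by (simp add: l0 scaleC_of_real scaleR_conv_of_real)
  qed (simp add: bd mult.commute)
  have "closed {x. l x = 0}"
    by (intro closed_Collect_eq continuous_intros bounded_linear.continuous_on [OF bl])
  moreover have "csubspace {x. l x = 0}"
    by (auto simp: csubspace_def l0 lin)
  ultimately obtain p where p: "p \<in> {x. l x = 0}"
    "\<And>s. s \<in> {x. l x = 0} \<Longrightarrow> cinner s (u - p) = 0"
    by (rule orthogonal_projection [where y = u]) blast
  define n where "n = u - p"
  have ln: "l n \<noteq> 0"
    using lin [of "-1" p u] u p by (simp add: n_def scaleC_minus_one)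
  then have n: "n \<noteq> 0"
    using l0 by auto
  show ?thesis
  proof
    fix x
    have "l (l n *\<^sub>C x + (- l x) *\<^sub>C n) = 0"
      by (simp add: lin [of "l n" x] lin [of "- l x" n 0, unfolded add_0_right l0] del: scaleC_minus_left)
    then have "cinner (l n *\<^sub>C x + (- l x) *\<^sub>C n) n = 0"
      using p n_def by blast
    then have "l n * cinner x n = l x * cinner n n"
      by (simp add: cinner_simps)
    then show "l x = cinner x (cnj (l n / cinner n n) *\<^sub>C n)"
      using n by (simp add: cinner_simps field_simps)
  qed
qed

text \<open>Baire category: the closed sets \<open>S k\<close> exhaust the space, so one of them
  contains a ball, on which all functionals given by \<open>Y\<close> share one bound.\<close>

lemma uniform_boundedness:
  fixes Y :: "'a::complex_hilbert set"
  assumes "\<And>x. \<exists>C. \<forall>y\<in>Y. cmod (cinner x y) \<le> C"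
  obtains C where "0 \<le> C" "\<And>y. y \<in> Y \<Longrightarrow> norm y \<le> C"
proof -
  define S where "S k = {x. \<forall>y\<in>Y. cmod (cinner x y) \<le> real k}" for k :: nat
  have clS: "closed (S k)" for k
  proof -
    have "S k = (\<Inter>y\<in>Y. {x. cmod (cinner x y) \<le> real k})"
      by (auto simp: S_def)
    then show ?thesis
      by (auto intro!: closed_INT closed_Collect_le continuous_intros
          bounded_bilinear.continuous_on [OF bounded_bilinear_cinner])
  qed
  have "x \<in> (\<Union>k. S k)" for x
  proof -
    obtain C where "\<forall>y\<in>Y. cmod (cinner x y) \<le> C"
      using assms by blast
    then have "x \<in> S (nat \<lceil>C\<rceil>)"
      unfolding S_def using real_nat_ceiling_ge [of C] order_trans by blast
    then show ?thesis by blast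
  qed
  then have U: "\<Union>(range S) = UNIV" by blast
  have "\<exists>k. interior (S k) \<noteq> {}"
  proof (rule ccontr)
    assume "\<not> ?thesis"
    then have "interior (\<Union>(range S)) = {}"
      using clS Baire_category_alt [of "euclidean :: 'a topology" "range S"]
      by (auto simp: completely_metrizable_space_euclidean)
    with U show False by simp
  qed
  then obtain k x r where "0 < r" "ball x r \<subseteq> S k"
    by (meson all_not_in_conv mem_interior)
  then have S: "cmod (cinner w y) \<le> real k" if "norm (w - x) < r" "y \<in> Y" for w y
  proof -
    have "w \<in> ball x r"
      using that by (simp add: dist_norm norm_minus_commute)
    then show ?thesis
      using \<open>ball x r \<subseteq> S k\<close> that(2) unfolding S_def by blast
  qed
  have "norm y \<le> 4 * real k / r" if y: "y \<in> Y" for y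
  proof (cases "y = 0")
    case False
    \<comment> \<open>Half the radius: \<open>x + t *\<^sub>R y\<close> stays in the ball, and its
      difference from the centre pairs with \<open>y\<close> to r/2 times the norm of
      \<open>y\<close>.\<close>
    define t where "t = r / (2 * norm y)"
    have t: "0 < t" "t * norm y = r / 2"
      using False \<open>0 < r\<close> by (auto simp: t_def)
    have "cmod (cinner (t *\<^sub>R y) y) = cmod (cinner (x + t *\<^sub>R y) y - cinner x y)"
      by (simp add: cinner_simps)
    also have "\<dots> \<le> cmod (cinner (x + t *\<^sub>R y) y) + cmod (cinner x y)"
      by (rule norm_triangle_ineq4)
    also have "\<dots> \<le> real k + real k"
      using S [of "x + t *\<^sub>R y" y] S [of x y] t y \<open>0 < r\<close> by (intro add_mono) auto
    also have "cinner (t *\<^sub>R y) y = complex_of_real (t * norm y * norm y)"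
      by (simp only: scaleC_of_real [symmetric] cinner_scaleC_left cinner_self power2_eq_square
          of_real_mult mult.assoc)
    also have "t * norm y * norm y = r / 2 * norm y"
      by (simp only: t)
    also have "cmod (of_real (r / 2 * norm y)) = r / 2 * norm y"
      using \<open>0 < r\<close> by (simp only: norm_of_real) simp
    finally have "r / 2 * norm y \<le> 2 * real k"
      by simp
    then show ?thesis
      using \<open>0 < r\<close> by (simp add: field_simps)
  qed (use \<open>0 < r\<close> in simp)
  then show ?thesis
    using \<open>0 < r\<close> by (intro that [of "4 * real k / r"]) auto
qed

text \<open>The image of the unit ball is weakly bounded, because pairing with \<open>x\<close> is
  controlled by the norm of \<open>T' x\<close>; uniform boundedness makes it norm bounded.
  Linearity is read off the adjoint relation, so exhibiting any adjoint map proves an operator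
  bounded.\<close>

lemma hellinger_toeplitz:
  fixes T :: "'a::complex_hilbert \<Rightarrow> 'b::complex_hilbert"
  assumes adj: "\<And>x y. cinner (T x) y = cinner x (T' y)"
  shows "bounded_clinear T"
proof -
  have "\<exists>C. \<forall>y \<in> T ` cball 0 1. cmod (cinner x y) \<le> C" for x
  proof (rule exI [of _ "norm (T' x)"], clarify)
    fix y :: 'a
    assume y: "y \<in> cball 0 1"
    have "cmod (cinner x (T y)) = cmod (cinner y (T' x))"
      by (metis adj cinner_commute complex_mod_cnj)
    also have "\<dots> \<le> norm y * norm (T' x)"
      by (rule cinner_bound)
    also have "\<dots> \<le> 1 * norm (T' x)"
      using y by (intro mult_right_mono) auto
    finally show "cmod (cinner x (T y)) \<le> norm (T' x)" by simp
  qed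
  then obtain C where C: "0 \<le> C" "\<And>y. y \<in> T ` cball 0 1 \<Longrightarrow> norm y \<le> C"
    using uniform_boundedness by blast
  have lin: "T (c *\<^sub>C x + y) = c *\<^sub>C T x + T y" for c x y
    by (rule cinner_ext_left) (simp add: cinner_simps adj)
  have T0: "T 0 = 0"
    using lin [of 1 0 0] by simp
  show ?thesis
  proof (rule bounded_clinearI [where K = C])
    show "norm (T x) \<le> C * norm x" for x
    proof (cases "x = 0")
      case False
      define c where "c = complex_of_real (1 / norm x)"
      have "T (c *\<^sub>C x) = c *\<^sub>C T x"
        using lin [of c x 0] by (simp add: T0)
      moreover have "norm (T (c *\<^sub>C x)) \<le> C"
        by (rule C(2)) (use False in \<open>auto simp: norm_scaleC c_def norm_divide\<close>)
      ultimately have "1 / norm x * norm (T x) \<le> C"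
        by (simp add: norm_scaleC c_def norm_divide)
      then show ?thesis
        using False by (simp add: field_simps)
    qed (simp add: T0)
  qed (rule lin)
qed

section \<open>Operator functions and symmetric bounded operators\<close>

lemma operator_holomorphic_on_diff_const:
  assumes F: "operator_holomorphic_on F S" and K: "bounded_clinear K"
  shows "operator_holomorphic_on (\<lambda>z h. F z h - K h) S"
  using assms unfolding operator_holomorphic_on_def by (simp add: bounded_clinear_diff)

lemma cinner_bounded_adjoint:
  fixes T :: "'a::complex_hilbert \<Rightarrow> 'a"
  assumes T: "bounded_clinear T"
  shows "cinner (T x) y = cinner x (bounded_adjoint T y)"
proof -
  obtain C where C: "0 < C" "\<And>x. norm (T x) \<le> C * norm x"
    using bounded_clinear_norm_bound [OF T] by blast
  have "cmod (cinner (T x) y) \<le> C * norm y * norm x" for x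
  proof -
    have "cmod (cinner (T x) y) \<le> norm (T x) * norm y"
      by (rule cinner_bound)
    also have "\<dots> \<le> C * norm x * norm y"
      by (intro mult_right_mono C) simp
    finally show ?thesis
      by (simp only: mult_ac)
  qed
  then obtain v where v: "\<And>x. cinner (T x) y = cinner x v"
    by (rule riesz_representation [of "\<lambda>x. cinner (T x) y", rotated])
      (use bounded_clinearD [OF T] in \<open>auto simp: cinner_simps\<close>)
  then show ?thesis
    using bounded_adjointI [OF v] by simp
qed

text \<open>Polarization at \<open>x + y\<close> and \<open>x + \<i> *\<^sub>C y\<close> of the
  sesquilinear form \<open>d\<close>, whose diagonal vanishes because the quadratic form is
  real.\<close>

lemma real_form_imp_symmetric:
  fixes T :: "'a::complex_inner \<Rightarrow> 'a"
  assumes T: "bounded_clinear T" and real: "\<And>x. Im (cinner (T x) x) = 0"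
  shows "cinner (T x) y = cinner x (T y)"
proof -
  define d where "d x y = cinner (T x) y - cinner x (T y)" for x y
  have d0: "d x x = 0" for x
  proof -
    have "cinner x (T x) = cnj (cinner (T x) x)"
      by (rule cinner_commute)
    then show ?thesis
      using real [of x] by (simp add: d_def complex_eq_iff)
  qed
  have "d (x + y) (x + y) = d x x + d x y + d y x + d y y"
    by (simp add: d_def bounded_clinearD [OF T] cinner_simps)
  then have 1: "d x y + d y x = 0"
    by (simp add: d0)
  have "d (x + \<i> *\<^sub>C y) (x + \<i> *\<^sub>C y) = d x x - \<i> * d x y + \<i> * d y x + d y y"
    by (simp add: d_def bounded_clinearD [OF T] cinner_simps algebra_simps)
  then have "\<i> * (d y x - d x y) = 0"
    by (simp add: d0 algebra_simps)
  with 1 have "d x y = 0" by auto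
  then show ?thesis
    by (simp add: d_def)
qed

text \<open>The difference of the values at \<open>w\<close> and \<open>z\<close> is w - z times
  \<open>Q w + D\<close>, and the operator norm of \<open>Q w\<close> tends to 0.\<close>

lemma operator_holomorphic_tendsto:
  assumes F: "operator_holomorphic_on F S" and z: "z \<in> S"
  shows "((\<lambda>w. F w h) \<longlongrightarrow> F z h) (at z within S)"
proof -
  obtain D where D: "bounded_clinear D"
    "((\<lambda>w. onorm (\<lambda>h. (1 / (w - z)) *\<^sub>C (F w h - F z h) - D h)) \<longlongrightarrow> 0) (at z within S)"
    using assms unfolding operator_holomorphic_on_def by blast
  define Q where "Q w h = (1 / (w - z)) *\<^sub>C (F w h - F z h) - D h" for w h
  have "((\<lambda>w. F w h - F z h) \<longlongrightarrow> 0) (at z within S)"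
  proof (rule Lim_null_comparison)
    show "\<forall>\<^sub>F w in at z within S.
        norm (F w h - F z h) \<le> cmod (w - z) * (onorm (Q w) * norm h + norm (D h))"
      unfolding eventually_at_filter
    proof (intro always_eventually allI impI)
      fix w
      assume "w \<noteq> z" "w \<in> S"
      then have *: "bounded_clinear (\<lambda>h. F w h - F z h)"
        using F z unfolding operator_holomorphic_on_def by (blast intro: bounded_clinear_diff)
      have "bounded_clinear (\<lambda>h. (1 / (w - z)) *\<^sub>C (F w h - F z h))"
        by (rule bounded_clinear_compose [OF _ *])
          (simp add: bounded_clinear_def bounded_linear_scaleC scaleC_scaleC mult.commute)
      then have "bounded_clinear (Q w)"
        unfolding Q_def by (intro bounded_clinear_diff D)
      then have "norm (Q w h) \<le> onorm (Q w) * norm h"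
        by (simp add: onorm bounded_clinear_def)
      moreover have "F w h - F z h = (w - z) *\<^sub>C (Q w h + D h)"
        using \<open>w \<noteq> z\<close> by (simp add: Q_def scaleC_scaleC)
      then have "norm (F w h - F z h) = cmod (w - z) * norm (Q w h + D h)"
        by (simp add: norm_scaleC)
      ultimately show "norm (F w h - F z h) \<le> cmod (w - z) * (onorm (Q w) * norm h + norm (D h))"
        using norm_triangle_ineq [of "Q w h" "D h"] by (auto intro: mult_left_mono)
    qed
    have "((\<lambda>w. cmod (w - z) * (onorm (Q w) * norm h + norm (D h)))
        \<longlongrightarrow> cmod (z - z) * (0 * norm h + norm (D h))) (at z within S)"
      using D(2) unfolding Q_def by (intro tendsto_intros)
    then show "((\<lambda>w. cmod (w - z) * (onorm (Q w) * norm h + norm (D h))) \<longlongrightarrow> 0) (at z within S)"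
      by simp
  qed
  then show ?thesis
    by (simp add: LIM_zero_iff)
qed

section \<open>Unbounded operators\<close>

lemma linear_operatorD:
  assumes "linear_operator A"
  shows "A 0 = Some 0"
    and "A f = Some u \<Longrightarrow> A g = Some v \<Longrightarrow> A (c *\<^sub>C f + g) = Some (c *\<^sub>C u + v)"
    and "A f = Some u \<Longrightarrow> A g = Some v \<Longrightarrow> A (f + g) = Some (u + v)"
    and "A f = Some u \<Longrightarrow> A g = Some v \<Longrightarrow> A (f - g) = Some (u - v)"
    and "A f = Some u \<Longrightarrow> A (c *\<^sub>C f) = Some (c *\<^sub>C u)"
proof -
  have *: "A (c *\<^sub>C f + g) = Some (c *\<^sub>C u + v)" if "A f = Some u" "A g = Some v" for c f g u v
    using assms that unfolding linear_operator_def by blast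
  show 0: "A 0 = Some 0"
    using assms unfolding linear_operator_def by blast
  show "A f = Some u \<Longrightarrow> A g = Some v \<Longrightarrow> A (c *\<^sub>C f + g) = Some (c *\<^sub>C u + v)"
    by (rule *)
  show "A f = Some u \<Longrightarrow> A g = Some v \<Longrightarrow> A (f + g) = Some (u + v)"
    using * [of f u g v 1] by simp
  show "A f = Some u \<Longrightarrow> A g = Some v \<Longrightarrow> A (f - g) = Some (u - v)"
    using * [of g v f u "-1"] by (simp add: scaleC_minus_one)
  show "A f = Some u \<Longrightarrow> A (c *\<^sub>C f) = Some (c *\<^sub>C u)"
    using * [of f u 0 0 c] 0 by simp
qed

lemma densely_defined_ext:
  assumes "densely_defined A" and eq: "\<And>f u. A f = Some u \<Longrightarrow> cinner f h = cinner f k"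
  shows "h = k"
proof -
  have "h - k \<in> closure (dom A)"
    using assms(1) by (simp add: densely_defined_def)
  then obtain X where X: "\<And>n. X n \<in> dom A" "X \<longlonglongrightarrow> h - k"
    unfolding closure_sequential by blast
  have "(\<lambda>n. cinner (X n) (h - k)) \<longlonglongrightarrow> cinner (h - k) (h - k)"
    by (intro tendsto_intros X(2))
  moreover have "cinner (X n) (h - k) = 0" for n
    using X(1) [of n] eq by (auto simp: cinner_diff_right)
  ultimately have "cinner (h - k) (h - k) = 0"
    by (simp add: LIMSEQ_const_iff)
  then show ?thesis by simp
qed

text \<open>Density makes the vector in the definite description unique. The definition of
  \<open>adj\<close> is unfolded only here.\<close>

lemma adj_eq_Some_iff:
  assumes "densely_defined A"
  shows "adj A g = Some h \<longleftrightarrow> (\<forall>f u. A f = Some u \<longrightarrow> cinner u g = cinner f h)"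
proof -
  define P where "P h \<longleftrightarrow> (\<forall>f\<in>dom A. cinner (the (A f)) g = cinner f h)" for h
  have P: "P h \<longleftrightarrow> (\<forall>f u. A f = Some u \<longrightarrow> cinner u g = cinner f h)" for h
    unfolding P_def by (metis domD domI option.sel)
  have "h = k" if "P h" "P k" for h k
  proof (rule densely_defined_ext [OF assms])
    show "cinner f h = cinner f k" if "A f = Some u" for f u
      using \<open>P h\<close> \<open>P k\<close> that unfolding P by metis
  qed
  then have "(THE h. P h) = h" if "P h" for h
    using that by blast
  moreover have "adj A g = (if \<exists>h. P h then Some (THE h. P h) else None)"
    by (simp add: adj_def P_def)
  ultimately show ?thesis
    unfolding P [symmetric] by (auto split: if_splits)
qed

lemma symmetric_operatorD:
  assumes "symmetric_operator A" "A f = Some u" "A g = Some v"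
  shows "cinner u g = cinner f v"
  using assms unfolding symmetric_operator_def by force

lemma nonneg_operator_iff:
  "nonneg_operator A \<longleftrightarrow> (\<forall>f u. A f = Some u \<longrightarrow> 0 \<le> Re (cinner u f) \<and> Im (cinner u f) = 0)"
  unfolding nonneg_operator_def complex_nonneg_Reals_iff by (metis domD domI option.sel)

lemma linear_operator_adj: "densely_defined A \<Longrightarrow> linear_operator (adj A)"
  unfolding linear_operator_def by (auto simp: adj_eq_Some_iff cinner_simps)

section \<open>Lower bounds and closed ranges\<close>

lemma symmetric_lower_bound:
  assumes "symmetric_operator A" "A f = Some u"
  shows "\<bar>Im z\<bar> * norm f \<le> norm (u - z *\<^sub>C f)"
proof (cases "f = 0")
  case False
  have "cinner u f = cnj (cinner u f)"
    using assms symmetric_operatorD cinner_commute by metis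
  then have "Im (cinner u f) = 0"
    by (metis Reals_cnj_iff complex_is_Real_iff)
  then have "Im (cinner (u - z *\<^sub>C f) f) = - Im z * (norm f)\<^sup>2"
    by (simp add: cinner_simps cinner_self)
  then have "\<bar>Im z\<bar> * (norm f)\<^sup>2 \<le> cmod (cinner (u - z *\<^sub>C f) f)"
    using abs_Im_le_cmod [of "cinner (u - z *\<^sub>C f) f"] by (simp add: abs_mult)
  also have "\<dots> \<le> norm (u - z *\<^sub>C f) * norm f"
    by (rule cinner_bound)
  finally show ?thesis
    using False by (simp add: power2_eq_square)
qed simp

lemma nonneg_lower_bound:
  assumes "nonneg_operator A" "A f = Some u"
  shows "- x * norm f \<le> norm (u - of_real x *\<^sub>C f)"
proof (cases "f = 0")
  case False
  have "0 \<le> Re (cinner u f)"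
    using assms by (auto simp: nonneg_operator_iff)
  then have "- x * (norm f)\<^sup>2 \<le> Re (cinner (u - of_real x *\<^sub>C f) f)"
    by (simp add: cinner_simps cinner_self)
  also have "\<dots> \<le> cmod (cinner (u - of_real x *\<^sub>C f) f)"
    by (rule complex_Re_le_cmod)
  also have "\<dots> \<le> norm (u - of_real x *\<^sub>C f) * norm f"
    by (rule cinner_bound)
  finally show ?thesis
    using False mult_right_le_imp_le [of "- x * norm f" "norm f"]
    by (simp add: power2_eq_square)
qed simp

text \<open>By the lower bound, preimages of a convergent sequence in the range of B - z are Cauchy,
  so with \<open>B\<close> closed the range \<open>S\<close> is closed and \<open>y\<close> can be
  projected onto it. For \<open>A\<close> the remainder \<open>n\<close> becomes a defect vector;
  for self-adjoint operators it will vanish.\<close>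

lemma range_decomposition:
  fixes B :: "'a::complex_hilbert \<rightharpoonup> 'a"
  assumes lin: "linear_operator B" and cl: "closed_operator B" and "0 < c"
    and bd: "\<And>f u. B f = Some u \<Longrightarrow> c * norm f \<le> norm (u - z *\<^sub>C f)"
  obtains f u n where "B f = Some u" "y = u - z *\<^sub>C f + n"
    "\<And>g v. B g = Some v \<Longrightarrow> cinner (v - z *\<^sub>C g) n = 0"
proof -
  define S where "S = {u - z *\<^sub>C f | f u. B f = Some u}"
  note B = linear_operatorD [OF lin]
  have "csubspace S"
    unfolding csubspace_def
  proof (intro conjI allI ballI)
    show "0 \<in> S"
      unfolding S_def using B(1) by (intro CollectI exI [of _ 0]) simp
    fix a x y
    assume "x \<in> S" "y \<in> S"
    then obtain f u g v where *: "x = u - z *\<^sub>C f" "B f = Some u" "y = v - z *\<^sub>C g" "B g = Some v"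
      by (auto simp: S_def)
    have "a *\<^sub>C x + y = (a *\<^sub>C u + v) - z *\<^sub>C (a *\<^sub>C f + g)"
      by (simp add: * scaleC_simps mult.commute)
    then show "a *\<^sub>C x + y \<in> S"
      using B(2) [OF *(2,4), of a] unfolding S_def by blast
  qed
  moreover have "closed S"
    unfolding closed_sequential_limits
  proof safe
    fix s l
    assume s: "\<forall>n. s n \<in> S" "s \<longlonglongrightarrow> l"
    then obtain f u where fu: "\<And>n. B (f n) = Some (u n)" "\<And>n. s n = u n - z *\<^sub>C f n"
      unfolding S_def by (atomize_elim, simp) metis
    have le: "c * norm (f m - f n) \<le> norm (s m - s n)" for m n
    proof -
      have "s m - s n = (u m - u n) - z *\<^sub>C (f m - f n)"
        by (simp add: fu scaleC_simps)
      then show ?thesis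
        using bd [OF B(4) [OF fu(1) fu(1)], of m n] by simp
    qed
    have "Cauchy f"
    proof (rule metric_CauchyI)
      fix e :: real
      assume "0 < e"
      then have "0 < c * e"
        using \<open>0 < c\<close> by simp
      with metric_CauchyD [OF LIMSEQ_imp_Cauchy [OF s(2)]]
      obtain N where N: "\<And>m n. m \<ge> N \<Longrightarrow> n \<ge> N \<Longrightarrow> dist (s m) (s n) < c * e"
        by blast
      have "dist (f m) (f n) < e" if "m \<ge> N" "n \<ge> N" for m n
      proof -
        have "c * norm (f m - f n) < c * e"
          using le [of m n] N [OF that] by (simp add: dist_norm)
        then show ?thesis
          using \<open>0 < c\<close> by (simp add: dist_norm)
      qed
      then show "\<exists>N. \<forall>m\<ge>N. \<forall>n\<ge>N. dist (f m) (f n) < e"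
        by blast
    qed
    then obtain g where g: "f \<longlonglongrightarrow> g"
      using Cauchy_convergent convergent_def by blast
    have "u = (\<lambda>n. s n + z *\<^sub>C f n)"
      by (simp add: fu)
    then have "u \<longlonglongrightarrow> l + z *\<^sub>C g"
      using s(2) g by (auto intro!: tendsto_intros)
    then have "(\<lambda>n. (f n, u n)) \<longlonglongrightarrow> (g, l + z *\<^sub>C g)"
      using g by (intro tendsto_Pair)
    then have "(g, l + z *\<^sub>C g) \<in> Map.graph B"
      using cl fu(1) unfolding closed_operator_def closed_sequential_limits
      by (meson in_graphI)
    then have "B g = Some (l + z *\<^sub>C g)"
      by (rule in_graphD)
    moreover have "l = (l + z *\<^sub>C g) - z *\<^sub>C g"
      by simp
    ultimately show "l \<in> S"
      unfolding S_def by blast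
  qed
  ultimately obtain p where p: "p \<in> S" "\<And>s. s \<in> S \<Longrightarrow> cinner s (y - p) = 0"
    using orthogonal_projection by blast
  then obtain f u where "p = u - z *\<^sub>C f" "B f = Some u"
    by (auto simp: S_def)
  then show ?thesis
    using p(2) by (intro that [of f u "y - p"]) (auto simp: S_def)
qed

section \<open>Self-adjoint operators and their resolvent sets\<close>

definition selfadjoint_operator :: "('a::complex_inner \<rightharpoonup> 'a) \<Rightarrow> bool" where
  "selfadjoint_operator B \<longleftrightarrow>
     (\<forall>g h. B g = Some h \<longleftrightarrow> (\<forall>f u. B f = Some u \<longrightarrow> cinner u g = cinner f h))"

lemma selfadjoint_operatorD:
  assumes "selfadjoint_operator B"
  shows "B f = Some u \<Longrightarrow> B g = Some h \<Longrightarrow> cinner u g = cinner f h"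
    and "(\<And>f u. B f = Some u \<Longrightarrow> cinner u g = cinner f h) \<Longrightarrow> B g = Some h"
  using assms unfolding selfadjoint_operator_def by blast+

lemma selfadjoint_symmetric: "selfadjoint_operator B \<Longrightarrow> symmetric_operator B"
  unfolding symmetric_operator_def dom_def using selfadjoint_operatorD(1) by fastforce

lemma selfadjoint_closed:
  assumes "selfadjoint_operator B"
  shows "closed_operator B"
  unfolding closed_operator_def closed_sequential_limits
proof safe
  fix X f u
  assume X: "\<forall>n. X n \<in> Map.graph B" "X \<longlonglongrightarrow> (f, u)"
  have "B f = Some u"
  proof (rule selfadjoint_operatorD(2) [OF assms])
    fix g v
    assume g: "B g = Some v"
    have "B (fst (X n)) = Some (snd (X n))" for n
      using X(1) by (metis in_graphD prod.collapse)
    then have "cinner v (fst (X n)) = cinner g (snd (X n))" for n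
      using g selfadjoint_operatorD(1) [OF assms] by blast
    moreover have "(\<lambda>n. cinner v (fst (X n))) \<longlonglongrightarrow> cinner v f"
      using tendsto_fst [OF X(2)] by (intro tendsto_intros) simp
    moreover have "(\<lambda>n. cinner g (snd (X n))) \<longlonglongrightarrow> cinner g u"
      using tendsto_snd [OF X(2)] by (intro tendsto_intros) simp
    ultimately show "cinner v f = cinner g u"
      using LIMSEQ_unique by simp
  qed
  then show "(f, u) \<in> Map.graph B"
    by (rule in_graphI)
qed

text \<open>By self-adjointness the remainder orthogonal to the range of B - z lies in the kernel of
  B - cnj z, which the second lower bound makes trivial.\<close>

lemma selfadjoint_surjective:
  fixes B :: "'a::complex_hilbert \<rightharpoonup> 'a"
  assumes B: "linear_operator B" "selfadjoint_operator B" and "0 < c"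
    and bd: "\<And>f u. B f = Some u \<Longrightarrow> c * norm f \<le> norm (u - z *\<^sub>C f)"
      "\<And>f u. B f = Some u \<Longrightarrow> c * norm f \<le> norm (u - cnj z *\<^sub>C f)"
  shows "\<exists>f u. B f = Some u \<and> y = u - z *\<^sub>C f"
proof -
  obtain f u n where *: "B f = Some u" "y = u - z *\<^sub>C f + n"
    "\<And>g v. B g = Some v \<Longrightarrow> cinner (v - z *\<^sub>C g) n = 0"
    by (rule range_decomposition [OF B(1) selfadjoint_closed [OF B(2)] \<open>0 < c\<close> bd(1), of y]) blast+
  have "B n = Some (cnj z *\<^sub>C n)"
    by (rule selfadjoint_operatorD(2) [OF B(2)]) (use *(3) in \<open>simp add: cinner_simps\<close>)
  then have "n = 0"
    using bd(2) [of n] \<open>0 < c\<close> by (simp add: mult_le_0_iff)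
  then show ?thesis
    using * by auto
qed

text \<open>Surjectivity at both points suffices: the inverses are then everywhere defined and mutually
  adjoint, hence bounded by the Hellinger--Toeplitz theorem.\<close>

lemma symmetric_resolvent_setI:
  fixes B :: "'a::complex_hilbert \<rightharpoonup> 'a"
  assumes lin: "linear_operator B" and sym: "symmetric_operator B"
    and surj: "\<And>y. \<exists>f u. B f = Some u \<and> y = u - z *\<^sub>C f"
      "\<And>y. \<exists>f u. B f = Some u \<and> y = u - cnj z *\<^sub>C f"
  shows "z \<in> resolvent_set B"
proof -
  have "\<exists>f. B f = Some (y + z *\<^sub>C f)" for y
    using surj(1) [of y] by (auto simp: algebra_simps)
  then obtain R where R: "\<And>y. B (R y) = Some (y + z *\<^sub>C R y)"
    by metis
  have "\<exists>f. B f = Some (y + cnj z *\<^sub>C f)" for y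
    using surj(2) [of y] by (auto simp: algebra_simps)
  then obtain R' where R': "\<And>y. B (R' y) = Some (y + cnj z *\<^sub>C R' y)"
    by metis
  \<comment> \<open>A vector in the kernel of B - z is orthogonal to the range of B - cnj z, hence
    to itself, since \<open>f\<close> is the image of \<open>R' f\<close>.\<close>
  have inj: "f = 0" if "B f = Some (z *\<^sub>C f)" for f
    using symmetric_operatorD [OF sym that R' [of f]] by (simp add: cinner_simps)
  have "cinner (R x) y = cinner x (R' y)" for x y
    using symmetric_operatorD [OF sym R [of x] R' [of y]] by (simp add: cinner_simps)
  then have "bounded_clinear R"
    by (rule hellinger_toeplitz)
  moreover have "R (u - z *\<^sub>C f) = f" if "B f = Some u" for f u
  proof -
    have "B (R (u - z *\<^sub>C f) - f) = Some (z *\<^sub>C (R (u - z *\<^sub>C f) - f))"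
      using linear_operatorD(4) [OF lin R [of "u - z *\<^sub>C f"] that]
      by (simp add: scaleC_simps)
    then show ?thesis
      using inj by fastforce
  qed
  ultimately show ?thesis
    unfolding resolvent_set_def using R by (auto intro!: exI [of _ R])
qed

lemma resolvent_setE:
  assumes "z \<in> resolvent_set B"
  obtains R where "bounded_clinear R" "\<And>y. B (R y) = Some (y + z *\<^sub>C R y)"
    "\<And>f u. B f = Some u \<Longrightarrow> R (u - z *\<^sub>C f) = f"
proof -
  obtain R where R: "bounded_clinear R" "\<And>h. R h \<in> dom B \<and> the (B (R h)) - z *\<^sub>C R h = h"
    "\<And>f. f \<in> dom B \<Longrightarrow> R (the (B f) - z *\<^sub>C f) = f"
    using assms unfolding resolvent_set_def by blast
  show ?thesis
  proof (rule that [OF R(1)])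
    fix y
    obtain v where v: "B (R y) = Some v"
      using R(2) by blast
    moreover have "v - z *\<^sub>C R y = y"
      using R(2) [of y] v by simp
    ultimately show "B (R y) = Some (y + z *\<^sub>C R y)"
      by (simp add: diff_eq_eq)
  next
    show "R (u - z *\<^sub>C f) = f" if "B f = Some u" for f u
      using R(3) [of f] that by auto
  qed
qed

lemma selfadjoint_nonreal_resolvent_set:
  fixes B :: "'a::complex_hilbert \<rightharpoonup> 'a"
  assumes B: "linear_operator B" "selfadjoint_operator B" and "Im z \<noteq> 0"
  shows "z \<in> resolvent_set B"
proof -
  have sym: "symmetric_operator B"
    using B(2) by (rule selfadjoint_symmetric)
  have *: "\<exists>f u. B f = Some u \<and> y = u - w *\<^sub>C f" if "Im w \<noteq> 0" for y w
    using symmetric_lower_bound [OF sym, of _ _ w] symmetric_lower_bound [OF sym, of _ _ "cnj w"]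
      that by (intro selfadjoint_surjective [OF B, of "\<bar>Im w\<bar>"]) auto
  show ?thesis
    by (rule symmetric_resolvent_setI [OF B(1) sym]) (use * \<open>Im z \<noteq> 0\<close> in auto)
qed

lemma selfadjoint_nonneg_resolvent_set:
  fixes B :: "'a::complex_hilbert \<rightharpoonup> 'a"
  assumes B: "linear_operator B" "selfadjoint_operator B"
    and nonneg: "nonneg_operator B" and "z \<notin> \<real>\<^sub>\<ge>\<^sub>0"
  shows "z \<in> resolvent_set B"
proof (cases "Im z = 0")
  case True
  with \<open>z \<notin> \<real>\<^sub>\<ge>\<^sub>0\<close> obtain x where x: "z = of_real x" "x < 0"
    by (metis complex_nonneg_Reals_iff complex_is_Real_iff Reals_cases Re_complex_of_real not_le)
  have *: "\<exists>f u. B f = Some u \<and> y = u - z *\<^sub>C f" for y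
    using nonneg_lower_bound [OF nonneg, of _ _ x] x
    by (intro selfadjoint_surjective [OF B, of "- x"]) auto
  show ?thesis
    by (rule symmetric_resolvent_setI [OF B(1) selfadjoint_symmetric [OF B(2)]]) (use * x in auto)
qed (rule selfadjoint_nonreal_resolvent_set [OF B])

section \<open>Cauchy--Schwarz for forms; nonnegativity from negative resolvent points\<close>

lemma cauchy_schwarz_nonneg_operator:
  assumes lin: "linear_operator A" and sym: "symmetric_operator A" and nonneg: "nonneg_operator A"
    and x: "A x = Some u" and y: "A y = Some v"
  shows "(cmod (cinner u y))\<^sup>2 \<le> Re (cinner u x) * Re (cinner v y)"
proof -
  define e where "e = cinner u y"
  define a where "a = Re (cinner u x)"
  define b where "b = Re (cinner v y)"
  have e: "cinner v x = cnj e"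
    using symmetric_operatorD [OF sym x y] by (metis cinner_commute e_def)
  \<comment> \<open>With \<open>e\<close> built into the coefficient \<open>c\<close>, the form at
    \<open>c *\<^sub>C y + x\<close> is a polynomial in the real variable \<open>t\<close>, both
    cross terms being t |e|^2.\<close>
  have q: "0 \<le> t\<^sup>2 * (cmod e)\<^sup>2 * b + 2 * t * (cmod e)\<^sup>2 + a" for t
  proof -
    define c where "c = of_real t * e"
    have "cinner (c *\<^sub>C v + u) (c *\<^sub>C y + x)
        = of_real (t\<^sup>2) * (e * cnj e) * cinner v y + of_real (2 * t) * (e * cnj e) + cinner u x"
      by (simp add: cinner_simps e e_def [symmetric] c_def algebra_simps power2_eq_square)
    then have "Re (cinner (c *\<^sub>C v + u) (c *\<^sub>C y + x))
        = t\<^sup>2 * (cmod e)\<^sup>2 * b + 2 * t * (cmod e)\<^sup>2 + a"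
      by (simp add: complex_norm_square [symmetric] a_def b_def flip: of_real_power of_real_mult)
    moreover have "A (c *\<^sub>C y + x) = Some (c *\<^sub>C v + u)"
      using linear_operatorD(2) [OF lin y x] .
    ultimately show ?thesis
      using nonneg unfolding nonneg_operator_iff by metis
  qed
  have ab: "0 \<le> a" "0 \<le> b"
    using nonneg x y by (auto simp: a_def b_def nonneg_operator_iff)
  show ?thesis
  proof (cases "b = 0")
    case True
    have "(cmod e)\<^sup>2 = 0"
    proof (rule ccontr)
      assume ne: "(cmod e)\<^sup>2 \<noteq> 0"
      \<comment> \<open>For \<open>b = 0\<close> the polynomial is affine in \<open>t\<close>, and
        this \<open>t\<close> gives it the value - a - 2.\<close>
      define t where "t = - (a + 1) / (cmod e)\<^sup>2"
      have "t * (cmod e)\<^sup>2 = - (a + 1)"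
        using ne unfolding t_def by simp
      then show False
        using q [of t] True ab by (simp add: mult.assoc)
    qed
    then show ?thesis
      using True by (simp add: e_def b_def)
  next
    case False
    then have "0 < b" using ab by simp
    have "0 \<le> (1/b)\<^sup>2 * (cmod e)\<^sup>2 * b - 2 * (1/b) * (cmod e)\<^sup>2 + a"
      using q [of "- (1/b)"] by simp
    also have "(1/b)\<^sup>2 * (cmod e)\<^sup>2 * b - 2 * (1/b) * (cmod e)\<^sup>2 + a = a - (cmod e)\<^sup>2 / b"
      using \<open>0 < b\<close> by (simp add: power2_eq_square field_simps)
    finally have "(cmod e)\<^sup>2 \<le> a * b"
      using \<open>0 < b\<close> by (simp add: field_simps)
    then show ?thesis
      by (simp add: e_def a_def b_def)
  qed
qed

text \<open>Cauchy--Schwarz for the form of \<open>T\<close> at \<open>x\<close> and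
  \<open>T x\<close> bounds |T x|^4 by the product of the form at \<open>x\<close> and the form at
  \<open>T x\<close>; the latter is at most C |T x|^2. This converts estimates of forms into
  estimates of norms.\<close>

lemma nonneg_map_norm_bound:
  fixes T :: "'a::complex_inner \<Rightarrow> 'a"
  assumes lin: "\<And>c x y. T (c *\<^sub>C x + y) = c *\<^sub>C T x + T y"
    and sym: "\<And>x y. cinner (T x) y = cinner x (T y)"
    and nonneg: "\<And>x. 0 \<le> Re (cinner (T x) x)"
    and bd: "\<And>x. Re (cinner (T x) x) \<le> C * (norm x)\<^sup>2"
  shows "(norm (T x))\<^sup>2 \<le> C * Re (cinner (T x) x)"
proof (cases "T x = 0")
  case False
  have "((norm (T x))\<^sup>2)\<^sup>2 = (cmod (cinner (T x) (T x)))\<^sup>2"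
    by (simp add: cinner_self norm_power)
  also have "\<dots> \<le> Re (cinner (T x) x) * Re (cinner (T (T x)) (T x))"
  proof (rule cauchy_schwarz_nonneg_operator [where A = "\<lambda>x. Some (T x)"])
    show "linear_operator (\<lambda>x. Some (T x))"
      using lin [of 1 0 0] by (simp add: linear_operator_def lin)
    show "symmetric_operator (\<lambda>x. Some (T x))"
      by (simp add: symmetric_operator_def sym)
    have "Im (cinner (T x) x) = 0" for x
      by (metis Reals_cnj_iff cinner_commute complex_is_Real_iff sym)
    then show "nonneg_operator (\<lambda>x. Some (T x))"
      by (simp add: nonneg_operator_iff nonneg)
  qed simp_all
  also have "\<dots> \<le> Re (cinner (T x) x) * (C * (norm (T x))\<^sup>2)"
    by (intro mult_left_mono bd nonneg)
  finally have "(norm (T x))\<^sup>2 * (norm (T x))\<^sup>2 \<le> (C * Re (cinner (T x) x)) * (norm (T x))\<^sup>2"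
    by (simp only: power2_eq_square mult_ac)
  then show ?thesis
    by (rule mult_right_le_imp_le) (use False in simp)
qed simp

text \<open>The infimum of the numerical range of a negative-point resolvent is an approximate
  eigenvalue; if it were negative, a negative real number would lie in the spectrum.\<close>

lemma negative_resolvents_imp_nonneg:
  fixes B :: "'a::complex_hilbert \<rightharpoonup> 'a"
  assumes sym: "symmetric_operator B"
    and res: "\<And>x::real. x < 0 \<Longrightarrow> of_real x \<in> resolvent_set B"
  shows "nonneg_operator B"
proof -
  \<comment> \<open>Every negative \<open>x\<close> is a lower bound for the form of
    \<open>B\<close>: the form of B - x at \<open>f\<close> equals the form of the resolvent at (B -
    x) f.\<close>
  have Re_nonneg: "x * (norm f)\<^sup>2 \<le> Re (cinner u f)" if "x < 0" "B f = Some u" for x f u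
  proof -
    obtain R where R: "bounded_clinear R" "\<And>y. B (R y) = Some (y + of_real x *\<^sub>C R y)"
      "\<And>f u. B f = Some u \<Longrightarrow> R (u - of_real x *\<^sub>C f) = f"
      using resolvent_setE [OF res [OF \<open>x < 0\<close>]] by blast
    have symR: "cinner (R a) b = cinner a (R b)" for a b
      using symmetric_operatorD [OF sym R(2) R(2), of a b] by (simp add: cinner_simps)
    obtain C where C: "0 < C" "\<And>y. norm (R y) \<le> C * norm y"
      using bounded_clinear_norm_bound [OF R(1)] by blast
    have q: "\<bar>Re (cinner (R y) y)\<bar> \<le> C * (norm y)\<^sup>2" for y
    proof -
      have "\<bar>Re (cinner (R y) y)\<bar> \<le> norm (R y) * norm y"
        using abs_Re_le_cmod cinner_bound order_trans by blast
      also have "\<dots> \<le> C * norm y * norm y"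
        by (intro mult_right_mono C) simp
      finally show ?thesis
        by (simp add: power2_eq_square mult.assoc)
    qed
    have Rnn: "0 \<le> Re (cinner (R y) y)" for y
    proof (rule ccontr)
      assume "\<not> ?thesis"
      then have neg: "Re (cinner (R y) y) < 0" by simp
      define S where "S = (\<lambda>y. Re (cinner (R y) y)) ` sphere 0 1"
      define m where "m = Inf S"
      have bdd: "bdd_below S"
        unfolding S_def
      proof (rule bdd_belowI2 [of _ "- C"])
        show "- C \<le> Re (cinner (R e) e)" if "e \<in> sphere 0 1" for e
          using q [of e] that by (simp add: abs_le_iff)
      qed
      have m_le: "m * (norm y)\<^sup>2 \<le> Re (cinner (R y) y)" for y
      proof (cases "y = 0")
        case False
        define e where "e = of_real (1 / norm y) *\<^sub>C y"
        have "e \<in> sphere 0 1"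
          using False by (simp add: e_def norm_scaleC norm_divide)
        then have "m \<le> Re (cinner (R e) e)"
          unfolding m_def S_def[symmetric] using bdd by (auto intro!: cInf_lower simp: S_def)
        also have "cinner (R e) e = of_real (1 / (norm y)\<^sup>2) * cinner (R y) y"
          by (simp add: e_def bounded_clinearD [OF R(1)] cinner_simps power2_eq_square)
        finally have "m \<le> 1 / (norm y)\<^sup>2 * Re (cinner (R y) y)"
          by (simp only: Re_complex_of_real times_complex.sel Im_complex_of_real)
        then show ?thesis
          using False by (simp add: field_simps)
      qed (simp add: bounded_clinearD [OF R(1)])
      have m: "m < 0"
        using m_le [of y] neg by (smt (verit) mult_nonneg_nonneg zero_le_power2)
      \<comment> \<open>Subtracting the infimum \<open>m\<close> leaves a nonnegative operator whose
        form is bounded by \<open>C - m\<close>.\<close>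
      define T where "T y = R y - of_real m *\<^sub>C y" for y
      have T_form: "cinner (T y) y = cinner (R y) y - of_real (m * (norm y)\<^sup>2)" for y
        by (simp add: T_def cinner_simps cinner_self)
      have T_bound: "(norm (T y))\<^sup>2 \<le> (C - m) * Re (cinner (T y) y)" for y
      proof (rule nonneg_map_norm_bound)
        show "T (c *\<^sub>C x + y) = c *\<^sub>C T x + T y" for c x y
          by (simp add: T_def bounded_clinearD [OF R(1)] scaleC_simps mult.commute)
        show "cinner (T x) y = cinner x (T y)" for x y
          by (simp add: T_def cinner_simps symR)
        show "0 \<le> Re (cinner (T x) x)" for x
          using m_le [of x] by (simp add: T_form)
        show "Re (cinner (T x) x) \<le> (C - m) * (norm x)\<^sup>2" for x
          using q [of x] by (simp add: T_form left_diff_distrib abs_le_iff)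
      qed
      \<comment> \<open>By spectral mapping, \<open>m\<close> in the spectrum of the resolvent at
        \<open>x\<close> corresponds to x + 1/m in the spectrum of \<open>B\<close>. As
        \<open>x1\<close> is negative, B - x1 is invertible, and this bounds \<open>T\<close> from
        below.\<close>
      define x1 where "x1 = x + 1 / m"
      have "1 / m < 0"
        using m by simp
      then have "x1 < 0"
        unfolding x1_def by (rule add_neg_neg [OF \<open>x < 0\<close>])
      then obtain R1 where R1: "bounded_clinear R1"
        "\<And>f u. B f = Some u \<Longrightarrow> R1 (u - of_real x1 *\<^sub>C f) = f"
        using resolvent_setE [OF res] by metis
      obtain C1 where C1: "0 < C1" "\<And>y. norm (R1 y) \<le> C1 * norm y"
        using bounded_clinear_norm_bound [OF R1(1)] by blast
      define L where "L = (C1 / - m + 1) / - m"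
      have L: "0 < L"
        using C1 m unfolding L_def by (intro divide_pos_pos add_pos_pos) auto
      have lower: "norm y \<le> L * norm (T y)" for y
      proof -
        have mm: "of_real m * of_real (1 / m) = (1::complex)"
          using m by simp
        have "R1 (y + of_real x *\<^sub>C R y - of_real x1 *\<^sub>C R y) = R y"
          using R1(2) [OF R(2)] .
        moreover have "y + of_real x *\<^sub>C R y - of_real x1 *\<^sub>C R y
            = (- of_real (1 / m)) *\<^sub>C T y"
          using mm by (simp add: T_def x1_def scaleC_simps mult.commute)
        ultimately have "R y = (- of_real (1 / m)) *\<^sub>C R1 (T y)"
          by (metis bounded_clinearD(3) [OF R1(1)])
        then have "norm (R y) = norm (R1 (T y)) / - m"
          using m by (simp add: norm_scaleC norm_divide)
        also have "\<dots> \<le> C1 * norm (T y) / - m"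
          using m C1 by (intro divide_right_mono) auto
        finally have Ry: "norm (R y) \<le> C1 / - m * norm (T y)" by simp
        have "of_real m *\<^sub>C y = R y - T y"
          by (simp add: T_def)
        then have "- m * norm y = norm (R y - T y)"
          using m by (metis abs_of_neg norm_of_real norm_scaleC)
        also have "\<dots> \<le> (C1 / - m + 1) * norm (T y)"
          using norm_triangle_ineq4 [of "R y" "T y"] Ry by (simp add: algebra_simps)
        finally have "norm y * - m \<le> (C1 / - m + 1) * norm (T y)"
          by (simp only: mult.commute)
        moreover have "0 < - m"
          using m by simp
        ultimately have "norm y \<le> (C1 / - m + 1) * norm (T y) / - m"
          by (simp only: pos_le_divide_eq)
        then show ?thesis
          by (simp add: L_def)
      qed
      \<comment> \<open>By \<open>lower\<close> and \<open>T_bound\<close> the form of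
        \<open>T\<close> is at least \<open>d\<close> on the unit sphere, so the infimum
        \<open>m\<close> would be at least \<open>m + d\<close>.\<close>
      define d where "d = 1 / (L\<^sup>2 * (C - m))"
      have Cm: "0 < C - m" using C m by simp
      then have d: "0 < d"
        using L by (simp add: d_def)
      have "m + d \<le> Inf S"
      proof (rule cInf_greatest)
        have "y \<noteq> 0"
          using neg bounded_clinearD(4) [OF R(1)] by auto
        then have "of_real (1 / norm y) *\<^sub>C y \<in> sphere 0 1"
          by (simp add: norm_scaleC norm_divide)
        then show "S \<noteq> {}"
          unfolding S_def by blast
        fix s
        assume "s \<in> S"
        then obtain e where e: "norm e = 1" "s = Re (cinner (R e) e)"
          by (auto simp: S_def)
        have "1 \<le> (L * norm (T e))\<^sup>2"
          using lower [of e] e by (simp add: one_le_power)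
        also have "\<dots> = L\<^sup>2 * (norm (T e))\<^sup>2"
          by (simp add: power_mult_distrib)
        also have "\<dots> \<le> L\<^sup>2 * ((C - m) * Re (cinner (T e) e))"
          by (intro mult_left_mono T_bound) simp
        also have "Re (cinner (T e) e) = s - m"
          by (simp add: T_form e)
        finally have "1 \<le> (L\<^sup>2 * (C - m)) * (s - m)"
          by (simp add: mult.assoc)
        then have "d \<le> s - m"
          using L Cm unfolding d_def by (subst pos_divide_le_eq) (auto simp: mult.commute)
        then show "m + d \<le> s" by simp
      qed
      with d show False by (simp add: m_def)
    qed
    have "0 \<le> Re (cinner f (u - of_real x *\<^sub>C f))"
      using Rnn [of "u - of_real x *\<^sub>C f"] R(3) [OF that(2)] by simp
    moreover have "Re (cinner f u) = Re (cinner u f)"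
      by (metis cinner_commute cnj.simps(1))
    ultimately show ?thesis
      by (simp add: cinner_simps cinner_self)
  qed
  have "0 \<le> Re (cinner u f)" if "B f = Some u" for f u
  proof (rule ccontr)
    define r where "r = Re (cinner u f)"
    \<comment> \<open>\<open>N\<close> exceeds the squared norm of \<open>f\<close> by 1, so the
      lower bound r / N would give r (N - 1) \<le> r N, impossible for negative
      \<open>r\<close>.\<close>
    define N where "N = (norm f)\<^sup>2 + 1"
    assume "\<not> ?thesis"
    then have r: "r < 0" by (simp add: r_def)
    have N: "0 < N" by (simp add: N_def add_nonneg_pos)
    have "r / N * (N - 1) \<le> r"
      using Re_nonneg [of "r / N", OF _ that] r N
      by (simp add: divide_neg_pos r_def N_def)
    then have "r * (N - 1) \<le> r * N"
      using N by (simp add: field_simps)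
    then show False
      using r by (simp add: algebra_simps)
  qed
  moreover have "Im (cinner u f) = 0" if "B f = Some u" for f u
    by (metis Reals_cnj_iff cinner_commute complex_is_Real_iff symmetric_operatorD [OF sym that that])
  ultimately show ?thesis
    by (simp add: nonneg_operator_iff)
qed

section \<open>The Friedrichs extension\<close>

locale nonneg_symmetric =
  fixes A :: "'a::complex_hilbert \<rightharpoonup> 'a"
  assumes lin: "linear_operator A" and dense: "densely_defined A"
    and sym: "symmetric_operator A" and nonneg: "nonneg_operator A"
begin

lemma adjD: "adj A g = Some h \<Longrightarrow> A f = Some u \<Longrightarrow> cinner u g = cinner f h"
  using adj_eq_Some_iff [OF dense] by blast

lemma operator_in_adj: "A f = Some u \<Longrightarrow> adj A f = Some u"
  using adj_eq_Some_iff [OF dense] symmetric_operatorD [OF sym] by blast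

section \<open>Approximating sequences and the closed form\<close>

lemma form_approx_Some:
  assumes "form_approx A X f"
  obtains U where "\<And>n. A (X n) = Some (U n)"
proof -
  have "A (X n) = Some (the (A (X n)))" for n
    using assms unfolding form_approx_def by (metis domIff option.collapse range_subsetD)
  then show ?thesis
    by (rule that)
qed

lemma form_approx_cauchy:
  assumes "form_approx A X f" "\<And>n. A (X n) = Some (U n)" "0 < e"
  obtains N where "\<And>m n. m \<ge> N \<Longrightarrow> n \<ge> N \<Longrightarrow> Re (cinner (U m - U n) (X m - X n)) < e"
proof -
  obtain N where N: "\<And>m n. m \<ge> N \<Longrightarrow> n \<ge> N \<Longrightarrow>
      cmod (cinner (the (A (X m - X n))) (X m - X n)) < e"
    using assms(1,3) unfolding form_approx_def by meson
  have A: "A (X m - X n) = Some (U m - U n)" for m n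
    by (rule linear_operatorD(4) [OF lin assms(2) assms(2)])
  show ?thesis
  proof (rule that)
    fix m n
    assume "m \<ge> N" "n \<ge> N"
    then have "cmod (cinner (U m - U n) (X m - X n)) < e"
      using N [of m n] by (simp add: A)
    then show "Re (cinner (U m - U n) (X m - X n)) < e"
      using complex_Re_le_cmod le_less_trans by blast
  qed
qed

lemma form_approx_bounded:
  assumes "form_approx A X f" "\<And>n. A (X n) = Some (U n)"
  obtains C N where "0 < C" "\<And>n. n \<ge> N \<Longrightarrow> Re (cinner (U n) (X n)) \<le> C"
proof -
  obtain N where N: "\<And>m n. m \<ge> N \<Longrightarrow> n \<ge> N \<Longrightarrow> Re (cinner (U m - U n) (X m - X n)) < 1"
    using form_approx_cauchy [OF assms zero_less_one] by blast
  have nn: "0 \<le> Re (cinner (U n) (X n))" for n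
    using nonneg assms(2) by (simp add: nonneg_operator_iff)
  have "Re (cinner (U n) (X n)) \<le> 2 * Re (cinner (U N) (X N)) + 2" if "n \<ge> N" for n
  proof -
    \<comment> \<open>For the form q, nonnegativity at X n - 2 X N is the inequality q(X n) \<le> 2
      q(X N) + 2 q(X n - X N).\<close>
    have "0 \<le> Re (cinner (U n - 2 *\<^sub>C U N) (X n - 2 *\<^sub>C X N))"
      using linear_operatorD(4) [OF lin assms(2) linear_operatorD(5) [OF lin assms(2)]] nonneg
      unfolding nonneg_operator_iff by blast
    then have "Re (cinner (U n) (X n))
        \<le> 2 * Re (cinner (U N) (X N)) + 2 * Re (cinner (U n - U N) (X n - X N))"
      by (simp add: cinner_simps)
    then show ?thesis
      using N [OF that order_refl] by simp
  qed
  then show ?thesis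
    using nn [of N] by (intro that [of "2 * Re (cinner (U N) (X N)) + 2" N]) auto
qed

text \<open>For a fixed index m, symmetry moves \<open>A\<close> onto \<open>Y m\<close>, so norm
  convergence of \<open>X\<close> gives the limit \<open>cinner w (Y m)\<close>. Replacing
  \<open>Y m\<close> by \<open>Y n\<close> costs little uniformly in n, by Cauchy--Schwarz for the
  form and boundedness of the form along \<open>X\<close>.\<close>

lemma form_approx_tendsto:
  assumes X: "form_approx A X f" and Y: "form_approx A Y g"
    and U: "\<And>n. A (X n) = Some (U n)" and f: "adj A f = Some w"
  shows "(\<lambda>n. cinner (U n) (Y n)) \<longlonglongrightarrow> cinner w g"
proof (rule LIMSEQ_I)
  fix e :: real
  assume "0 < e"
  obtain V where V: "\<And>n. A (Y n) = Some (V n)"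
    using form_approx_Some [OF Y] by blast
  obtain C N1 where C: "0 < C" "\<And>n. n \<ge> N1 \<Longrightarrow> Re (cinner (U n) (X n)) \<le> C"
    using form_approx_bounded [OF X U] by blast
  have "0 < (e / 3)\<^sup>2 / C"
    using C \<open>0 < e\<close> by simp
  then obtain N2 where N2: "\<And>m n. m \<ge> N2 \<Longrightarrow> n \<ge> N2 \<Longrightarrow>
      Re (cinner (V m - V n) (Y m - Y n)) < (e / 3)\<^sup>2 / C"
    using form_approx_cauchy [OF Y V] by blast
  have lim: "X \<longlonglongrightarrow> f" "Y \<longlonglongrightarrow> g"
    using X Y by (auto simp: form_approx_def)
  have "(\<lambda>m. cinner w (Y m)) \<longlonglongrightarrow> cinner w g"
    by (intro tendsto_intros lim)
  from LIMSEQ_D [OF this, of "e / 3"] \<open>0 < e\<close>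
  obtain N3 where N3: "\<And>m. m \<ge> N3 \<Longrightarrow> cmod (cinner w (Y m) - cinner w g) < e / 3"
    by auto
  define m where "m = max N2 N3"
  have "(\<lambda>n. cinner (X n) (V m)) \<longlonglongrightarrow> cinner f (V m)"
    by (intro tendsto_intros lim)
  moreover have "cinner (X n) (V m) = cinner (U n) (Y m)" for n
    using symmetric_operatorD [OF sym U V] by simp
  moreover have "cinner f (V m) = cinner w (Y m)"
    using adjD [OF f V] by (metis cinner_commute)
  ultimately have "(\<lambda>n. cinner (U n) (Y m)) \<longlonglongrightarrow> cinner w (Y m)"
    by simp
  from LIMSEQ_D [OF this, of "e / 3"] \<open>0 < e\<close>
  obtain N4 where N4: "\<And>n. n \<ge> N4 \<Longrightarrow> cmod (cinner (U n) (Y m) - cinner w (Y m)) < e / 3"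
    by auto
  show "\<exists>N. \<forall>n\<ge>N. norm (cinner (U n) (Y n) - cinner w g) < e"
  proof (intro exI allI impI)
    fix n
    assume n: "n \<ge> max N1 (max N2 N4)"
    have "(cmod (cinner (U n) (Y n - Y m)))\<^sup>2
        \<le> Re (cinner (U n) (X n)) * Re (cinner (V n - V m) (Y n - Y m))"
      by (rule cauchy_schwarz_nonneg_operator [OF lin sym nonneg U linear_operatorD(4) [OF lin V V]])
    also have "\<dots> \<le> C * ((e / 3)\<^sup>2 / C)"
    proof (rule mult_mono)
      show "Re (cinner (U n) (X n)) \<le> C"
        using n by (intro C(2)) simp
      show "Re (cinner (V n - V m) (Y n - Y m)) \<le> (e / 3)\<^sup>2 / C"
        using n by (intro less_imp_le [OF N2]) (simp_all add: m_def)
      show "0 \<le> Re (cinner (V n - V m) (Y n - Y m))"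
        using linear_operatorD(4) [OF lin V V] nonneg unfolding nonneg_operator_iff by blast
    qed (use C in simp)
    also have "C * ((e / 3)\<^sup>2 / C) = (e / 3)\<^sup>2"
      using C(1) by simp
    finally have "cmod (cinner (U n) (Y n - Y m)) \<le> e / 3"
      by (rule power2_le_imp_le) (use \<open>0 < e\<close> in simp)
    moreover have "cmod (cinner (U n) (Y m) - cinner w (Y m)) < e / 3"
      using N4 n by simp
    moreover have "cmod (cinner w (Y m) - cinner w g) < e / 3"
      by (rule N3) (simp add: m_def)
    moreover have "cmod (p + q + r) < e"
      if "cmod p \<le> e / 3" "cmod q < e / 3" "cmod r < e / 3" for p q r
      using that norm_triangle_ineq [of "p + q" r] norm_triangle_ineq [of p q] by linarith
    moreover have "cinner (U n) (Y n) - cinner w g = cinner (U n) (Y n - Y m)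
        + (cinner (U n) (Y m) - cinner w (Y m)) + (cinner w (Y m) - cinner w g)"
      by (simp add: cinner_simps)
    ultimately show "norm (cinner (U n) (Y n) - cinner w g) < e"
      by metis
  qed
qed

lemma operator_in_closed_form_dom:
  assumes "A f = Some u"
  shows "f \<in> closed_form_dom A"
proof -
  have "form_approx A (\<lambda>n. f) f"
    using assms linear_operatorD(1) [OF lin] by (auto simp: form_approx_def)
  then show ?thesis
    by (auto simp: closed_form_dom_def)
qed

lemma closed_form_eqI:
  assumes "f \<in> closed_form_dom A" "g \<in> closed_form_dom A"
    and lim: "\<And>X Y. form_approx A X f \<Longrightarrow> form_approx A Y g \<Longrightarrow>
      (\<lambda>n. cinner (the (A (X n))) (Y n)) \<longlonglongrightarrow> t"
  shows "closed_form A f g = t"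
  unfolding closed_form_def
proof (rule the_equality)
  obtain X Y where *: "form_approx A X f" "form_approx A Y g"
    using assms by (auto simp: closed_form_dom_def)
  show "s = t" if "\<forall>X Y. form_approx A X f \<longrightarrow> form_approx A Y g \<longrightarrow>
      (\<lambda>n. cinner (the (A (X n))) (Y n)) \<longlonglongrightarrow> s" for s
    using that * lim [OF *] LIMSEQ_unique by blast
qed (use lim in blast)

lemma closed_form_adj_left:
  assumes "f \<in> closed_form_dom A" "g \<in> closed_form_dom A" and f: "adj A f = Some w"
  shows "closed_form A f g = cinner w g"
proof (rule closed_form_eqI [OF assms(1,2)])
  fix X Y
  assume *: "form_approx A X f" "form_approx A Y g"
  then obtain U where U: "\<And>n. A (X n) = Some (U n)"
    using form_approx_Some by blast
  show "(\<lambda>n. cinner (the (A (X n))) (Y n)) \<longlonglongrightarrow> cinner w g"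
    using form_approx_tendsto [OF * U f] by (simp add: U)
qed

lemma closed_form_adj_right:
  assumes "f \<in> closed_form_dom A" "g \<in> closed_form_dom A" and g: "adj A g = Some w"
  shows "closed_form A f g = cinner f w"
proof (rule closed_form_eqI [OF assms(1,2)])
  fix X Y
  assume *: "form_approx A X f" "form_approx A Y g"
  obtain U where U: "\<And>n. A (X n) = Some (U n)"
    using *(1) form_approx_Some by blast
  obtain V where V: "\<And>n. A (Y n) = Some (V n)"
    using *(2) form_approx_Some by blast
  have "(\<lambda>n. cnj (cinner (V n) (X n))) \<longlonglongrightarrow> cnj (cinner w f)"
    by (intro tendsto_cnj form_approx_tendsto [OF *(2,1) V g])
  moreover have "cnj (cinner (V n) (X n)) = cinner (the (A (X n))) (Y n)" for n
    using symmetric_operatorD [OF sym U V] U by (metis cinner_commute option.sel)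
  ultimately show "(\<lambda>n. cinner (the (A (X n))) (Y n)) \<longlonglongrightarrow> cinner f w"
    using cinner_commute [of f w] by simp
qed

text \<open>Testing the representing vector against \<open>dom A\<close>, which lies in the form
  domain, already yields the adjoint relation; conversely \<open>closed_form_adj_left\<close>
  represents the closed form by the adjoint.\<close>

lemma friedrichs_extension_iff:
  "friedrichs_extension A f = Some w \<longleftrightarrow> f \<in> closed_form_dom A \<and> adj A f = Some w"
proof -
  define P where "P h \<longleftrightarrow> (\<forall>g\<in>closed_form_dom A. closed_form A f g = cinner h g)" for h
  have F: "friedrichs_extension A f =
      (if f \<in> closed_form_dom A \<and> (\<exists>h. P h) then Some (THE h. P h) else None)"
    unfolding friedrichs_extension_def P_def by simp
  have P: "P h \<longleftrightarrow> adj A f = Some h" if D: "f \<in> closed_form_dom A" for h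
  proof
    assume h: "P h"
    have "cinner u f = cinner g h" if g: "A g = Some u" for g u
    proof -
      have "g \<in> closed_form_dom A"
        using g by (rule operator_in_closed_form_dom)
      then have "cinner f u = cinner h g"
        using h closed_form_adj_right [OF D _ operator_in_adj [OF g]] by (simp add: P_def)
      then show ?thesis
        by (metis cinner_commute)
    qed
    then show "adj A f = Some h"
      using adj_eq_Some_iff [OF dense] by blast
  next
    show "P h" if "adj A f = Some h"
      using closed_form_adj_left [OF D _ that] by (simp add: P_def)
  qed
  show ?thesis
  proof (cases "f \<in> closed_form_dom A")
    case True
    show ?thesis
    proof (cases "adj A f")
      case None
      then show ?thesis using True by (simp add: F P)
    next
      case (Some h)
      then have "(THE h. P h) = h"
        by (intro the_equality) (simp_all add: P [OF True])
      moreover have "\<exists>h. P h"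
        using Some P [OF True] by blast
      ultimately have "friedrichs_extension A f = Some h"
        unfolding F using True by presburger
      then show ?thesis
        using True Some by simp
    qed
  qed (simp add: F)
qed

lemma friedrichs_proper: "proper_extension A (friedrichs_extension A)"
  unfolding proper_extension_def map_le_def
proof (intro conjI ballI)
  fix f
  assume "f \<in> dom A"
  then obtain u where u: "A f = Some u" by blast
  then have "friedrichs_extension A f = Some u"
    by (simp add: friedrichs_extension_iff operator_in_closed_form_dom operator_in_adj)
  with u show "A f = friedrichs_extension A f" by simp
next
  fix f
  assume "f \<in> dom (friedrichs_extension A)"
  then obtain u where u: "friedrichs_extension A f = Some u" by blast
  then show "friedrichs_extension A f = adj A f"
    by (simp add: friedrichs_extension_iff)
qed

text \<open>Both sides are the closed form at \<open>f\<close> and \<open>g\<close>, evaluated from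
  the left and from the right.\<close>

lemma symmetric_friedrichs:
  assumes f: "friedrichs_extension A f = Some u" and g: "friedrichs_extension A g = Some v"
  shows "cinner u g = cinner f v"
  using assms closed_form_adj_left closed_form_adj_right unfolding friedrichs_extension_iff
  by metis

lemma friedrichs_approx:
  assumes "friedrichs_extension A f = Some w"
  obtains X U where "\<And>n. A (X n) = Some (U n)" "X \<longlonglongrightarrow> f"
    "(\<lambda>n. cinner (U n) (X n)) \<longlonglongrightarrow> cinner w f"
proof -
  obtain X where X: "form_approx A X f"
    using assms by (auto simp: friedrichs_extension_iff closed_form_dom_def)
  obtain U where U: "\<And>n. A (X n) = Some (U n)"
    using X form_approx_Some by blast
  show ?thesis
  proof (rule that [OF U])
    show "X \<longlonglongrightarrow> f"
      using X by (simp add: form_approx_def)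
    show "(\<lambda>n. cinner (U n) (X n)) \<longlonglongrightarrow> cinner w f"
      using assms by (intro form_approx_tendsto [OF X X U]) (simp add: friedrichs_extension_iff)
  qed
qed

end

section \<open>Boundary triplets and Weyl functions\<close>

locale symmetric_boundary_triplet =
  fixes A :: "'a::complex_hilbert \<rightharpoonup> 'a"
    and \<Gamma>\<^sub>0 \<Gamma>\<^sub>1 :: "'a \<Rightarrow> 'b::complex_hilbert"
  assumes lin: "linear_operator A" and clo: "closed_operator A" and dense: "densely_defined A"
    and sym: "symmetric_operator A" and triplet: "boundary_triplet A \<Gamma>\<^sub>0 \<Gamma>\<^sub>1"
begin

abbreviation A\<^sub>0 :: "'a \<rightharpoonup> 'a" where "A\<^sub>0 \<equiv> kernel_extension A \<Gamma>\<^sub>0"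
abbreviation M :: "complex \<Rightarrow> 'b \<Rightarrow> 'b" where "M \<equiv> weyl_function A \<Gamma>\<^sub>0 \<Gamma>\<^sub>1"

section \<open>Boundary values and the extension \<open>A\<^sub>0\<close>\<close>

lemmas adj_iff = adj_eq_Some_iff [OF dense]
lemmas adj_linear = linear_operatorD [OF linear_operator_adj [OF dense]]

lemma in_adj: "A f = Some u \<Longrightarrow> adj A f = Some u"
  using symmetric_operatorD [OF sym] by (auto simp: adj_iff)

lemma green:
  assumes "adj A f = Some u" "adj A g = Some v"
  shows "cinner u g - cinner f v = cinner (\<Gamma>\<^sub>1 f) (\<Gamma>\<^sub>0 g) - cinner (\<Gamma>\<^sub>0 f) (\<Gamma>\<^sub>1 g)"
proof -
  have "\<forall>f\<in>dom (adj A). \<forall>g\<in>dom (adj A).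
      cinner (the (adj A f)) g - cinner f (the (adj A g)) =
      cinner (\<Gamma>\<^sub>1 f) (\<Gamma>\<^sub>0 g) - cinner (\<Gamma>\<^sub>0 f) (\<Gamma>\<^sub>1 g)"
    using triplet unfolding boundary_triplet_def by blast
  moreover have "f \<in> dom (adj A)" "g \<in> dom (adj A)"
    using assms by auto
  ultimately have "cinner (the (adj A f)) g - cinner f (the (adj A g)) =
      cinner (\<Gamma>\<^sub>1 f) (\<Gamma>\<^sub>0 g) - cinner (\<Gamma>\<^sub>0 f) (\<Gamma>\<^sub>1 g)"
    by blast
  then show ?thesis
    by (simp only: assms option.sel)
qed

lemma surj:
  obtains f u where "adj A f = Some u" "\<Gamma>\<^sub>0 f = h" "\<Gamma>\<^sub>1 f = k"
proof -
  have "(k, h) \<in> (\<lambda>f. (\<Gamma>\<^sub>1 f, \<Gamma>\<^sub>0 f)) ` dom (adj A)"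
    using triplet unfolding boundary_triplet_def by simp
  then show ?thesis
    using that by auto
qed

lemma Gamma_linear:
  assumes "adj A f = Some u" "adj A g = Some v"
  shows "\<Gamma>\<^sub>0 (c *\<^sub>C f + g) = c *\<^sub>C \<Gamma>\<^sub>0 f + \<Gamma>\<^sub>0 g" "\<Gamma>\<^sub>1 (c *\<^sub>C f + g) = c *\<^sub>C \<Gamma>\<^sub>1 f + \<Gamma>\<^sub>1 g"
    and "\<Gamma>\<^sub>0 (f + g) = \<Gamma>\<^sub>0 f + \<Gamma>\<^sub>0 g" "\<Gamma>\<^sub>1 (f + g) = \<Gamma>\<^sub>1 f + \<Gamma>\<^sub>1 g"
    and "\<Gamma>\<^sub>0 (f - g) = \<Gamma>\<^sub>0 f - \<Gamma>\<^sub>0 g" "\<Gamma>\<^sub>1 (f - g) = \<Gamma>\<^sub>1 f - \<Gamma>\<^sub>1 g"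
    and "\<Gamma>\<^sub>0 (c *\<^sub>C f) = c *\<^sub>C \<Gamma>\<^sub>0 f" "\<Gamma>\<^sub>1 (c *\<^sub>C f) = c *\<^sub>C \<Gamma>\<^sub>1 f"
proof -
  have *: "\<Gamma>\<^sub>0 (c *\<^sub>C f + g) = c *\<^sub>C \<Gamma>\<^sub>0 f + \<Gamma>\<^sub>0 g \<and> \<Gamma>\<^sub>1 (c *\<^sub>C f + g) = c *\<^sub>C \<Gamma>\<^sub>1 f + \<Gamma>\<^sub>1 g"
    if "adj A f = Some u" "adj A g = Some v" for c f g u v
    using triplet that unfolding boundary_triplet_def by (meson domI)
  have 0: "adj A 0 = Some 0"
    by (rule adj_linear)
  have z: "\<Gamma>\<^sub>0 0 = 0" "\<Gamma>\<^sub>1 0 = 0"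
    using * [OF 0 0, of 1] by simp_all
  show "\<Gamma>\<^sub>0 (c *\<^sub>C f + g) = c *\<^sub>C \<Gamma>\<^sub>0 f + \<Gamma>\<^sub>0 g" "\<Gamma>\<^sub>1 (c *\<^sub>C f + g) = c *\<^sub>C \<Gamma>\<^sub>1 f + \<Gamma>\<^sub>1 g"
    using * [OF assms] by blast+
  show "\<Gamma>\<^sub>0 (f + g) = \<Gamma>\<^sub>0 f + \<Gamma>\<^sub>0 g" "\<Gamma>\<^sub>1 (f + g) = \<Gamma>\<^sub>1 f + \<Gamma>\<^sub>1 g"
    using * [OF assms, of 1] by simp_all
  show "\<Gamma>\<^sub>0 (f - g) = \<Gamma>\<^sub>0 f - \<Gamma>\<^sub>0 g" "\<Gamma>\<^sub>1 (f - g) = \<Gamma>\<^sub>1 f - \<Gamma>\<^sub>1 g"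
    using * [OF assms(2,1), of "-1"] by (simp_all add: scaleC_minus_one)
  show "\<Gamma>\<^sub>0 (c *\<^sub>C f) = c *\<^sub>C \<Gamma>\<^sub>0 f" "\<Gamma>\<^sub>1 (c *\<^sub>C f) = c *\<^sub>C \<Gamma>\<^sub>1 f"
    using * [OF assms(1) 0, of c] z by simp_all
qed

text \<open>For \<open>f\<close> in \<open>dom A\<close> the left side of Green's identity vanishes
  against the whole domain of the adjoint. The boundary map is onto, so each boundary value can be
  paired with itself.\<close>

lemma Gamma_operator:
  assumes "A f = Some u"
  shows "\<Gamma>\<^sub>0 f = 0" "\<Gamma>\<^sub>1 f = 0"
proof -
  have *: "cinner (\<Gamma>\<^sub>1 f) (\<Gamma>\<^sub>0 g) = cinner (\<Gamma>\<^sub>0 f) (\<Gamma>\<^sub>1 g)" if g: "adj A g = Some v" for g v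
    using green [OF in_adj [OF assms] g] g assms by (simp add: adj_iff)
  obtain g v where "adj A g = Some v" "\<Gamma>\<^sub>0 g = \<Gamma>\<^sub>1 f" "\<Gamma>\<^sub>1 g = 0"
    by (rule surj)
  with * show "\<Gamma>\<^sub>1 f = 0"
    by fastforce
  obtain g v where "adj A g = Some v" "\<Gamma>\<^sub>0 g = 0" "\<Gamma>\<^sub>1 g = \<Gamma>\<^sub>0 f"
    by (rule surj)
  with * show "\<Gamma>\<^sub>0 f = 0"
    by fastforce
qed

lemma A0_iff: "A\<^sub>0 f = Some u \<longleftrightarrow> adj A f = Some u \<and> \<Gamma>\<^sub>0 f = 0"
  unfolding kernel_extension_def by (auto simp: restrict_map_def)

lemma linear_A0: "linear_operator A\<^sub>0"
proof -
  have "\<Gamma>\<^sub>0 0 = 0"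
    using Gamma_operator(1) linear_operatorD(1) [OF lin] .
  then show ?thesis
    using adj_linear(1,2) Gamma_linear(1) unfolding linear_operator_def A0_iff by simp
qed

lemma selfadjoint_A0: "selfadjoint_operator A\<^sub>0"
  unfolding selfadjoint_operator_def
proof (intro allI iffI impI)
  show "cinner u g = cinner f h" if "A\<^sub>0 g = Some h" "A\<^sub>0 f = Some u" for f g h u
    using that green [of f u g h] by (simp add: A0_iff)
next
  fix g h
  assume *: "\<forall>f u. A\<^sub>0 f = Some u \<longrightarrow> cinner u g = cinner f h"
  have g: "adj A g = Some h"
    unfolding adj_iff using * A0_iff in_adj Gamma_operator(1) by blast
  \<comment> \<open>A test vector of \<open>A\<^sub>0\<close> whose \<open>\<Gamma>\<^sub>1\<close>
    is \<open>\<Gamma>\<^sub>0 g\<close>, so that Green's identity isolates the norm of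
    \<open>\<Gamma>\<^sub>0 g\<close>.\<close>
  obtain f u where f: "adj A f = Some u" "\<Gamma>\<^sub>0 f = 0" "\<Gamma>\<^sub>1 f = \<Gamma>\<^sub>0 g"
    by (rule surj)
  then have "cinner u g = cinner f h"
    using * A0_iff by blast
  then have "cinner (\<Gamma>\<^sub>0 g) (\<Gamma>\<^sub>0 g) = 0"
    using green [OF f(1) g] f by simp
  then show "A\<^sub>0 g = Some h"
    using g by (simp add: A0_iff)
qed

lemmas symmetric_A0 = selfadjoint_symmetric [OF selfadjoint_A0]

lemma nonreal_in_resolvent_set: "Im z \<noteq> 0 \<Longrightarrow> z \<in> resolvent_set A\<^sub>0"
  by (rule selfadjoint_nonreal_resolvent_set [OF linear_A0 selfadjoint_A0])

lemma cnj_in_resolvent_set: "z \<in> resolvent_set A\<^sub>0 \<Longrightarrow> cnj z \<in> resolvent_set A\<^sub>0"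
proof (cases "Im z = 0")
  case True
  then have "cnj z = z"
    by (simp add: complex_eq_iff)
  then show "z \<in> resolvent_set A\<^sub>0 \<Longrightarrow> cnj z \<in> resolvent_set A\<^sub>0"
    by simp
qed (simp add: nonreal_in_resolvent_set)

lemma proper_A0: "proper_extension A A\<^sub>0"
  unfolding proper_extension_def map_le_def
  using A0_iff in_adj Gamma_operator(1) by force

text \<open>Orthogonality to the range of A - z is the adjoint relation at \<open>cnj z\<close>; it
  turns the remainder of \<open>range_decomposition\<close> into a defect vector.\<close>

lemma defect_decomposition:
  assumes "0 < c" and bd: "\<And>f u. A f = Some u \<Longrightarrow> c * norm f \<le> norm (u - z *\<^sub>C f)"
  obtains f u n where "A f = Some u" "y = u - z *\<^sub>C f + n" "adj A n = Some (cnj z *\<^sub>C n)"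
proof -
  obtain f u n where *: "A f = Some u" "y = u - z *\<^sub>C f + n"
    "\<And>g v. A g = Some v \<Longrightarrow> cinner (v - z *\<^sub>C g) n = 0"
    using range_decomposition [OF lin clo assms] by blast
  have "adj A n = Some (cnj z *\<^sub>C n)"
    unfolding adj_iff using *(3) by (auto simp: cinner_simps)
  with * show ?thesis
    using that by blast
qed

text \<open>Converse of \<open>Gamma_operator\<close>. An element of \<open>dom A\<close> corrects
  \<open>f\<close> to a vector \<open>e\<close>, still with zero boundary values; Green's identity
  against the defect vector \<open>n\<close> gives n = 0. Then \<open>e\<close> lies in the kernel
  of \<open>A\<^sub>0\<close> minus \<i>, which is trivial by symmetry.\<close>

lemma minimal_operator_eq:
  assumes f: "adj A f = Some u" and "\<Gamma>\<^sub>0 f = 0" "\<Gamma>\<^sub>1 f = 0"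
  shows "A f = Some u"
proof -
  obtain g v n where g: "A g = Some v" and y: "u - \<i> *\<^sub>C f = v - \<i> *\<^sub>C g + n"
    and n: "adj A n = Some (cnj \<i> *\<^sub>C n)"
    using defect_decomposition [of 1 \<i> "u - \<i> *\<^sub>C f"] symmetric_lower_bound [OF sym, of _ _ \<i>]
    by auto
  define e where "e = f - g"
  have e: "adj A e = Some (u - v)" "\<Gamma>\<^sub>0 e = 0" "\<Gamma>\<^sub>1 e = 0"
    using adj_linear(4) [OF f in_adj [OF g]] Gamma_linear [OF f in_adj [OF g]] assms
      Gamma_operator [OF g] by (simp_all add: e_def)
  have n_eq: "u - v = \<i> *\<^sub>C e + n"
    using y by (simp add: e_def scaleC_diff_right algebra_simps)
  have "cinner n n = cinner (u - v) n - cinner e (cnj \<i> *\<^sub>C n)"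
    by (simp add: n_eq cinner_simps)
  also have "\<dots> = 0"
    using green [OF e(1) n] e by simp
  finally have "A\<^sub>0 e = Some (\<i> *\<^sub>C e)"
    using e n_eq by (simp add: A0_iff)
  then have "e = 0"
    using symmetric_lower_bound [OF symmetric_A0, of e _ \<i>] by fastforce
  then show ?thesis
    using e(1) g adj_linear(1) by (simp add: e_def)
qed

text \<open>The boundary values of a real defect space form a maximal symmetric relation.\<close>

lemma defect_boundary_maximal:
  assumes "0 < c" and bd: "\<And>f u. A f = Some u \<Longrightarrow> c * norm f \<le> norm (u - of_real x *\<^sub>C f)"
    and hk: "\<And>f. adj A f = Some (of_real x *\<^sub>C f) \<Longrightarrow> cinner k (\<Gamma>\<^sub>0 f) = cinner h (\<Gamma>\<^sub>1 f)"
  obtains g where "adj A g = Some (of_real x *\<^sub>C g)" "\<Gamma>\<^sub>0 g = h" "\<Gamma>\<^sub>1 g = k"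
proof -
  obtain f u where f: "adj A f = Some u" "\<Gamma>\<^sub>0 f = h" "\<Gamma>\<^sub>1 f = k"
    by (rule surj)
  obtain g v n where g: "A g = Some v" and y: "u - of_real x *\<^sub>C f = v - of_real x *\<^sub>C g + n"
    and n: "adj A n = Some (of_real x *\<^sub>C n)"
    by (rule defect_decomposition [OF assms(1,2), of "u - of_real x *\<^sub>C f"]) auto
  \<comment> \<open>Subtracting \<open>g\<close> keeps the boundary values and leaves the defect
    vector \<open>n\<close> as the image of \<open>e\<close> under \<open>adj A\<close> minus x.
    Green's identity with \<open>hk\<close> at \<open>n\<close> makes \<open>n\<close> orthogonal to
    itself.\<close>
  define e where "e = f - g"
  have e: "adj A e = Some (u - v)" "\<Gamma>\<^sub>0 e = h" "\<Gamma>\<^sub>1 e = k"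
    using adj_linear(4) [OF f(1) in_adj [OF g]] Gamma_linear [OF f(1) in_adj [OF g]] f
      Gamma_operator [OF g] by (simp_all add: e_def)
  have n_eq: "u - v = of_real x *\<^sub>C e + n"
    using y by (simp add: e_def scaleC_diff_right algebra_simps)
  have "cinner n n = cinner (u - v) n - cinner e (of_real x *\<^sub>C n)"
    by (simp add: n_eq cinner_simps)
  also have "\<dots> = 0"
    using green [OF e(1) n] e hk [OF n] by simp
  finally have "n = 0" by simp
  then show ?thesis
    using that [of e] e n_eq by simp
qed

section \<open>The gamma-field and the Weyl function\<close>

definition gamma_field :: "complex \<Rightarrow> 'b \<Rightarrow> 'a" where
  "gamma_field z h = (THE f. adj A f = Some (z *\<^sub>C f) \<and> \<Gamma>\<^sub>0 f = h)"

lemma defect_unique: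
  assumes z: "z \<in> resolvent_set A\<^sub>0"
    and f: "adj A f = Some (z *\<^sub>C f)" and g: "adj A g = Some (z *\<^sub>C g)" and eq: "\<Gamma>\<^sub>0 f = \<Gamma>\<^sub>0 g"
  shows "f = g"
proof -
  obtain R where R: "bounded_clinear R" "\<And>f u. A\<^sub>0 f = Some u \<Longrightarrow> R (u - z *\<^sub>C f) = f"
    using resolvent_setE [OF z] by metis
  have "A\<^sub>0 (f - g) = Some (z *\<^sub>C (f - g))"
    using adj_linear(4) [OF f g] Gamma_linear(5) [OF f g] eq
    by (simp add: A0_iff scaleC_diff_right)
  then have "R 0 = f - g"
    using R(2) by fastforce
  then show ?thesis
    using bounded_clinearD(4) [OF R(1)] by simp
qed

lemma gamma_field:
  assumes z: "z \<in> resolvent_set A\<^sub>0"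
  shows "adj A (gamma_field z h) = Some (z *\<^sub>C gamma_field z h)" "\<Gamma>\<^sub>0 (gamma_field z h) = h"
proof -
  obtain R where R: "\<And>y. A\<^sub>0 (R y) = Some (y + z *\<^sub>C R y)"
    using resolvent_setE [OF z] by metis
  obtain f u where f: "adj A f = Some u" "\<Gamma>\<^sub>0 f = h"
    by (rule surj)
  \<comment> \<open>An arbitrary lift \<open>f\<close> of \<open>h\<close> is corrected inside the
    domain of \<open>A\<^sub>0\<close>, which leaves \<open>\<Gamma>\<^sub>0\<close>
    unchanged.\<close>
  define g where "g = R (u - z *\<^sub>C f)"
  have g: "adj A g = Some (u - z *\<^sub>C f + z *\<^sub>C g)" "\<Gamma>\<^sub>0 g = 0"
    using R [of "u - z *\<^sub>C f"] by (simp_all add: A0_iff g_def)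
  have "adj A (f - g) = Some (z *\<^sub>C (f - g)) \<and> \<Gamma>\<^sub>0 (f - g) = h"
    using adj_linear(4) [OF f(1) g(1)] Gamma_linear(5) [OF f(1) g(1)] f g(2)
    by (simp add: scaleC_diff_right)
  then have "adj A (gamma_field z h) = Some (z *\<^sub>C gamma_field z h) \<and> \<Gamma>\<^sub>0 (gamma_field z h) = h"
    unfolding gamma_field_def by (rule theI) (use defect_unique [OF z] \<open>_ \<and> _\<close> in blast)
  then show "adj A (gamma_field z h) = Some (z *\<^sub>C gamma_field z h)" "\<Gamma>\<^sub>0 (gamma_field z h) = h"
    by blast+
qed

lemma gamma_field_eqI:
  assumes "z \<in> resolvent_set A\<^sub>0" "adj A f = Some (z *\<^sub>C f)" "\<Gamma>\<^sub>0 f = h"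
  shows "gamma_field z h = f"
  using defect_unique [OF assms(1) gamma_field(1) [OF assms(1)] assms(2)] gamma_field(2) assms by simp

lemma weyl_eq:
  assumes z: "z \<in> resolvent_set A\<^sub>0"
  shows "M z h = \<Gamma>\<^sub>1 (gamma_field z h)"
  unfolding weyl_function_def defect_space_def
  by (rule the_equality) (use gamma_field [OF z] gamma_field_eqI [OF z] in auto)

text \<open>Green's identity for two defect vectors. With w = cnj z it gives the adjoint of
  \<open>M z\<close>, with w = z the imaginary part, with two real points the monotonicity.\<close>

lemma gamma_field_green:
  assumes z: "z \<in> resolvent_set A\<^sub>0" and w: "w \<in> resolvent_set A\<^sub>0"
  shows "(z - cnj w) * cinner (gamma_field z h) (gamma_field w k) = cinner (M z h) k - cinner h (M w k)"
  using green [OF gamma_field(1) [OF z, of h] gamma_field(1) [OF w, of k]] gamma_field(2) [OF z] gamma_field(2) [OF w]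
  by (simp add: weyl_eq z w cinner_simps algebra_simps)

lemma weyl_adjoint:
  assumes z: "z \<in> resolvent_set A\<^sub>0"
  shows "cinner (M z h) k = cinner h (M (cnj z) k)"
  using gamma_field_green [OF z cnj_in_resolvent_set [OF z], of h k] by simp

lemma bounded_weyl: "z \<in> resolvent_set A\<^sub>0 \<Longrightarrow> bounded_clinear (M z)"
  by (rule hellinger_toeplitz) (rule weyl_adjoint)

text \<open>Exhibits the adjoint of the gamma-field as \<open>\<Gamma>\<^sub>1\<close> after the
  resolvent at \<open>cnj z\<close>. Read in both directions, it bounds both maps by the
  Hellinger--Toeplitz theorem.\<close>

lemma gamma_field_adjoint:
  assumes z: "z \<in> resolvent_set A\<^sub>0" and R: "\<And>y. A\<^sub>0 (R y) = Some (y + cnj z *\<^sub>C R y)"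
  shows "cinner (gamma_field z h) y = cinner h (\<Gamma>\<^sub>1 (R y))"
  using green [OF gamma_field(1) [OF z, of h], of "R y" "y + cnj z *\<^sub>C R y"] R [of y] gamma_field(2) [OF z, of h]
  by (simp add: A0_iff cinner_simps)

lemma bounded_gam:
  assumes z: "z \<in> resolvent_set A\<^sub>0"
  shows "bounded_clinear (gamma_field z)"
proof -
  obtain R where R: "\<And>y. A\<^sub>0 (R y) = Some (y + cnj z *\<^sub>C R y)"
    using resolvent_setE [OF cnj_in_resolvent_set [OF z]] by metis
  show ?thesis
    by (rule hellinger_toeplitz) (rule gamma_field_adjoint [OF z R])
qed

lemma bounded_Gamma1_resolvent:
  assumes z: "z \<in> resolvent_set A\<^sub>0" and R: "\<And>y. A\<^sub>0 (R y) = Some (y + z *\<^sub>C R y)"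
  shows "bounded_clinear (\<lambda>y. \<Gamma>\<^sub>1 (R y))"
proof (rule hellinger_toeplitz)
  show "cinner (\<Gamma>\<^sub>1 (R y)) h = cinner y (gamma_field (cnj z) h)" for y h
    using gamma_field_adjoint [of "cnj z" R h y] cnj_in_resolvent_set [OF z] R
    by (metis cinner_commute complex_cnj_cnj)
qed

text \<open>The equal values of \<open>\<Gamma>\<^sub>0\<close> cancel. This is how nonnegativity of
  \<open>A\<^sub>0\<close> reaches the gamma-field.\<close>

lemma gamma_field_diff:
  assumes z: "z \<in> resolvent_set A\<^sub>0" and w: "w \<in> resolvent_set A\<^sub>0"
  shows "A\<^sub>0 (gamma_field z h - gamma_field w h) = Some (z *\<^sub>C gamma_field z h - w *\<^sub>C gamma_field w h)"
  using adj_linear(4) [OF gamma_field(1) [OF z] gamma_field(1) [OF w]]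
    Gamma_linear(5) [OF gamma_field(1) [OF z] gamma_field(1) [OF w]] gamma_field(2) [OF z] gamma_field(2) [OF w]
  by (simp add: A0_iff)

text \<open>Applying the resolvent to \<open>gamma_field_diff\<close> shows that gamma(z) - gamma(w)
  is (z - w) R gamma(w); then take \<open>\<Gamma>\<^sub>1\<close>.\<close>

lemma weyl_diff:
  assumes z: "z \<in> resolvent_set A\<^sub>0" and w: "w \<in> resolvent_set A\<^sub>0"
    and R: "bounded_clinear R" "\<And>y. A\<^sub>0 (R y) = Some (y + z *\<^sub>C R y)"
      "\<And>f u. A\<^sub>0 f = Some u \<Longrightarrow> R (u - z *\<^sub>C f) = f"
  shows "M z h - M w h = (z - w) *\<^sub>C \<Gamma>\<^sub>1 (R (gamma_field w h))"
proof -
  have "R ((z - w) *\<^sub>C gamma_field w h) = gamma_field z h - gamma_field w h"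
    using R(3) [OF gamma_field_diff [OF z w]] by (simp add: scaleC_simps)
  then have "gamma_field z h - gamma_field w h = (z - w) *\<^sub>C R (gamma_field w h)"
    by (simp add: bounded_clinearD [OF R(1)])
  moreover have a: "adj A (R (gamma_field w h)) = Some (gamma_field w h + z *\<^sub>C R (gamma_field w h))"
    using R(2) A0_iff by blast
  ultimately show ?thesis
    using Gamma_linear(6) [OF gamma_field(1) [OF z] gamma_field(1) [OF w], of h h] Gamma_linear(8) [OF a a, of "z - w"]
    by (simp add: weyl_eq z w)
qed

text \<open>By \<open>weyl_diff\<close> the candidate derivative at w is
  \<open>\<Gamma>\<^sub>1\<close> after the resolvent after the gamma-field, all at w. The error
  \<open>Q z\<close> carries a further factor z - w, and the resolvents at z stay bounded near
  w.\<close>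

lemma weyl_holomorphic:
  assumes "S \<subseteq> resolvent_set A\<^sub>0"
  shows "operator_holomorphic_on M S"
  unfolding operator_holomorphic_on_def
proof (intro conjI ballI)
  show "bounded_clinear (M z)" if "z \<in> S" for z
    using that assms bounded_weyl by blast
next
  fix w
  assume "w \<in> S"
  then have w: "w \<in> resolvent_set A\<^sub>0"
    using assms by blast
  obtain Rw where Rw: "bounded_clinear Rw" "\<And>y. A\<^sub>0 (Rw y) = Some (y + w *\<^sub>C Rw y)"
    "\<And>f u. A\<^sub>0 f = Some u \<Longrightarrow> Rw (u - w *\<^sub>C f) = f"
    using resolvent_setE [OF w] by blast
  define G where "G = (\<lambda>y. \<Gamma>\<^sub>1 (Rw y))"
  define D where "D = (\<lambda>h. G (gamma_field w h))"
  have G: "bounded_clinear G"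
    unfolding G_def by (rule bounded_Gamma1_resolvent [OF w Rw(2)])
  have D: "bounded_clinear D"
    unfolding D_def by (rule bounded_clinear_compose [OF G bounded_gam [OF w]])
  obtain C1 where C1: "0 < C1" "\<And>y. norm (G y) \<le> C1 * norm y"
    using bounded_clinear_norm_bound [OF G] by blast
  obtain C2 where C2: "0 < C2" "\<And>y. norm (Rw y) \<le> C2 * norm y"
    using bounded_clinear_norm_bound [OF Rw(1)] by blast
  obtain C3 where C3: "0 < C3" "\<And>h. norm (gamma_field w h) \<le> C3 * norm h"
    using bounded_clinear_norm_bound [OF bounded_gam [OF w]] by blast
  define Q where "Q z h = (1 / (z - w)) *\<^sub>C (M z h - M w h) - D h" for z h
  have bound: "norm (onorm (Q z)) \<le> cmod (z - w) * (2 * C1 * C2 * C3)"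
    if "z \<in> S" "z \<noteq> w" and small: "cmod (z - w) * C2 \<le> 1 / 2" for z
  proof -
    have z: "z \<in> resolvent_set A\<^sub>0"
      using that assms by blast
    obtain R where R: "bounded_clinear R" "\<And>y. A\<^sub>0 (R y) = Some (y + z *\<^sub>C R y)"
      "\<And>f u. A\<^sub>0 f = Some u \<Longrightarrow> R (u - z *\<^sub>C f) = f"
      using resolvent_setE [OF z] by blast
    have res: "R y = Rw y + (z - w) *\<^sub>C Rw (R y)" for y
      using Rw(3) [OF R(2) [of y]] bounded_clinearD(1,3) [OF Rw(1)]
      by (metis add_diff_eq scaleC_diff_left)
    \<comment> \<open>Absorption: by the resolvent identity \<open>res\<close> and the smallness of
      z - w, at most half the norm of \<open>R y\<close> reappears on the right.\<close>
    have R_bound: "norm (R y) \<le> 2 * C2 * norm y" for y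
    proof -
      have "norm (R y) \<le> norm (Rw y) + cmod (z - w) * norm (Rw (R y))"
        using res [of y] norm_triangle_ineq norm_scaleC by metis
      also have "\<dots> \<le> C2 * norm y + cmod (z - w) * (C2 * norm (R y))"
        by (intro add_mono mult_left_mono C2) simp
      also have "cmod (z - w) * (C2 * norm (R y)) \<le> 1 / 2 * norm (R y)"
        using small by (simp only: mult.assoc [symmetric] mult_right_mono norm_ge_zero)
      finally show ?thesis by simp
    qed
    have Q: "Q z h = (z - w) *\<^sub>C G (R (gamma_field w h))" for h
    proof -
      have "\<Gamma>\<^sub>1 (R y) = G y + (z - w) *\<^sub>C G (R y)" for y
      proof -
        have a: "adj A (Rw y) = Some (y + w *\<^sub>C Rw y)" for y
          using Rw(2) A0_iff by blast
        have "\<Gamma>\<^sub>1 (R y) = \<Gamma>\<^sub>1 ((z - w) *\<^sub>C Rw (R y) + Rw y)"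
          using res [of y] by (simp add: add.commute)
        then show ?thesis
          using Gamma_linear(2) [OF a a] by (simp add: G_def)
      qed
      moreover have "Q z h = \<Gamma>\<^sub>1 (R (gamma_field w h)) - G (gamma_field w h)"
        using \<open>z \<noteq> w\<close> by (simp add: Q_def D_def weyl_diff [OF z w R] scaleC_scaleC)
      ultimately show ?thesis by simp
    qed
    have "norm (Q z h) \<le> cmod (z - w) * (2 * C1 * C2 * C3) * norm h" for h
    proof -
      have "norm (G (R (gamma_field w h))) \<le> C1 * (2 * C2 * (C3 * norm h))"
        using C1 C2 C3 R_bound
        by (meson order_trans mult_left_mono less_imp_le mult_nonneg_nonneg zero_le_numeral)
      then have "cmod (z - w) * norm (G (R (gamma_field w h)))
          \<le> cmod (z - w) * (C1 * (2 * C2 * (C3 * norm h)))"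
        by (rule mult_left_mono) simp
      then show ?thesis
        by (simp add: Q norm_scaleC mult_ac)
    qed
    then have "onorm (Q z) \<le> cmod (z - w) * (2 * C1 * C2 * C3)"
      using C1 C2 C3 by (intro onorm_bound) auto
    moreover have "bounded_clinear (Q z)"
      unfolding Q by (intro bounded_clinear_compose [OF _ bounded_clinear_compose [OF G
            bounded_clinear_compose [OF R(1) bounded_gam [OF w]]]])
        (simp add: bounded_clinear_def bounded_linear_scaleC scaleC_scaleC mult.commute)
    then have "0 \<le> onorm (Q z)"
      by (simp add: onorm_pos_le bounded_clinear_def)
    ultimately show ?thesis
      by simp
  qed
  have "((\<lambda>z. onorm (Q z)) \<longlongrightarrow> 0) (at w within S)"
  proof (rule Lim_null_comparison)
    have "((\<lambda>z. cmod (z - w) * C2) \<longlongrightarrow> cmod (w - w) * C2) (at w within S)"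
      by (intro tendsto_intros)
    then have "\<forall>\<^sub>F z in at w within S. cmod (z - w) * C2 < 1 / 2"
      by (rule order_tendstoD(2)) simp
    then show "\<forall>\<^sub>F z in at w within S. norm (onorm (Q z)) \<le> cmod (z - w) * (2 * C1 * C2 * C3)"
      unfolding eventually_at_filter by eventually_elim (blast intro: bound less_imp_le)
    have "((\<lambda>z. cmod (z - w) * (2 * C1 * C2 * C3)) \<longlongrightarrow> cmod (w - w) * (2 * C1 * C2 * C3))
        (at w within S)"
      by (intro tendsto_intros)
    then show "((\<lambda>z. cmod (z - w) * (2 * C1 * C2 * C3)) \<longlongrightarrow> 0) (at w within S)"
      by simp
  qed
  with D show "\<exists>D. bounded_clinear D \<and>
      ((\<lambda>z. onorm (\<lambda>h. (1 / (z - w)) *\<^sub>C (M z h - M w h) - D h)) \<longlongrightarrow> 0) (at w within S)"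
    unfolding Q_def by blast
qed

text \<open>The symmetric \<open>K\<close> cancels in the imaginary part, and
  \<open>gamma_field_green\<close> with w = z leaves Im z times the squared norm of
  \<open>gamma_field z h\<close>.\<close>

lemma Im_operator_weyl:
  assumes z: "Im z > 0" and K: "\<And>x y. cinner (K x) y = cinner x (K y)"
  shows "bounded_nonneg (Im_operator (\<lambda>h. M z h - K h))"
  unfolding bounded_nonneg_def
proof
  fix h
  have zr: "z \<in> resolvent_set A\<^sub>0"
    using z by (simp add: nonreal_in_resolvent_set)
  have "bounded_adjoint (\<lambda>h. M z h - K h) h = M (cnj z) h - K h"
    by (rule bounded_adjointI) (simp add: cinner_simps weyl_adjoint [OF zr] K)
  then have "cinner (Im_operator (\<lambda>h. M z h - K h) h) h
      = (cinner (M z h) h - cinner (M (cnj z) h) h) / (2 * \<i>)"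
    by (simp add: Im_operator_def cinner_simps diff_divide_distrib)
  also have "cinner (M (cnj z) h) h = cinner h (M z h)"
    using weyl_adjoint [OF zr, of h h] by (metis cinner_commute)
  also have "cinner (M z h) h - cinner h (M z h) = (z - cnj z) * cinner (gamma_field z h) (gamma_field z h)"
    using gamma_field_green [OF zr zr] by simp
  also have "\<dots> = of_real (Im z * (norm (gamma_field z h))\<^sup>2) * (2 * \<i>)"
    by (simp add: complex_diff_cnj cinner_self)
  also have "\<dots> / (2 * \<i>) = of_real (Im z * (norm (gamma_field z h))\<^sup>2)"
    by (rule nonzero_mult_div_cancel_right) simp
  finally show "cinner (Im_operator (\<lambda>h. M z h - K h) h) h \<in> \<real>\<^sub>\<ge>\<^sub>0"
    using z by (simp only: nonneg_Reals_of_real_iff zero_le_mult_iff) simp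
qed

section \<open>Solving the inhomogeneous adjoint equation; lifting values of
  \<open>\<Gamma>\<^sub>1\<close>\<close>

lemma adj_shift_surjective:
  assumes "0 < c" and bd: "\<And>f u. A f = Some u \<Longrightarrow> c * norm f \<le> norm (u - of_real x *\<^sub>C f)"
  obtains v where "adj A v = Some (y + of_real x *\<^sub>C v)"
proof -
  \<comment> \<open>\<open>dec\<close> splits \<open>s\<close> into a part \<open>a\<close> in the
    range of A - x, with preimage \<open>f\<close>, and an orthogonal defect vector
    \<open>n\<close>. The map \<open>P\<close> sending \<open>s\<close> to \<open>f\<close> inverts
    A - x on its range and vanishes on defect vectors; its adjoint solves the equation.\<close>
  define dec where "dec s f a n \<longleftrightarrow> A f = Some (a + of_real x *\<^sub>C f) \<and> s = a + n \<and>
      adj A n = Some (of_real x *\<^sub>C n)" for s f a n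
  have orth: "cinner a n = 0" if "A f = Some (a + of_real x *\<^sub>C f)" "adj A n = Some (of_real x *\<^sub>C n)"
    for f a n
  proof -
    have "cinner (a + of_real x *\<^sub>C f) n = cinner f (of_real x *\<^sub>C n)"
      using that adj_iff by blast
    then show ?thesis
      by (simp add: cinner_simps)
  qed
  have ex: "\<exists>f a n. dec s f a n" for s
  proof -
    obtain f u n where "A f = Some u" "s = u - of_real x *\<^sub>C f + n"
      "adj A n = Some (of_real x *\<^sub>C n)"
      by (rule defect_decomposition [OF assms, of s]) auto
    then have "dec s f (u - of_real x *\<^sub>C f) n"
      by (simp add: dec_def)
    then show ?thesis by blast
  qed
  have unique: "f = g" if "dec s f a n" "dec s g b k" for s f g a b n k
  proof -
    have fg: "A f = Some (a + of_real x *\<^sub>C f)" "A g = Some (b + of_real x *\<^sub>C g)"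
      "adj A n = Some (of_real x *\<^sub>C n)" "adj A k = Some (of_real x *\<^sub>C k)"
      using that by (simp_all add: dec_def)
    have "A (f - g) = Some ((a - b) + of_real x *\<^sub>C (f - g))"
      using linear_operatorD(4) [OF lin fg(1,2)] by (simp add: scaleC_diff_right algebra_simps)
    moreover have "adj A (n - k) = Some (of_real x *\<^sub>C (n - k))"
      using adj_linear(4) [OF fg(3,4)] by (simp add: scaleC_diff_right)
    ultimately have "cinner (a - b) (n - k) = 0"
      by (rule orth)
    moreover have "n - k = - (a - b)"
      using that by (simp add: dec_def algebra_simps)
    ultimately have "a - b = 0"
      by (metis cinner_minus_right cinner_self_eq_0 neg_equal_0_iff_equal)
    then have "c * norm (f - g) \<le> 0"
      using bd [OF \<open>A (f - g) = _\<close>] by simp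
    then show ?thesis
      using \<open>0 < c\<close> by (simp add: mult_le_0_iff)
  qed
  obtain P a n where P: "\<And>s. dec s (P s) (a s) (n s)"
    using ex by metis
  have lin_P: "P (t *\<^sub>C r + s) = t *\<^sub>C P r + P s" for t r s
  proof (rule unique [OF P])
    have "A (t *\<^sub>C P r + P s)
        = Some (t *\<^sub>C (a r + of_real x *\<^sub>C P r) + (a s + of_real x *\<^sub>C P s))"
      using P [of r] P [of s] unfolding dec_def by (blast intro: linear_operatorD(2) [OF lin])
    moreover have "adj A (t *\<^sub>C n r + n s)
        = Some (t *\<^sub>C (of_real x *\<^sub>C n r) + of_real x *\<^sub>C n s)"
      using P [of r] P [of s] unfolding dec_def by (blast intro: adj_linear(2))
    moreover have "r = a r + n r" "s = a s + n s"
      using P by (auto simp: dec_def)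
    then have "t *\<^sub>C r + s = t *\<^sub>C (a r + n r) + (a s + n s)"
      by (rule arg_cong2 [where f = "\<lambda>p q. t *\<^sub>C p + q"])
    then have "t *\<^sub>C r + s = (t *\<^sub>C a r + a s) + (t *\<^sub>C n r + n s)"
      by (simp add: scaleC_add_right)
    ultimately show "dec (t *\<^sub>C r + s) (t *\<^sub>C P r + P s) (t *\<^sub>C a r + a s) (t *\<^sub>C n r + n s)"
      unfolding dec_def by (simp add: scaleC_simps mult.commute add_ac)
  qed
  \<comment> \<open>\<open>a s\<close> and \<open>n s\<close> are orthogonal, so the norm of
    \<open>a s\<close> is at most that of \<open>s\<close>; the lower bound for A - x then bounds
    \<open>P\<close>.\<close>
  have bd_P: "cmod (cinner (P s) y) \<le> norm y / c * norm s" for s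
  proof -
    have *: "A (P s) = Some (a s + of_real x *\<^sub>C P s)" "s = a s + n s"
      "adj A (n s) = Some (of_real x *\<^sub>C n s)"
      using P [of s] by (auto simp: dec_def)
    have o: "cinner (a s) (n s) = 0"
      by (rule orth [OF *(1,3)])
    have "(norm (a s))\<^sup>2 \<le> (norm (a s))\<^sup>2 + (norm (n s))\<^sup>2"
      by simp
    also have "\<dots> = (norm (a s - (- n s)))\<^sup>2"
      unfolding norm_diff_sq by (simp add: o)
    also have "a s - (- n s) = s"
      using *(2) by simp
    finally have "norm (a s) \<le> norm s"
      by (rule power2_le_imp_le) simp
    moreover have "c * norm (P s) \<le> norm (a s)"
      using bd [OF *(1)] by simp
    ultimately have "norm (P s) \<le> norm s / c"
      using \<open>0 < c\<close> by (simp add: pos_le_divide_eq mult.commute)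
    then have "norm (P s) * norm y \<le> norm s / c * norm y"
      by (rule mult_right_mono) simp
    then show ?thesis
      using cinner_bound [of "P s" y] by (simp add: mult.commute)
  qed
  obtain v where v: "\<And>s. cinner (P s) y = cinner s v"
    by (rule riesz_representation [of "\<lambda>s. cinner (P s) y", OF _ bd_P])
      (auto simp: lin_P cinner_simps)
  show ?thesis
  proof (rule that)
    show "adj A v = Some (y + of_real x *\<^sub>C v)"
      unfolding adj_iff
    proof (intro allI impI)
      fix f u
      assume f: "A f = Some u"
      \<comment> \<open>A vector in the range of A - x has no defect part, so \<open>P\<close>
        returns its preimage; this turns the Riesz identity into the adjoint relation for
        \<open>v\<close>.\<close>
      have "dec (u - of_real x *\<^sub>C f) f (u - of_real x *\<^sub>C f) 0"
        using f adj_linear(1) by (simp add: dec_def)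
      then have "P (u - of_real x *\<^sub>C f) = f"
        using unique P by blast
      then show "cinner u v = cinner f (y + of_real x *\<^sub>C v)"
        using v [of "u - of_real x *\<^sub>C f"] by (simp add: cinner_simps)
    qed
  qed
qed

text \<open>Every \<open>h\<close> is \<open>\<Gamma>\<^sub>1 g\<close> with \<open>g\<close> in the
  domain of \<open>A\<^sub>0\<close>, and Green's identity bounds \<open>cinner h k\<close> by a
  constant depending on \<open>h\<close> times the norm of \<open>gamma_field z k\<close>. Uniform
  boundedness removes the dependence on \<open>h\<close>.\<close>

lemma gamma_field_lower_bound:
  assumes z: "z \<in> resolvent_set A\<^sub>0"
  obtains c where "0 < c" "\<And>k. c * norm k \<le> norm (gamma_field z k)"
proof -
  have "\<exists>C. \<forall>k \<in> {k. norm (gamma_field z k) \<le> 1}. cmod (cinner h k) \<le> C" for h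
  proof -
    obtain g u where g: "adj A g = Some u" "\<Gamma>\<^sub>0 g = 0" "\<Gamma>\<^sub>1 g = h"
      by (rule surj)
    have "cmod (cinner h k) \<le> norm (u - cnj z *\<^sub>C g)" if "norm (gamma_field z k) \<le> 1" for k
    proof -
      have "cinner h k = cinner (u - cnj z *\<^sub>C g) (gamma_field z k)"
        using green [OF g(1) gamma_field(1) [OF z, of k]] by (simp add: g gamma_field(2) [OF z] cinner_simps)
      then have "cmod (cinner h k) \<le> norm (u - cnj z *\<^sub>C g) * norm (gamma_field z k)"
        by (simp add: cinner_bound)
      also have "\<dots> \<le> norm (u - cnj z *\<^sub>C g) * 1"
        by (intro mult_left_mono that) simp
      finally show ?thesis by simp
    qed
    then show ?thesis by blast
  qed
  then obtain C where C: "0 \<le> C" "\<And>k. norm (gamma_field z k) \<le> 1 \<Longrightarrow> norm k \<le> C"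
    using uniform_boundedness by (metis (mono_tags, lifting) mem_Collect_eq)
  have "norm k \<le> (C + 1) * norm (gamma_field z k)" for k
  proof (cases "k = 0")
    case False
    have "\<Gamma>\<^sub>0 0 = 0"
      by (rule Gamma_operator(1)) (rule linear_operatorD(1) [OF lin])
    then have ne: "gamma_field z k \<noteq> 0"
      using False gamma_field(2) [OF z] by metis
    define a where "a = complex_of_real (1 / norm (gamma_field z k))"
    have "norm (gamma_field z (a *\<^sub>C k)) \<le> 1"
      using ne by (simp add: bounded_clinearD [OF bounded_gam [OF z]] norm_scaleC a_def norm_divide)
    then have "norm (a *\<^sub>C k) \<le> C"
      by (rule C(2))
    then have "norm k / norm (gamma_field z k) \<le> C"
      by (simp add: norm_scaleC a_def norm_divide)
    then have "norm k \<le> C * norm (gamma_field z k)"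
      using ne by (simp add: pos_divide_le_eq)
    then show ?thesis
      by (simp add: distrib_right add_increasing2)
  qed (use C(1) in simp)
  then show ?thesis
    using C(1) by (intro that [of "1 / (C + 1)"]) (auto simp: pos_divide_le_eq mult.commute)
qed

text \<open>The vector R gamma(x) h works, where h solves \<open>N h = k\<close>: \<open>N\<close>
  is gamma(x) followed by its adjoint, hence symmetric and, by
  \<open>gamma_field_lower_bound\<close>, bounded below, so it is onto.\<close>

lemma Gamma1_lifting:
  assumes z: "of_real x \<in> resolvent_set A\<^sub>0"
  obtains C where "\<And>k. \<exists>w u. A\<^sub>0 w = Some u \<and> \<Gamma>\<^sub>1 w = k \<and> norm w \<le> C * norm k \<and> norm u \<le> C * norm k"
proof -
  define z where "z = complex_of_real x"
  have zr: "z \<in> resolvent_set A\<^sub>0" and cz: "cnj z = z"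
    using assms by (simp_all add: z_def)
  obtain R where R: "bounded_clinear R" "\<And>y. A\<^sub>0 (R y) = Some (y + z *\<^sub>C R y)"
    using resolvent_setE [OF zr] by metis
  obtain c where c: "0 < c" "\<And>k. c * norm k \<le> norm (gamma_field z k)"
    using gamma_field_lower_bound [OF zr] by blast
  define N where "N k = \<Gamma>\<^sub>1 (R (gamma_field z k))" for k
  have N: "cinner h (N k) = cinner (gamma_field z h) (gamma_field z k)" for h k
    using gamma_field_adjoint [OF zr, of R] R(2) by (simp add: cz N_def)
  have symN: "cinner (N h) k = cinner h (N k)" for h k
    using N [of k h] N [of h k] cinner_commute by metis
  have lowN: "c\<^sup>2 * norm k \<le> norm (N k)" for k
  proof (cases "k = 0")
    case False
    have "c\<^sup>2 * (norm k)\<^sup>2 \<le> (norm (gamma_field z k))\<^sup>2"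
      using c by (simp only: power_mult_distrib [symmetric]) (intro power_mono, auto)
    also have "\<dots> = cmod (cinner k (N k))"
      by (simp add: N cinner_self norm_power)
    also have "\<dots> \<le> norm k * norm (N k)"
      by (rule cinner_bound)
    finally have "(c\<^sup>2 * norm k) * norm k \<le> norm (N k) * norm k"
      by (simp add: power2_eq_square mult_ac)
    then show ?thesis
      by (rule mult_right_le_imp_le) (use False in simp)
  qed simp
  have surjN: "\<exists>h. N h = k" for k
  proof -
    define B where "B = (\<lambda>k. Some (N k))"
    have "bounded_clinear N"
      using symN by (rule hellinger_toeplitz)
    then have "linear_operator B"
      by (simp add: linear_operator_def B_def bounded_clinearD)
    moreover have "selfadjoint_operator B"
      unfolding selfadjoint_operator_def B_def by (auto simp: symN intro: cinner_ext_right)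
    ultimately have "\<exists>f u. B f = Some u \<and> k = u - 0 *\<^sub>C f"
      using lowN c by (intro selfadjoint_surjective [of B "c\<^sup>2"]) (auto simp: B_def)
    then show ?thesis
      by (auto simp: B_def)
  qed
  obtain C1 where C1: "0 < C1" "\<And>k. norm (R (gamma_field z k)) \<le> C1 * norm k"
    using bounded_clinear_norm_bound [OF bounded_clinear_compose [OF R(1) bounded_gam [OF zr]]]
    by blast
  obtain C2 where C2: "0 < C2" "\<And>k. norm (gamma_field z k) \<le> C2 * norm k"
    using bounded_clinear_norm_bound [OF bounded_gam [OF zr]] by blast
  \<comment> \<open>A common bound for w = R gamma(x) h and its image gamma(x) h + x w; the division
    by \<open>c\<^sup>2\<close> comes from solving \<open>N h = k\<close>.\<close>
  define C where "C = (C1 + C2 + cmod z * C1) / c\<^sup>2"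
  show ?thesis
  proof (rule that)
    fix k
    obtain h where h: "N h = k"
      using surjN by blast
    have hk: "norm h \<le> norm k / c\<^sup>2"
      using lowN [of h] c h by (simp add: pos_le_divide_eq mult.commute)
    have *: "a * norm h \<le> C * norm k" if "a \<le> C1 + C2 + cmod z * C1" "0 \<le> a" for a
    proof -
      have "a * norm h \<le> (C1 + C2 + cmod z * C1) * (norm k / c\<^sup>2)"
        using that hk by (intro mult_mono) auto
      then show ?thesis
        by (simp add: C_def)
    qed
    have "norm (R (gamma_field z h)) \<le> C1 * norm h"
      by (rule C1)
    also have "\<dots> \<le> C * norm k"
      using C1 C2 by (intro *) (auto simp: add_increasing2)
    finally have 1: "norm (R (gamma_field z h)) \<le> C * norm k" .
    have "norm (gamma_field z h + z *\<^sub>C R (gamma_field z h)) \<le> norm (gamma_field z h) + cmod z * norm (R (gamma_field z h))"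
      using norm_triangle_ineq norm_scaleC by metis
    also have "\<dots> \<le> C2 * norm h + cmod z * (C1 * norm h)"
      by (intro add_mono mult_left_mono C1 C2) simp
    also have "\<dots> = (C2 + cmod z * C1) * norm h"
      by (simp add: algebra_simps)
    also have "\<dots> \<le> C * norm k"
      using C1 C2 by (intro *) auto
    finally have 2: "norm (gamma_field z h + z *\<^sub>C R (gamma_field z h)) \<le> C * norm k" .
    have "\<Gamma>\<^sub>1 (R (gamma_field z h)) = k"
      using h by (simp add: N_def)
    then show "\<exists>w u. A\<^sub>0 w = Some u \<and> \<Gamma>\<^sub>1 w = k \<and> norm w \<le> C * norm k \<and> norm u \<le> C * norm k"
      using R(2) 1 2 by blast
  qed
qed

end

section \<open>Transversality with the Friedrichs extension\<close>

locale nonneg_boundary_triplet = symmetric_boundary_triplet A \<Gamma>\<^sub>0 \<Gamma>\<^sub>1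
  for A :: "'a::complex_hilbert \<rightharpoonup> 'a" and \<Gamma>\<^sub>0 \<Gamma>\<^sub>1 :: "'a \<Rightarrow> 'b::complex_hilbert" +
  assumes nonneg: "nonneg_operator A"
begin

sublocale nonneg_symmetric A
  by unfold_locales (rule lin dense sym nonneg)+

abbreviation A\<^sub>F :: "'a \<rightharpoonup> 'a" where "A\<^sub>F \<equiv> friedrichs_extension A"

lemma AF_adj: "A\<^sub>F f = Some u \<Longrightarrow> adj A f = Some u"
  by (simp add: friedrichs_extension_iff)

section \<open>From transversality to the Stieltjes class\<close>

lemma transversal_imp_S_hat:
  assumes nonneg0: "nonneg_operator A\<^sub>0" and tr: "transversal A A\<^sub>0 A\<^sub>F"
  shows "in_class_S_hat (resolvent_set A\<^sub>0) M"
proof -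
  have int: "dom A\<^sub>0 \<inter> dom A\<^sub>F = dom A"
    and sum: "{f + g | f g. f \<in> dom A\<^sub>0 \<and> g \<in> dom A\<^sub>F} = dom (adj A)"
    using tr by (simp_all add: transversal_def)
  have res: "z \<in> resolvent_set A\<^sub>0" if "z \<notin> \<real>\<^sub>\<ge>\<^sub>0" for z
    by (rule selfadjoint_nonneg_resolvent_set [OF linear_A0 selfadjoint_A0 nonneg0 that])
  \<comment> \<open>Transversality splits any lift of \<open>h\<close>; the summand from
    \<open>A\<^sub>0\<close> does not contribute to \<open>\<Gamma>\<^sub>0\<close>.\<close>
  have "\<exists>g v. A\<^sub>F g = Some v \<and> \<Gamma>\<^sub>0 g = h" for h
  proof -
    obtain f u where f: "adj A f = Some u" "\<Gamma>\<^sub>0 f = h"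
      by (rule surj)
    then have "f \<in> {f + g | f g. f \<in> dom A\<^sub>0 \<and> g \<in> dom A\<^sub>F}"
      using sum by auto
    then obtain a b g v where "f = a + g" "A\<^sub>0 a = Some b" "A\<^sub>F g = Some v"
      by auto
    then show ?thesis
      using Gamma_linear(3) [OF _ AF_adj, of a b g v] f by (auto simp: A0_iff)
  qed
  then obtain g v where gv: "\<And>h. A\<^sub>F (g h) = Some (v h)" "\<And>h. \<Gamma>\<^sub>0 (g h) = h"
    by metis
  \<comment> \<open>The boundary operator of the Friedrichs extension; it inherits the symmetry of
    \<open>A\<^sub>F\<close>, and Hellinger--Toeplitz makes it bounded.\<close>
  define B where "B h = \<Gamma>\<^sub>1 (g h)" for h
  have B: "cinner (B x) y = cinner x (B y)" for x y
    using green [OF AF_adj [OF gv(1)] AF_adj [OF gv(1)], of x y]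
      symmetric_friedrichs [OF gv(1) gv(1), of x y] by (simp add: gv(2) B_def)
  have bB: "bounded_clinear B"
    using B by (rule hellinger_toeplitz)
  define F where "F = (\<lambda>z h. M z h - B h)"
  have "operator_holomorphic_on F S" if "S \<subseteq> resolvent_set A\<^sub>0" for S
    unfolding F_def by (rule operator_holomorphic_on_diff_const [OF weyl_holomorphic [OF that] bB])
  moreover have "- \<real>\<^sub>\<ge>\<^sub>0 \<subseteq> resolvent_set A\<^sub>0" "{z. Im z > 0} \<subseteq> resolvent_set A\<^sub>0"
    using res by (auto simp: complex_nonneg_Reals_iff)
  moreover have "bounded_nonneg (Im_operator (F z))" if "Im z > 0" for z
    unfolding F_def by (rule Im_operator_weyl [OF that B])
  moreover have "bounded_nonneg (F (of_real x))" if "x < 0" for x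
    unfolding bounded_nonneg_def
  proof
    fix h
    have x: "of_real x \<in> resolvent_set A\<^sub>0"
      using that by (intro res) (simp add: complex_nonneg_Reals_iff)
    define f where "f = gamma_field (of_real x) h"
    have f: "adj A f = Some (of_real x *\<^sub>C f)" "\<Gamma>\<^sub>0 f = h" "\<Gamma>\<^sub>1 f = M (of_real x) h"
      using gamma_field [OF x] weyl_eq [OF x] by (simp_all add: f_def)
    have g: "adj A (g h) = Some (v h)"
      by (rule AF_adj [OF gv(1)])
    \<comment> \<open>\<open>u\<close> is the image of \<open>g h\<close> under
      \<open>A\<^sub>F\<close> minus x, and \<open>w\<close> is the resolvent of
      \<open>A\<^sub>0\<close> at \<open>u\<close>. By Green's identity the form of F(x) at
      \<open>h\<close> is the difference of the two resolvent forms at \<open>u\<close>, so the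
      claim is that the resolvent of \<open>A\<^sub>0\<close> dominates there.\<close>
    define u where "u = v h - of_real x *\<^sub>C g h"
    define w where "w = g h - f"
    have w: "A\<^sub>0 w = Some (u + of_real x *\<^sub>C w)"
      using adj_linear(4) [OF g f(1)] Gamma_linear(5) [OF g f(1)]
      by (simp add: A0_iff w_def f gv u_def scaleC_simps)
    have eq: "cinner (F (of_real x) h) h = cnj (cinner u w - cinner u (g h))"
    proof -
      have "cinner (v h) f - cinner (g h) (of_real x *\<^sub>C f)
          = cinner (B h) h - cinner h (M (of_real x) h)"
        using green [OF g f(1)] by (simp add: f gv B_def)
      then have "cinner h (F (of_real x) h) = - cinner u f"
        by (simp add: F_def u_def cinner_simps B [of h h])
      then show ?thesis
        by (metis cinner_commute cinner_diff_right diff_diff_eq2 add_diff_cancel_left'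
            minus_diff_eq w_def)
    qed
    obtain X U where X: "\<And>n. A (X n) = Some (U n)" "X \<longlonglongrightarrow> g h"
      "(\<lambda>n. cinner (U n) (X n)) \<longlonglongrightarrow> cinner (v h) (g h)"
      by (rule friedrichs_approx [OF gv(1) [of h]]) blast
    text \<open>Extremality of the Friedrichs extension: the variational expression on the left is bounded
      by the resolvent form of \<open>A\<^sub>0\<close> and converges to that of the Friedrichs extension.\<close>
    have le: "2 * Re (cinner u (X n)) - Re (cinner (U n - of_real x *\<^sub>C X n) (X n))
        \<le> Re (cinner u w)" for n
    proof -
      have X0: "A\<^sub>0 (X n) = Some (U n)"
        using in_adj [OF X(1)] Gamma_operator [OF X(1)] by (simp add: A0_iff)
      \<comment> \<open>The form of \<open>A\<^sub>0\<close> minus x is nonnegative at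
        \<open>w - X n\<close>; expanding it gives the variational bound.\<close>
      have "0 \<le> Re (cinner (u + of_real x *\<^sub>C w - U n) (w - X n))"
        using linear_operatorD(4) [OF linear_A0 w X0] nonneg0
        unfolding nonneg_operator_iff by blast
      also have "\<dots> \<le> Re (cinner (u + of_real x *\<^sub>C w - U n) (w - X n)) - x * (norm (w - X n))\<^sup>2"
        using \<open>x < 0\<close> by (simp add: mult_le_0_iff)
      also have "\<dots> = Re (cinner (u - (U n - of_real x *\<^sub>C X n)) (w - X n))"
      proof -
        have "u - (U n - of_real x *\<^sub>C X n)
            = (u + of_real x *\<^sub>C w - U n) - of_real x *\<^sub>C (w - X n)"
          by (simp add: scaleC_simps)
        then show ?thesis
          by (simp only: cinner_diff_left [of _ "of_real x *\<^sub>C (w - X n)"] cinner_scaleC_left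
              cinner_self) simp
      qed
      also have "\<dots> = Re (cinner u w) - Re (cinner u (X n))
          - Re (cinner (U n - of_real x *\<^sub>C X n) w)
          + Re (cinner (U n - of_real x *\<^sub>C X n) (X n))"
        by (simp add: cinner_diff_left [of u] cinner_diff_right)
      also have "cinner (U n - of_real x *\<^sub>C X n) w = cinner (X n) u"
        using symmetric_operatorD [OF symmetric_A0 X0 w] by (simp add: cinner_simps)
      also have "Re (cinner (X n) u) = Re (cinner u (X n))"
        by (metis cinner_commute cnj.simps(1))
      finally show ?thesis by simp
    qed
    have "(\<lambda>n. 2 * Re (cinner u (X n)) - Re (cinner (U n - of_real x *\<^sub>C X n) (X n)))
        \<longlonglongrightarrow> 2 * Re (cinner u (g h)) - Re (cinner (v h) (g h) - of_real x * cinner (g h) (g h))"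
      unfolding cinner_diff_left cinner_scaleC_left by (intro tendsto_intros X)
    then have "2 * Re (cinner u (g h)) - Re (cinner (v h) (g h) - of_real x * cinner (g h) (g h))
        \<le> Re (cinner u w)"
      using le by (intro LIMSEQ_le_const2) auto
    moreover have "cinner (v h) (g h) - of_real x * cinner (g h) (g h) = cinner u (g h)"
      by (simp add: u_def cinner_simps)
    ultimately have "0 \<le> Re (cinner (F (of_real x) h) h)"
      by (simp add: eq)
    moreover have "cinner (F (of_real x) h) h = cinner h (F (of_real x) h)"
      using weyl_adjoint [OF x, of h h] by (simp add: F_def cinner_simps B)
    then have "Im (cinner (F (of_real x) h) h) = 0"
      by (metis Reals_cnj_iff cinner_commute complex_is_Real_iff)
    ultimately show "cinner (F (of_real x) h) h \<in> \<real>\<^sub>\<ge>\<^sub>0"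
      by (simp add: complex_nonneg_Reals_iff)
  qed
  ultimately have "F \<in> class_S"
    by (simp add: class_S_def class_R_def)
  moreover have "bounded_adjoint B = B"
    using B by (intro ext bounded_adjointI)
  ultimately show ?thesis
    unfolding in_class_S_hat_def using bB by (intro exI [of _ F] exI [of _ B]) (simp add: F_def)
qed

section \<open>From the Stieltjes class to transversality\<close>

lemma S_hat_negative_resolvent:
  assumes F: "F \<in> class_S" and K: "bounded_clinear K" "bounded_adjoint K = K"
    and M_eq: "\<And>z h. z \<in> resolvent_set A\<^sub>0 - \<real>\<^sub>\<ge>\<^sub>0 \<Longrightarrow> M z h = F z h + K h"
    and x: "x < 0"
  shows "of_real x \<in> resolvent_set A\<^sub>0"
proof -
  define L where "L h = F (of_real x) h + K h" for h
  have xS: "of_real x \<in> - \<real>\<^sub>\<ge>\<^sub>0"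
    using x by (simp add: complex_nonneg_Reals_iff)
  have hol: "operator_holomorphic_on F (- \<real>\<^sub>\<ge>\<^sub>0)"
    using F by (simp add: class_S_def)
  have symK: "cinner (K a) b = cinner a (K b)" for a b
    using cinner_bounded_adjoint [OF K(1), of a b] K(2) by simp
  have "cinner (F (of_real x) a) b = cinner a (F (of_real x) b)" for a b
  proof (rule real_form_imp_symmetric)
    show "bounded_clinear (F (of_real x))"
      using hol xS by (simp add: operator_holomorphic_on_def)
    show "Im (cinner (F (of_real x) a) a) = 0" for a
      using F x by (simp add: class_S_def bounded_nonneg_def complex_nonneg_Reals_iff)
  qed
  then have symL: "cinner (L a) b = cinner a (L b)" for a b
    by (simp add: L_def cinner_simps symK)
  have bd: "- x * norm f \<le> norm (u - of_real x *\<^sub>C f)" if "A f = Some u" for f u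
    by (rule nonneg_lower_bound [OF nonneg that])
  define e where "e n = inverse (real (Suc n))" for n
  \<comment> \<open>The points \<open>zz n\<close> approach \<open>x\<close> vertically; being
    nonreal, they lie in the resolvent set, where \<open>M\<close> equals F + K.\<close>
  define zz where "zz n = Complex x (e n)" for n
  have e: "0 < e n" for n
    by (simp add: e_def)
  have e0: "e \<longlonglongrightarrow> 0"
    unfolding e_def by (rule LIMSEQ_inverse_real_of_nat)
  have zzr: "zz n \<in> resolvent_set A\<^sub>0" and zzS: "zz n \<in> - \<real>\<^sub>\<ge>\<^sub>0" and zzx: "zz n \<noteq> of_real x" for n
    using e [of n] by (auto simp: zz_def nonreal_in_resolvent_set complex_nonneg_Reals_iff
        complex_eq_iff)
  have zz: "zz \<longlonglongrightarrow> of_real x"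
    unfolding zz_def using tendsto_Complex [OF tendsto_const e0] by (simp add: complex_of_real_def)
  have zzF: "filterlim zz (at (of_real x) within - \<real>\<^sub>\<ge>\<^sub>0) sequentially"
    using zz zzS zzx by (auto simp: filterlim_at)
  have limM: "(\<lambda>n. M (zz n) h) \<longlonglongrightarrow> L h" for h
  proof -
    have "(\<lambda>n. F (zz n) h + K h) \<longlonglongrightarrow> L h"
      unfolding L_def
      by (intro tendsto_intros filterlim_compose [OF operator_holomorphic_tendsto [OF hol xS] zzF])
    then show ?thesis
      using M_eq zzr zzS by simp
  qed
  \<comment> \<open>The imaginary part of the form of M(zz n) is \<open>e n\<close> times the
    squared norm of gamma(zz n) h, and tends to 0 because the limit \<open>L\<close> is symmetric.
    One more factor \<open>e n\<close> gives the claim.\<close>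
  have gam0: "(\<lambda>n. e n * norm (gamma_field (zz n) h)) \<longlonglongrightarrow> 0" for h
  proof -
    have "(\<lambda>n. cinner (M (zz n) h) h - cinner h (M (zz n) h)) \<longlonglongrightarrow> cinner (L h) h - cinner h (L h)"
      by (intro tendsto_intros limM)
    moreover have "cinner (M (zz n) h) h - cinner h (M (zz n) h)
        = 2 * \<i> * of_real (e n * (norm (gamma_field (zz n) h))\<^sup>2)" for n
      unfolding gamma_field_green [OF zzr zzr, symmetric] cinner_self
      by (simp add: zz_def complex_eq_iff)
    ultimately have "(\<lambda>n. 2 * \<i> * complex_of_real (e n * (norm (gamma_field (zz n) h))\<^sup>2)) \<longlonglongrightarrow> 0"
      by (simp add: symL)
    then have "(\<lambda>n. norm (2 * \<i> * complex_of_real (e n * (norm (gamma_field (zz n) h))\<^sup>2))) \<longlonglongrightarrow> 0"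
      by (rule tendsto_norm_zero)
    then have "(\<lambda>n. 2 * (e n * (norm (gamma_field (zz n) h))\<^sup>2)) \<longlonglongrightarrow> 0"
      by (simp only: norm_mult norm_of_real) (simp add: abs_mult less_imp_le [OF e])
    then have "(\<lambda>n. e n * (2 * (e n * (norm (gamma_field (zz n) h))\<^sup>2)) / 2) \<longlonglongrightarrow> 0 * 0 / 2"
      by (intro tendsto_intros e0) simp_all
    moreover have "e n * (2 * (e n * (norm (gamma_field (zz n) h))\<^sup>2)) / 2 = (e n * norm (gamma_field (zz n) h))\<^sup>2" for n
      by (simp add: power2_eq_square)
    ultimately have "(\<lambda>n. (e n * norm (gamma_field (zz n) h))\<^sup>2) \<longlonglongrightarrow> 0"
      by simp
    then show ?thesis
      by simp
  qed
  \<comment> \<open>Green's identity between gamma(zz n) h and \<open>f\<close> carries the factor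
    zz n - x = \<i> e n, so the discrepancy tends to 0 by \<open>gam0\<close>.\<close>
  have defect: "cinner (L h) (\<Gamma>\<^sub>0 f) = cinner h (\<Gamma>\<^sub>1 f)" if f: "adj A f = Some (of_real x *\<^sub>C f)" for f h
  proof -
    have "(\<lambda>n. cinner (M (zz n) h) (\<Gamma>\<^sub>0 f) - cinner h (\<Gamma>\<^sub>1 f))
        \<longlonglongrightarrow> cinner (L h) (\<Gamma>\<^sub>0 f) - cinner h (\<Gamma>\<^sub>1 f)"
      by (intro tendsto_intros limM)
    moreover have "(\<lambda>n. cinner (M (zz n) h) (\<Gamma>\<^sub>0 f) - cinner h (\<Gamma>\<^sub>1 f)) \<longlonglongrightarrow> 0"
    proof (rule Lim_null_comparison [OF always_eventually])
      show "\<forall>n. norm (cinner (M (zz n) h) (\<Gamma>\<^sub>0 f) - cinner h (\<Gamma>\<^sub>1 f))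
          \<le> e n * norm (gamma_field (zz n) h) * norm f"
      proof
        fix n
        have "zz n - of_real x = \<i> * of_real (e n)"
          by (simp add: zz_def complex_eq_iff)
        then have "cinner (M (zz n) h) (\<Gamma>\<^sub>0 f) - cinner h (\<Gamma>\<^sub>1 f)
            = \<i> * of_real (e n) * cinner (gamma_field (zz n) h) f"
          using green [OF gamma_field(1) [OF zzr] f, of n h]
          by (simp add: gamma_field(2) [OF zzr] weyl_eq [OF zzr] cinner_simps left_diff_distrib [symmetric])
        then have "norm (cinner (M (zz n) h) (\<Gamma>\<^sub>0 f) - cinner h (\<Gamma>\<^sub>1 f))
            = e n * cmod (cinner (gamma_field (zz n) h) f)"
          using e [of n] by (simp add: norm_mult)
        also have "\<dots> \<le> e n * (norm (gamma_field (zz n) h) * norm f)"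
          using e [of n] by (intro mult_left_mono cinner_bound) simp
        finally show "norm (cinner (M (zz n) h) (\<Gamma>\<^sub>0 f) - cinner h (\<Gamma>\<^sub>1 f))
            \<le> e n * norm (gamma_field (zz n) h) * norm f"
          by (simp add: mult.assoc)
      qed
      show "(\<lambda>n. e n * norm (gamma_field (zz n) h) * norm f) \<longlonglongrightarrow> 0"
        using tendsto_mult [OF gam0 [of h] tendsto_const [of "norm f"]] by simp
    qed
    ultimately show ?thesis
      using LIMSEQ_unique by fastforce
  qed
  \<comment> \<open>A solution \<open>v\<close> of the equation for \<open>adj A\<close> is
    corrected by a defect vector with the same \<open>\<Gamma>\<^sub>0\<close>. By
    \<open>defect\<close> and maximality, \<open>\<Gamma>\<^sub>0 v\<close> and
    \<open>L (\<Gamma>\<^sub>0 v)\<close> are the boundary values of such a vector.\<close>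
  have surj_x: "\<exists>f u. A\<^sub>0 f = Some u \<and> y = u - of_real x *\<^sub>C f" for y
  proof -
    obtain v where v: "adj A v = Some (y + of_real x *\<^sub>C v)"
      using adj_shift_surjective [of "- x" x y] bd x by auto
    obtain g where g: "adj A g = Some (of_real x *\<^sub>C g)" "\<Gamma>\<^sub>0 g = \<Gamma>\<^sub>0 v"
      by (rule defect_boundary_maximal [of "- x" x "L (\<Gamma>\<^sub>0 v)" "\<Gamma>\<^sub>0 v"])
        (use bd x defect in auto)
    have "A\<^sub>0 (v - g) = Some (y + of_real x *\<^sub>C v - of_real x *\<^sub>C g)"
      using adj_linear(4) [OF v g(1)] Gamma_linear(5) [OF v g(1)] g(2) by (simp add: A0_iff)
    then show ?thesis
      by (intro exI conjI, assumption) (simp add: scaleC_diff_right)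
  qed
  show ?thesis
    by (rule symmetric_resolvent_setI [OF linear_A0 symmetric_A0]) (use surj_x in simp_all)
qed

lemma weyl_form_real:
  assumes "of_real x \<in> resolvent_set A\<^sub>0"
  shows "cinner (M (of_real x) h) k = cinner h (M (of_real x) k)"
  using weyl_adjoint [OF assms, of h k] by simp

text \<open>Let p be the real part of the inner product of f x and f y. Green's identity gives (x -
  y) p = \<mu> x - \<mu> y, and the form of \<open>A\<^sub>0\<close> at f x - f y is - (x + y) p
  plus two nonpositive terms. Its nonnegativity gives p \<ge> 0 and the estimates.\<close>

lemma defect_form_bound:
  fixes h :: 'b
  assumes nonneg0: "nonneg_operator A\<^sub>0" and x: "x < 0" and y: "y \<le> 2 * x"
  defines "\<mu> \<equiv> \<lambda>t. Re (cinner (M (complex_of_real t) h) h)"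
    and "f \<equiv> \<lambda>t. gamma_field (complex_of_real t) h"
  shows "Re (cinner (of_real x *\<^sub>C f x - of_real y *\<^sub>C f y) (f x - f y)) \<le> 3 * (\<mu> x - \<mu> y)"
    and "- x * (norm (f x))\<^sup>2 \<le> 3 * (\<mu> x - \<mu> y)" and "\<mu> y \<le> \<mu> x"
proof -
  have res: "of_real t \<in> resolvent_set A\<^sub>0" if "t < 0" for t
    using that by (intro selfadjoint_nonneg_resolvent_set [OF linear_A0 selfadjoint_A0 nonneg0])
      (simp add: complex_nonneg_Reals_iff)
  have y0: "y < 0" using x y by simp
  define p where "p = Re (cinner (f x) (f y))"
  have p': "Re (cinner (f y) (f x)) = p"
    unfolding p_def by (metis cinner_commute cnj.simps(1))
  have "of_real (x - y) * cinner (f x) (f y)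
      = cinner (M (of_real x) h) h - cinner h (M (of_real y) h)"
    using gamma_field_green [OF res [OF x] res [OF y0], of h h] by (simp add: f_def)
  then have "Re (of_real (x - y) * cinner (f x) (f y)) = \<mu> x - \<mu> y"
    by (simp only: weyl_form_real [OF res [OF y0], symmetric] \<mu>_def minus_complex.sel)
  then have p: "(x - y) * p = \<mu> x - \<mu> y"
    by (simp add: p_def)
  define q where "q = Re (cinner (of_real x *\<^sub>C f x - of_real y *\<^sub>C f y) (f x - f y))"
  have "0 \<le> q"
    using gamma_field_diff [OF res [OF x] res [OF y0], of h] nonneg0
    unfolding nonneg_operator_iff q_def f_def by blast
  have q: "q = x * (norm (f x))\<^sup>2 + y * (norm (f y))\<^sup>2 - (x + y) * p"
    by (simp add: q_def cinner_simps cinner_self p_def [symmetric] p' algebra_simps)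
  have nn: "x * (norm (f x))\<^sup>2 \<le> 0" "y * (norm (f y))\<^sup>2 \<le> 0"
    using x y0 by (simp_all add: mult_le_0_iff)
  have "0 \<le> - (x + y) * p"
    using \<open>0 \<le> q\<close> q nn by (simp only: minus_mult_left [symmetric])
  then have p0: "0 \<le> p"
    using x y0 by (simp add: zero_le_mult_iff)
  \<comment> \<open>The condition y \<le> 2 x is equivalent to - (x + y) \<le> 3 (x - y), which is
    the origin of the factor 3.\<close>
  have "- (x + y) * p \<le> (3 * (x - y)) * p"
    using x y by (intro mult_right_mono p0) simp
  then have le: "- (x + y) * p \<le> 3 * (\<mu> x - \<mu> y)"
    by (simp only: mult.assoc p)
  show "Re (cinner (of_real x *\<^sub>C f x - of_real y *\<^sub>C f y) (f x - f y)) \<le> 3 * (\<mu> x - \<mu> y)"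
    using le q nn unfolding q_def by linarith
  show "- x * (norm (f x))\<^sup>2 \<le> 3 * (\<mu> x - \<mu> y)"
    using le q nn \<open>0 \<le> q\<close> by linarith
  have "0 \<le> (x - y) * p"
    using x y p0 by simp
  then show "\<mu> y \<le> \<mu> x"
    using p by simp
qed

text \<open>By \<open>lower\<close> the decreasing forms of M(x) stay bounded below as x tends to
  minus infinity, so M(x) h has a limit \<open>k\<close>. A vector with boundary values
  \<open>h\<close> and \<open>k\<close> is then approximated in the form sense by elements of
  \<open>dom A\<close>.\<close>

lemma Gamma0_friedrichs_surj:
  assumes nonneg0: "nonneg_operator A\<^sub>0" and K: "bounded_clinear K"
    and lower: "\<And>x h. x < 0 \<Longrightarrow> Re (cinner (K h) h) \<le> Re (cinner (M (of_real x) h) h)"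
  obtains g v where "A\<^sub>F g = Some v" "\<Gamma>\<^sub>0 g = h"
proof -
  have res: "of_real t \<in> resolvent_set A\<^sub>0" if "t < 0" for t
    using that by (intro selfadjoint_nonneg_resolvent_set [OF linear_A0 selfadjoint_A0 nonneg0])
      (simp add: complex_nonneg_Reals_iff)
  \<comment> \<open>Powers of 2, so that any two of the points satisfy y \<le> 2 x in
    \<open>defect_form_bound\<close>.\<close>
  define x where "x n = - ((2::real) ^ n)" for n
  have x: "x n < 0" for n
    by (simp add: x_def)
  have x2: "x k \<le> 2 * x n" if "n < k" for n k
  proof -
    have "(2::real) ^ Suc n \<le> 2 ^ k"
      using that by (intro power_increasing) auto
    then show ?thesis by (simp add: x_def)
  qed
  define \<mu> where "\<mu> h n = Re (cinner (M (complex_of_real (x n)) h) h)" for h n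
  define f where "f n = gamma_field (complex_of_real (x n)) h" for n
  note xr = res [OF x]
  have form: "Re (cinner (of_real (x n) *\<^sub>C f n - of_real (x k) *\<^sub>C f k) (f n - f k))
      \<le> 3 * (\<mu> h n - \<mu> h k)" if "n < k" for n k
    unfolding \<mu>_def f_def by (rule defect_form_bound [OF nonneg0 x x2 [OF that]])
  have f_small: "- x n * (norm (f n))\<^sup>2 \<le> 3 * (\<mu> h n - \<mu> h (Suc n))" for n
    unfolding \<mu>_def f_def by (rule defect_form_bound [OF nonneg0 x x2 [OF lessI]])
  have "\<mu> l (Suc n) \<le> \<mu> l n" for l n
    unfolding \<mu>_def by (rule defect_form_bound [OF nonneg0 x x2 [OF lessI]])
  then have dec: "decseq (\<mu> l)" for l
    by (rule decseq_SucI)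
  have \<mu>_lower: "Re (cinner (K l) l) \<le> \<mu> l n" for l n
    unfolding \<mu>_def by (rule lower [OF x])
  obtain m where m: "\<mu> h \<longlonglongrightarrow> m"
    by (rule decseq_convergent [OF dec [of h], of "Re (cinner (K h) h)"])
      (simp_all add: \<mu>_lower)
  have f0: "f \<longlonglongrightarrow> 0"
  proof -
    have "(\<lambda>n. (norm (f n))\<^sup>2) \<longlonglongrightarrow> 0"
    proof (rule Lim_null_comparison [OF always_eventually])
      have "(\<lambda>n. 3 * (\<mu> h n - \<mu> h (Suc n))) \<longlonglongrightarrow> 3 * (m - m)"
        by (intro tendsto_intros m LIMSEQ_Suc)
      then show "(\<lambda>n. 3 * (\<mu> h n - \<mu> h (Suc n))) \<longlonglongrightarrow> 0"
        by simp
      show "\<forall>n. norm ((norm (f n))\<^sup>2) \<le> 3 * (\<mu> h n - \<mu> h (Suc n))"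
      proof
        fix n
        have "1 * (norm (f n))\<^sup>2 \<le> - x n * (norm (f n))\<^sup>2"
          by (intro mult_right_mono) (simp_all add: x_def)
        then show "norm ((norm (f n))\<^sup>2) \<le> 3 * (\<mu> h n - \<mu> h (Suc n))"
          using f_small [of n] by simp
      qed
    qed
    then show ?thesis
      by (simp add: tendsto_norm_zero_iff)
  qed
  define Mn where "Mn n = M (complex_of_real (x n))" for n
  have symM: "cinner (Mn n a) b = cinner a (Mn n b)" for n a b
    unfolding Mn_def by (rule weyl_form_real [OF xr])
  have bM: "bounded_clinear (Mn n)" for n
    unfolding Mn_def by (rule bounded_weyl [OF xr])
  have \<mu>: "\<mu> l n = Re (cinner (Mn n l) l)" for l n
    by (simp add: \<mu>_def Mn_def)
  obtain C where C: "0 < C" "\<And>l. norm (Mn 0 l - K l) \<le> C * norm l"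
    using bounded_clinear_norm_bound [OF bounded_clinear_diff [OF bM K]] by blast
  have \<mu>_upper: "\<mu> l 0 - Re (cinner (K l) l) \<le> C * (norm l)\<^sup>2" for l
  proof -
    have "\<mu> l 0 - Re (cinner (K l) l) = Re (cinner (Mn 0 l - K l) l)"
      by (simp add: \<mu> cinner_simps)
    also have "\<dots> \<le> norm (Mn 0 l - K l) * norm l"
      using complex_Re_le_cmod cinner_bound order_trans by blast
    also have "\<dots> \<le> C * norm l * norm l"
      by (intro mult_right_mono C) simp
    finally show ?thesis
      by (simp add: power2_eq_square mult.assoc)
  qed
  \<comment> \<open>The difference \<open>T\<close> of two values of \<open>M\<close> is nonnegative
    with form at most \<open>C\<close> times the squared norm, so its norm at \<open>h\<close> is
    controlled by the convergent scalars \<open>\<mu> h n\<close>.\<close>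
  have diff_bound: "(norm (Mn n h - Mn k h))\<^sup>2 \<le> C * (\<mu> h n - \<mu> h k)" if "n \<le> k" for n k
  proof -
    define T where "T l = Mn n l - Mn k l" for l
    have T: "Re (cinner (T l) l) = \<mu> l n - \<mu> l k" for l
      by (simp add: T_def \<mu> cinner_simps)
    have "(norm (T h))\<^sup>2 \<le> C * Re (cinner (T h) h)"
    proof (rule nonneg_map_norm_bound)
      show "T (c *\<^sub>C a + b) = c *\<^sub>C T a + T b" for c a b
        by (simp add: T_def bounded_clinearD [OF bM] scaleC_diff_right)
      show "cinner (T a) b = cinner a (T b)" for a b
        by (simp add: T_def cinner_simps symM)
      show "0 \<le> Re (cinner (T l) l)" for l
        unfolding T using decseqD [OF dec that, of l] by simp
      show "Re (cinner (T l) l) \<le> C * (norm l)\<^sup>2" for l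
        unfolding T using decseqD [OF dec, of 0 n l] \<mu>_lower [of l k] \<mu>_upper [of l] by simp
    qed
    then show ?thesis
      by (simp only: T) (simp only: T_def)
  qed
  have \<mu>_Cauchy: "\<exists>N. \<forall>m\<ge>N. \<forall>n\<ge>N. \<bar>\<mu> h m - \<mu> h n\<bar> < r" if "0 < r" for r
    using metric_CauchyD [OF LIMSEQ_imp_Cauchy [OF m] that] by (simp add: dist_real_def)
  have "Cauchy (\<lambda>n. Mn n h)"
  proof (rule metric_CauchyI)
    fix r :: real
    assume "0 < r"
    then have "0 < r\<^sup>2 / C"
      using C by simp
    then obtain N where N: "\<And>m n. m \<ge> N \<Longrightarrow> n \<ge> N \<Longrightarrow> \<bar>\<mu> h m - \<mu> h n\<bar> < r\<^sup>2 / C"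
      using \<mu>_Cauchy by meson
    have *: "norm (Mn n h - Mn k h) < r" if "N \<le> n" "n \<le> k" for n k
    proof -
      have "(norm (Mn n h - Mn k h))\<^sup>2 \<le> C * (\<mu> h n - \<mu> h k)"
        using diff_bound that by blast
      also have "\<mu> h n - \<mu> h k < r\<^sup>2 / C"
        using N [of n k] that by simp
      then have "C * (\<mu> h n - \<mu> h k) < C * (r\<^sup>2 / C)"
        using C(1) by (rule mult_strict_left_mono)
      also have "C * (r\<^sup>2 / C) = r\<^sup>2"
        using C(1) by simp
      finally show ?thesis
        by (rule power_less_imp_less_base) (use \<open>0 < r\<close> in simp)
    qed
    show "\<exists>N. \<forall>m\<ge>N. \<forall>n\<ge>N. dist (Mn m h) (Mn n h) < r"
    proof (intro exI allI impI)
      fix m n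
      assume "m \<ge> N" "n \<ge> N"
      then show "dist (Mn m h) (Mn n h) < r"
        using * [of m n] * [of n m] by (cases "m \<le> n") (auto simp: dist_norm norm_minus_commute)
    qed
  qed
  then obtain k where k: "(\<lambda>n. Mn n h) \<longlonglongrightarrow> k"
    using Cauchy_convergent convergent_def by blast
  obtain g v where g: "adj A g = Some v" "\<Gamma>\<^sub>0 g = h" "\<Gamma>\<^sub>1 g = k"
    by (rule surj)
  have "of_real (- 1) \<in> resolvent_set A\<^sub>0"
    by (rule res) simp
  then obtain C' where C': "\<And>l. \<exists>w u. A\<^sub>0 w = Some u \<and> \<Gamma>\<^sub>1 w = l \<and>
      norm w \<le> C' * norm l \<and> norm u \<le> C' * norm l"
    using Gamma1_lifting by blast
  \<comment> \<open>These vectors correct the error of M(x n) h against its limit without changing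
    \<open>\<Gamma>\<^sub>0\<close>; the lifting makes them and their images tend to 0.\<close>
  have "\<forall>n. \<exists>w u. A\<^sub>0 w = Some u \<and> \<Gamma>\<^sub>1 w = k - Mn n h \<and>
      norm w \<le> C' * norm (k - Mn n h) \<and> norm u \<le> C' * norm (k - Mn n h)"
    using C' by blast
  then obtain w u where w: "\<And>n. A\<^sub>0 (w n) = Some (u n)" "\<And>n. \<Gamma>\<^sub>1 (w n) = k - Mn n h"
    "\<And>n. norm (w n) \<le> C' * norm (k - Mn n h)" "\<And>n. norm (u n) \<le> C' * norm (k - Mn n h)"
    by metis
  have "(\<lambda>n. C' * norm (k - Mn n h)) \<longlonglongrightarrow> C' * norm (k - k)"
    by (intro tendsto_intros k)
  then have lim0: "(\<lambda>n. C' * norm (k - Mn n h)) \<longlonglongrightarrow> 0"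
    by simp
  have w0: "w \<longlonglongrightarrow> 0"
    by (rule Lim_null_comparison [OF always_eventually lim0]) (simp add: w)
  have u0: "u \<longlonglongrightarrow> 0"
    by (rule Lim_null_comparison [OF always_eventually lim0]) (simp add: w)
  \<comment> \<open>The boundary values cancel: h - h - 0 under \<open>\<Gamma>\<^sub>0\<close>, and
    k minus \<open>Mn n h\<close> minus their difference under \<open>\<Gamma>\<^sub>1\<close>.
    Hence \<open>X n\<close> lies in \<open>dom A\<close>.\<close>
  define X where "X n = g - f n - w n" for n
  have f_adj: "adj A (f n) = Some (of_real (x n) *\<^sub>C f n)" "\<Gamma>\<^sub>0 (f n) = h" "\<Gamma>\<^sub>1 (f n) = Mn n h" for n
    using gamma_field [OF xr] weyl_eq [OF xr] by (simp_all add: f_def Mn_def)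
  have w_adj: "adj A (w n) = Some (u n)" "\<Gamma>\<^sub>0 (w n) = 0" for n
    using w(1) [of n] by (simp_all add: A0_iff)
  have AX: "A (X n) = Some (v - of_real (x n) *\<^sub>C f n - u n)" for n
  proof (rule minimal_operator_eq)
    note gf = adj_linear(4) [OF g(1) f_adj(1), of n]
    show "adj A (X n) = Some (v - of_real (x n) *\<^sub>C f n - u n)"
      unfolding X_def by (rule adj_linear(4) [OF gf w_adj(1)])
    show "\<Gamma>\<^sub>0 (X n) = 0" "\<Gamma>\<^sub>1 (X n) = 0"
      unfolding X_def Gamma_linear(5,6) [OF gf w_adj(1)] Gamma_linear(5,6) [OF g(1) f_adj(1)]
      by (simp_all add: g f_adj w_adj w(2))
  qed
  have Xg: "X \<longlonglongrightarrow> g"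
  proof -
    have "(\<lambda>n. g - f n - w n) \<longlonglongrightarrow> g - 0 - 0"
      by (intro tendsto_intros f0 w0)
    moreover have "X = (\<lambda>n. g - f n - w n)"
      by (simp add: fun_eq_iff X_def)
    ultimately show ?thesis
      by simp
  qed
  \<comment> \<open>Up to sign, the difference of two terms of \<open>X\<close> is a gamma-field
    part \<open>fa\<close> plus a correction \<open>fb\<close>. Nonnegativity of
    \<open>A\<^sub>0\<close> at \<open>fa - fb\<close> bounds the form of the sum by twice the sum
    of the forms; \<open>form\<close> controls the first and norms control the second.\<close>
  have q_bound: "Re (cinner (the (A (X n - X j))) (X n - X j))
      \<le> 6 * \<bar>\<mu> h n - \<mu> h j\<bar> + 2 * ((norm (u n) + norm (u j)) * (norm (w n) + norm (w j)))" for n j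
  proof -
    define a where "a = of_real (x n) *\<^sub>C f n - of_real (x j) *\<^sub>C f j"
    define fa where "fa = f n - f j"
    define b where "b = u n - u j"
    define fb where "fb = w n - w j"
    have 1: "A\<^sub>0 fa = Some a"
      unfolding a_def fa_def f_def by (rule gamma_field_diff [OF xr xr])
    have 2: "A\<^sub>0 fb = Some b"
      unfolding b_def fb_def by (rule linear_operatorD(4) [OF linear_A0 w(1) w(1)])
    have "0 \<le> Re (cinner (a - b) (fa - fb))"
      using linear_operatorD(4) [OF linear_A0 1 2] nonneg0 unfolding nonneg_operator_iff by blast
    moreover have "Re (cinner (a + b) (fa + fb)) + Re (cinner (a - b) (fa - fb))
        = 2 * Re (cinner a fa) + 2 * Re (cinner b fb)"
      by (simp add: cinner_simps)
    moreover have "Re (cinner a fa) \<le> 3 * \<bar>\<mu> h n - \<mu> h j\<bar>"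
    proof (cases n j rule: linorder_cases)
      case less
      then show ?thesis
        unfolding a_def fa_def by (rule order_trans [OF form]) (intro mult_left_mono abs_ge_self, simp)
    next
      case equal
      then show ?thesis by (simp add: a_def fa_def)
    next
      case greater
      have "cinner a fa = cinner (- a) (- fa)" by simp
      also have "\<dots> = cinner (of_real (x j) *\<^sub>C f j - of_real (x n) *\<^sub>C f n) (f j - f n)"
        by (simp only: a_def fa_def minus_diff_eq)
      finally show ?thesis
        unfolding abs_minus_commute [of "\<mu> h n"]
        by (simp only:) (rule order_trans [OF form [OF greater]], intro mult_left_mono abs_ge_self, simp)
    qed
    moreover have "Re (cinner b fb) \<le> (norm (u n) + norm (u j)) * (norm (w n) + norm (w j))"
    proof -
      have "Re (cinner b fb) \<le> norm b * norm fb"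
        using complex_Re_le_cmod cinner_bound order_trans by blast
      also have "\<dots> \<le> (norm (u n) + norm (u j)) * (norm (w n) + norm (w j))"
        unfolding b_def fb_def by (intro mult_mono norm_triangle_ineq4) auto
      finally show ?thesis .
    qed
    ultimately have "Re (cinner (a + b) (fa + fb)) \<le> 6 * \<bar>\<mu> h n - \<mu> h j\<bar>
        + 2 * ((norm (u n) + norm (u j)) * (norm (w n) + norm (w j)))"
      by linarith
    moreover have "X n - X j = - (fa + fb)"
      by (simp add: X_def fa_def fb_def)
    moreover have "the (A (X n - X j)) = - (a + b)"
      using linear_operatorD(4) [OF lin AX AX, of n j] by (simp add: a_def b_def)
    ultimately show ?thesis
      by (simp only: cinner_minus_left cinner_minus_right minus_minus)
  qed
  have "form_approx A X g"
    unfolding form_approx_def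
  proof (intro conjI allI impI)
    show "range X \<subseteq> dom A"
      using AX by blast
    show "X \<longlonglongrightarrow> g" by (rule Xg)
    fix r :: real
    assume "0 < r"
    \<comment> \<open>With this choice 6 r/20 + 2 (d + d) (1 + 1) is at most 14 r/20, below
      \<open>r\<close>; the minimum with 1 bounds the norms of the corrections
      \<open>w\<close>.\<close>
    define d where "d = min 1 (r / 20)"
    have d: "0 < d" "d \<le> 1" "d \<le> r / 20"
      using \<open>0 < r\<close> by (simp_all add: d_def)
    have "0 < r / 20" using \<open>0 < r\<close> by simp
    then obtain N1 where N1: "\<And>m n. m \<ge> N1 \<Longrightarrow> n \<ge> N1 \<Longrightarrow> \<bar>\<mu> h m - \<mu> h n\<bar> < r / 20"
      using \<mu>_Cauchy by meson
    obtain N2 where N2: "\<And>n. n \<ge> N2 \<Longrightarrow> norm (w n) < d"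
      using LIMSEQ_D [OF w0 d(1)] by auto
    obtain N3 where N3: "\<And>n. n \<ge> N3 \<Longrightarrow> norm (u n) < d"
      using LIMSEQ_D [OF u0 d(1)] by auto
    show "\<exists>N. \<forall>m\<ge>N. \<forall>n\<ge>N. cmod (cinner (the (A (X m - X n))) (X m - X n)) < r"
    proof (intro exI allI impI)
      fix i j
      assume ij: "i \<ge> max N1 (max N2 N3)" "j \<ge> max N1 (max N2 N3)"
      have A: "A (X i - X j) = Some (the (A (X i - X j)))"
        using linear_operatorD(4) [OF lin AX AX, of i j] by simp
      then have "0 \<le> Re (cinner (the (A (X i - X j))) (X i - X j))"
        "Im (cinner (the (A (X i - X j))) (X i - X j)) = 0"
        using nonneg unfolding nonneg_operator_iff by blast+
      then have "cmod (cinner (the (A (X i - X j))) (X i - X j))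
          = Re (cinner (the (A (X i - X j))) (X i - X j))"
        by (simp add: cmod_eq_Re)
      also have "\<dots> \<le> 6 * \<bar>\<mu> h i - \<mu> h j\<bar>
          + 2 * ((norm (u i) + norm (u j)) * (norm (w i) + norm (w j)))"
        by (rule q_bound)
      also have "(norm (u i) + norm (u j)) * (norm (w i) + norm (w j)) \<le> (d + d) * (1 + 1)"
        using ij d N2 [of i] N2 [of j] N3 [of i] N3 [of j]
        by (intro mult_mono add_mono) auto
      finally show "cmod (cinner (the (A (X i - X j))) (X i - X j)) < r"
        using N1 [of i j] ij d \<open>0 < r\<close> by simp
    qed
  qed
  then have "A\<^sub>F g = Some v"
    using g(1) by (auto simp: friedrichs_extension_iff closed_form_dom_def)
  then show ?thesis
    using that g(2) by blast
qed

text \<open>For the sum, subtract from \<open>f\<close> a vector of \<open>A\<^sub>F\<close> with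
  the same \<open>\<Gamma>\<^sub>0\<close>. For the intersection, Green's identity against
  \<open>g\<close> with \<open>\<Gamma>\<^sub>0 g = \<Gamma>\<^sub>1 f\<close> yields the squared
  norm of \<open>\<Gamma>\<^sub>1 f\<close>, which vanishes by symmetry of
  \<open>A\<^sub>F\<close>.\<close>

lemma transversalI:
  assumes ex: "\<And>h. \<exists>g v. A\<^sub>F g = Some v \<and> \<Gamma>\<^sub>0 g = h"
  shows "transversal A A\<^sub>0 A\<^sub>F"
proof -
  have "dom A \<subseteq> dom A\<^sub>0" "dom A \<subseteq> dom A\<^sub>F"
    using proper_A0 friedrichs_proper map_le_implies_dom_le unfolding proper_extension_def by blast+
  moreover have "f \<in> dom A" if f: "f \<in> dom A\<^sub>0" "f \<in> dom A\<^sub>F" for f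
  proof -
    obtain u where u: "A\<^sub>F f = Some u"
      using f(2) by blast
    have f0: "\<Gamma>\<^sub>0 f = 0"
      using f(1) A0_iff by blast
    obtain g v where g: "A\<^sub>F g = Some v" "\<Gamma>\<^sub>0 g = \<Gamma>\<^sub>1 f"
      using ex by blast
    have "cinner (\<Gamma>\<^sub>1 f) (\<Gamma>\<^sub>1 f) = 0"
      using green [OF AF_adj [OF u] AF_adj [OF g(1)]] symmetric_friedrichs [OF u g(1)]
      by (simp add: f0 g)
    then have "A f = Some u"
      using minimal_operator_eq [OF AF_adj [OF u]] f0 by simp
    then show ?thesis by blast
  qed
  moreover have "f \<in> dom (adj A) \<longleftrightarrow> f \<in> {f + g | f g. f \<in> dom A\<^sub>0 \<and> g \<in> dom A\<^sub>F}" for f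
  proof
    assume "f \<in> dom (adj A)"
    then obtain u where u: "adj A f = Some u" by blast
    obtain g v where g: "A\<^sub>F g = Some v" "\<Gamma>\<^sub>0 g = \<Gamma>\<^sub>0 f"
      using ex by blast
    have "A\<^sub>0 (f - g) = Some (u - v)"
      using adj_linear(4) [OF u AF_adj [OF g(1)]] Gamma_linear(5) [OF u AF_adj [OF g(1)]] g(2)
      by (simp add: A0_iff)
    then show "f \<in> {f + g | f g. f \<in> dom A\<^sub>0 \<and> g \<in> dom A\<^sub>F}"
      using g(1) by (intro CollectI exI [of _ "f - g"] exI [of _ g]) auto
  next
    assume "f \<in> {f + g | f g. f \<in> dom A\<^sub>0 \<and> g \<in> dom A\<^sub>F}"
    then obtain a b g v where "f = a + g" "A\<^sub>0 a = Some b" "A\<^sub>F g = Some v"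
      by auto
    then show "f \<in> dom (adj A)"
      using adj_linear(3) [OF _ AF_adj, of a b g v] by (auto simp: A0_iff)
  qed
  ultimately show ?thesis
    unfolding transversal_def using proper_A0 friedrichs_proper by blast
qed

lemma S_hat_imp_transversal:
  assumes "in_class_S_hat (resolvent_set A\<^sub>0) M"
  shows "nonneg_operator A\<^sub>0 \<and> transversal A A\<^sub>0 A\<^sub>F"
proof -
  obtain F K where F: "F \<in> class_S" and K: "bounded_clinear K" "bounded_adjoint K = K"
    and M_eq: "\<And>z h. z \<in> resolvent_set A\<^sub>0 - \<real>\<^sub>\<ge>\<^sub>0 \<Longrightarrow> M z h = F z h + K h"
    using assms unfolding in_class_S_hat_def by blast
  have res: "of_real x \<in> resolvent_set A\<^sub>0" if "x < 0" for x
    by (rule S_hat_negative_resolvent [OF F K M_eq that])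
  then have nonneg0: "nonneg_operator A\<^sub>0"
    by (rule negative_resolvents_imp_nonneg [OF symmetric_A0])
  \<comment> \<open>Nonnegativity of F(x) says that \<open>K\<close> is a lower bound for M(x), as
    \<open>Gamma0_friedrichs_surj\<close> requires.\<close>
  have lower: "Re (cinner (K h) h) \<le> Re (cinner (M (of_real x) h) h)" if "x < 0" for x h
  proof -
    have "M (of_real x) h = F (of_real x) h + K h"
      using that res by (intro M_eq) (simp add: complex_nonneg_Reals_iff)
    moreover have "0 \<le> Re (cinner (F (of_real x) h) h)"
      using F that by (simp add: class_S_def bounded_nonneg_def complex_nonneg_Reals_iff)
    ultimately show ?thesis
      by (simp add: cinner_simps)
  qed
  have "\<exists>g v. A\<^sub>F g = Some v \<and> \<Gamma>\<^sub>0 g = h" for h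
    using Gamma0_friedrichs_surj [OF nonneg0 K(1) lower] by metis
  then show ?thesis
    using nonneg0 transversalI by blast
qed

end

theorem theorem5p6:
  fixes A :: "'a::complex_hilbert \<rightharpoonup> 'a"
    and \<Gamma>\<^sub>0 \<Gamma>\<^sub>1 :: "'a \<Rightarrow> 'b::complex_hilbert"
  assumes "separable_space (euclidean :: 'a topology)"
    and "linear_operator A"
    and "closed_operator A"
    and "densely_defined A"
    and "symmetric_operator A"
    and "nonneg_operator A"
    and "boundary_triplet A \<Gamma>\<^sub>0 \<Gamma>\<^sub>1"
  defines "A\<^sub>0 \<equiv> kernel_extension A \<Gamma>\<^sub>0"
  shows "in_class_S_hat (resolvent_set A\<^sub>0) (weyl_function A \<Gamma>\<^sub>0 \<Gamma>\<^sub>1) \<longleftrightarrow>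
         nonneg_operator A\<^sub>0 \<and> transversal A A\<^sub>0 (friedrichs_extension A)"
proof -
  interpret nonneg_boundary_triplet A \<Gamma>\<^sub>0 \<Gamma>\<^sub>1
    using assms by unfold_locales
  show ?thesis
    unfolding A\<^sub>0_def using S_hat_imp_transversal transversal_imp_S_hat by blast
qed

end
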